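(* Let $P(z)=\frac14(z+2z^2+z^3)$, let $\rho(x)$, $x\ge0$, be the rescaled limit density of the disordered stochastic compression model started from the homogeneous chain (all weights $1$), and let $\Pi$ and $\Psi$ be the Poincaré-type and Schröder-type functions of $P$ at the fixed point $1$ (all defined in the context). Then $$\rho(x)=x\,\sigma(\log_2x)+o(x),\qquad x\to0^+,$$ where $\sigma$ is the $1$-periodic continuous function defined by $$\sigma(x)=2^{-x}\rho(2^x)+\frac{2^{-x}}{4\pi}\int_{-\infty}^{+\infty}H(-\mathbf{i}t2^{x+1})\bigl(2\Pi(\mathbf{i}t)^2+\Pi(\mathbf{i}t)^3\bigr)dt,\qquad x\in\mathbb{R},$$ and where the entire function $H$ satisfies $$H(z)=\sum_{n=2}^{\infty}\frac{z^n}{n!(2^{n-1}-1)},\qquad H(2z)=2H(z)+2(e^z-1-z),\qquad z\in\mathbb{C}.$$ The integral defining $\sigma$ converges, since $\Pi(\mathbf{i}t)=O(|t|^{-2})$ and $H(\mathbf{i}t)=O(|t|\ln|t|)$ as $t\to\pm\infty$, $t\in\mathbb{R}$. Moreover, $$\int_0^1\sigma(x)dx=\frac1{2\ln2}\int_0^1\Psi(z)^2(4z+3z^2)dz=\frac{-1}{\ln2}\int_{-\infty}^0t\bigl(2\Pi(t)^2+\Pi(t)^3\bigr)dt$$ $$=\frac{-1}{\ln2}\int_0^{+\infty}t\,\mathrm{Re}\bigl(2\Pi(\mathbf{i}t)^2+\Pi(\mathbf{i}t)^3\bigr)dt=\frac{-2}{\pi\ln2}\int_0^{+\infty}(\ln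 t)\,t\,\mathrm{Im}\bigl(2\Pi(\mathbf{i}t)^2+\Pi(\mathbf{i}t)^3\bigr)dt,$$ where the integral over $(-\infty,0)$ converges because $\Pi(t)=O(|t|^{-2})$ for large $|t|$ with $\mathrm{Re}\,t\le0$.
   Context: $\mathbf{i}=\sqrt{-1}$. Density $\rho$: for $N\ge0$ let $\rho_i=\rho_{i,N}$ be the densities of cells with weight $i$ after $N$ steps of disordered stochastic compression of the chain $\mathbb{Z}$ with all initial weights $1$; they are the coefficients in $\sum_{i\ge1}\rho_{i,N}z^i=\underbrace{P\circ\cdots\circ P}_{N}(z)$. (In this model, at each step a new cell results from merging one, two or three independent cells of the previous chain with probabilities $\frac14,\frac12,\frac14$.) The rescaled density is $$\rho(x)=\lim_{N\to\infty}2^N\rho_{[x2^N],N},\qquad x\in[0,\infty),$$ where $[a]$ is the integer part of $a$ and $\rho_{0,N}=0$. Its characteristic function is $\int_0^\infty e^{\mathbf{i}tx}\rho(x)dx=\Pi(\mathbf{i}t)$, and equivalently $$\rho(x)=\frac1{2\pi}\int_{-\infty}^{\infty}e^{-\mathbf{i}tx}\Pi(\mathbf{i}t)dt.$$ Function $\Pi$: the entire function $$\Pi(z)=\lim_{N\to\infty}\underbrace{P\circ\cdots\circ P}_{N}\Bigl(1+\frac z{2^N}\Bigr),$$ which satisfies $P(\Pi(z))=\Pi(2z)$, $\Pi(0)=1$, $\Pi'(0)=1$. Function $\Psi$: let $P^{-1}$ be the branch of the inverse of $P$ with $P^{-1}(1)=1$, which is analytic and injective on $\mathbb{C}\setminus(-\infty,0]$.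 Then $$\Psi(z)=\lim_{N\to\infty}2^N\bigl(\underbrace{P^{-1}\circ\cdots\circ P^{-1}}_{N}(z)-1\bigr),\qquad z\in\mathbb{C}\setminus(-\infty,0],$$ is analytic, satisfies $\Psi(P(z))=2\Psi(z)$ and $\Psi'(1)=1$, and is locally inverse to $\Pi$. *)

theory Defs
  imports "HOL-Complex_Analysis.Complex_Analysis" "HOL-Library.Landau_Symbols"
begin

definition comp_poly :: "'a::field poly" where
  "comp_poly = [:0, 1/4, 1/2, 1/4:]"

definition comp_map :: "complex \<Rightarrow> complex" where
  "comp_map z = 1/4 * (z + 2 * z^2 + z^3)"

lemma poly_comp_poly: "poly comp_poly z = comp_map z"
  by (simp add: comp_poly_def comp_map_def field_simps power2_eq_square power3_eq_cube)

(* The coefficient of z^i in the N-fold composition of P with itself; the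
   identity polynomial [:0, 1:] (N = 0) encodes the homogeneous chain. *)
definition cell_density :: "nat \<Rightarrow> nat \<Rightarrow> real" where
  "cell_density i N = coeff ((pcompose comp_poly ^^ N) [:0, 1:]) i"

lemma cell_density_0 [simp]: "cell_density 0 N = 0"
proof -
  have "poly ((pcompose comp_poly ^^ N) [:0, 1:]) (0::real) = 0"
    by (induction N) (simp_all add: poly_pcompose comp_poly_def)
  then show ?thesis
    by (simp add: cell_density_def poly_0_coeff_0)
qed

definition rescaled_density :: "real \<Rightarrow> real" where
  "rescaled_density x = lim (\<lambda>N. 2^N * cell_density (nat \<lfloor>x * 2^N\<rfloor>) N)"

definition poincare_fn :: "complex \<Rightarrow> complex" where
  "poincare_fn z = lim (\<lambda>N. (comp_map ^^ N) (1 + z / 2^N))"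

(* Both critical values of P, namely 0 and -1/27, lie on the cut (-oo, 0], so
   these conditions determine the branch uniquely on the slit plane.  Its values
   on the cut are arbitrary; they are never used, as the branch maps the slit
   plane into itself. *)
definition comp_inv :: "complex \<Rightarrow> complex" where
  "comp_inv = (SOME g. g holomorphic_on (- \<real>\<^sub>\<le>\<^sub>0) \<and>
                       (\<forall>z \<in> - \<real>\<^sub>\<le>\<^sub>0. comp_map (g z) = z) \<and> g 1 = 1)"

definition schroeder_fn :: "complex \<Rightarrow> complex" where
  "schroeder_fn z = lim (\<lambda>N. 2^N * ((comp_inv ^^ N) z - 1))"

definition H_fn :: "complex \<Rightarrow> complex" where
  "H_fn z = (\<Sum>\<^sub>\<infinity>n\<in>{2..}. z^n / (fact n * (2^(n-1) - 1)))"

definition weight_fn :: "complex \<Rightarrow> complex" where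
  "weight_fn z = 2 * poincare_fn z ^ 2 + poincare_fn z ^ 3"

(* Complex-valued because the integrand is; that the values are real is part of
   the claim. *)
definition sigma_fn :: "real \<Rightarrow> complex" where
  "sigma_fn x =
     of_real (2 powr (-x) * rescaled_density (2 powr x)) +
     of_real (2 powr (-x) / (4 * pi)) *
       (LBINT t. H_fn (- \<i> * of_real (t * 2 powr (x + 1))) * weight_fn (\<i> * of_real t))"

end

theory Submission
  imports Defs "HOL-Probability.Sinc_Integral" "HOL-Probability.Characteristic_Functions"
    "HOL-Real_Asymp.Real_Asymp"
begin

text \<open>
  Since \<open>P\<close> maps the unit disc into itself with \<open>|P(w)| \<le> |w| ((1 + |w|)/2)\<^sup>2\<close>, the iterates decay like
  \<open>4\<^sup>-\<^sup>n\<close> away from the fixed point 1, so that \<open>\<Pi>(z) = O(|z|\<^sup>-\<^sup>2)\<close> on the left half-plane and, by dominated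
  convergence in Cauchy's coefficient formula, \<open>\<rho>\<close> is the Fourier inverse of \<open>\<Pi>\<close>. The functional equation
  of \<open>\<Pi>\<close> says that \<open>w(x) = 2 \<rho>(x/2) - \<rho>(x)\<close> is the Fourier inverse of \<open>W = 2 \<Pi>\<^sup>2 + \<Pi>\<^sup>3\<close>. As \<open>w\<close> vanishes
  on the negative half-line, \<open>\<integral> W(it) dt = \<integral> t W(it) dt = 0\<close>, and with the functional equation of \<open>H\<close> the
  integral term \<open>S(x)\<close> of \<open>x \<sigma>(log\<^sub>2 x)\<close> satisfies \<open>S(2x) = 2 S(x) + w(2x)\<close>, which gives periodicity, while
  \<open>|H(iu)| \<le> u\<^sup>2\<close> gives \<open>S(x) = O(x\<^sup>2)\<close>.

  For the mean of \<open>\<sigma>\<close>, telescoping shows that it equals \<open>\<integral> 2\<^sup>-\<^sup>x w(2\<^sup>x) dx\<close>. Because \<open>w(-y) = 0\<close> for \<open>y > 0\<close>,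
  \<open>w(y)\<close> is a pure cosine integral of \<open>W(it)\<close>, and Fubini reduces the mean to \<open>\<integral> |t| W(it) dt\<close>. The remaining
  formulas follow by rotating the contour in the second quadrant (for \<open>z W(z)\<close> and for \<open>z W(z) Ln(-z)\<close>) and by
  the substitution \<open>z = \<Pi>(t)\<close>, \<open>t = \<Psi>(z)\<close> on \<open>(0, 1)\<close>.
\<close>

section \<open>The Poincare function\<close>

text \<open>The obstacle is uniformity in the number of iterations. P is expanding at 1 (P'(1) = 2)
  and contracting, with rate P'(0) = 1/4, on the rest of the closed unit disc, so no single estimate
  covers a whole orbit. Near 1 the orbit of 1 + u is controlled while 2^N |u| stays small; away from
  1 compactness and contraction take over. Doubling glues the regimes: a point far out is 2^k w with
  w in a fixed small half-annulus, the limit is used only at w, and the remaining k steps contract.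
  The coefficient formula integrates over the full circle, that is over |t| \<le> pi 2^N, where
  t/2^N is not small and convergence to the limit says nothing; a majorant uniform in N up to that
  endpoint is the main estimate. In the mean of sigma, 1/ln 2 comes from dx = dy/(y ln 2) for y = t
  2^x and pi/2 from the Dirichlet integral. The kernel there must be 1 - cos rather than cos, since
  2^-x cos(t 2^x) is not integrable at x = -\<infinity>.\<close>

lemma comp_map_1 [simp]: "comp_map 1 = 1"
  by (simp add: comp_map_def)

lemma comp_map_factor: "comp_map z = z * (1 + z)\<^sup>2 / 4"
  by (simp add: comp_map_def field_simps power2_eq_square power3_eq_cube)

lemma comp_map_one_plus: "comp_map (1 + u) = 1 + 2 * u + 5/4 * u^2 + u^3/4"
  by (simp add: comp_map_def field_simps power2_eq_square power3_eq_cube)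

lemma holomorphic_comp_map_pow: "(comp_map ^^ N) holomorphic_on A"
proof (induction N)
  case (Suc N)
  then show ?case
    unfolding funpow.simps comp_def comp_map_def by (intro holomorphic_intros)
qed (simp add: id_def)

lemma continuous_comp_map_pow: "continuous_on A (comp_map ^^ N)"
  by (intro holomorphic_on_imp_continuous_on holomorphic_comp_map_pow)

lemma tendsto_comp_map_pow:
  "(f \<longlongrightarrow> l) F \<Longrightarrow> ((\<lambda>x. (comp_map ^^ N) (f x)) \<longlongrightarrow> (comp_map ^^ N) l) F"
  using continuous_comp_map_pow[of UNIV N]
  by (metis UNIV_I continuous_on_eq_continuous_at isCont_tendsto_compose open_UNIV)

text \<open>Coefficientwise comparison with m(R) = 2R/(1-R) = 2R + 2R^2 + ...: the coefficients 2,
  5/4, 1/4 of P(1+u) - 1 are at most 2. The Lipschitz constant is m'(R) = 2/(1-R)^2.\<close>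

lemma comp_map_near_1:
  assumes "norm u \<le> R" "norm v \<le> R" "R < 1"
  shows "norm (comp_map (1 + u) - comp_map (1 + v)) \<le> 2 * norm (u - v) / (1 - R)^2"
    and "norm (comp_map (1 + u) - 1) \<le> 2 * R / (1 - R)"
proof -
  have R0: "0 \<le> R" using assms(1) norm_ge_zero order_trans by blast
  have e: "comp_map (1 + u) - comp_map (1 + v)
      = (u - v) * (2 + 5/4 * (u + v) + 1/4 * (u * u + u * v + v * v))"
    by (simp add: comp_map_one_plus field_simps power2_eq_square power3_eq_cube)
  have s: "norm (u + v) \<le> 2 * R" using norm_triangle_ineq[of u v] assms by linarith
  have m: "norm (x * y) \<le> R * R" if "norm x \<le> R" "norm y \<le> R" for x y :: complex
    using that R0 by (simp add: norm_mult mult_mono)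
  have q: "norm (u * u + u * v + v * v) \<le> 3 * (R * R)"
    using norm_triangle_ineq[of "u * u + u * v" "v * v"] norm_triangle_ineq[of "u * u" "u * v"]
      m[of u u] m[of u v] m[of v v] assms by linarith
  have "norm (2 + 5/4 * (u + v) + 1/4 * (u * u + u * v + v * v))
       \<le> norm (2::complex) + norm (5/4 * (u + v)) + norm (1/4 * (u * u + u * v + v * v))"
    by (intro norm_triangle_le add_mono norm_triangle_ineq order_refl)
  also have "\<dots> = 2 + 5/4 * norm (u + v) + 1/4 * norm (u * u + u * v + v * v)"
    by (simp only: norm_mult) simp
  also have "\<dots> \<le> 2 + 5/2 * R + 3/4 * (R * R)" using s q by linarith
  also have "\<dots> \<le> 2 / (1 - R)^2"
  proof -
    have "(2 + 5/2 * R + 3/4 * (R * R)) * (1 - R)^2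
        = 2 - 3/2 * R - 9/4 * R^2 + R^2 * R + 3/4 * (R^2 * R^2)"
      by (simp add: field_simps power2_eq_square)
    moreover have "R^2 * R \<le> R^2 * 1" using assms R0 by (intro mult_left_mono) auto
    moreover have "R^2 * R^2 \<le> R^2 * 1" using assms R0
      by (intro mult_left_mono) (auto simp: power_le_one)
    moreover have "0 \<le> R^2" by simp
    ultimately have "(2 + 5/2 * R + 3/4 * (R * R)) * (1 - R)^2 \<le> 2"
      using R0 by linarith
    then show ?thesis using assms by (simp add: pos_le_divide_eq)
  qed
  finally have "norm (u - v) * norm (2 + 5/4 * (u + v) + 1/4 * (u * u + u * v + v * v))
      \<le> norm (u - v) * (2 / (1 - R)^2)" by (intro mult_left_mono) auto
  then show "norm (comp_map (1 + u) - comp_map (1 + v)) \<le> 2 * norm (u - v) / (1 - R)^2"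
    unfolding e norm_mult by (simp add: mult.commute)
  have e2: "comp_map (1 + u) - 1 = 2 * u + 5/4 * (u * u) + 1/4 * (u * u * u)"
    by (simp add: comp_map_one_plus field_simps power2_eq_square power3_eq_cube)
  have "norm (2 * u + 5/4 * (u * u) + 1/4 * (u * u * u))
      \<le> norm (2 * u) + norm (5/4 * (u * u)) + norm (1/4 * (u * u * u))"
    by (intro norm_triangle_le add_mono norm_triangle_ineq order_refl)
  also have "\<dots> = 2 * norm u + 5/4 * (norm u * norm u) + 1/4 * (norm u * norm u * norm u)"
    by (simp add: norm_mult norm_divide)
  also have "\<dots> \<le> 2 * R + 5/4 * (R * R) + 1/4 * (R * R * R)"
    using assms R0 by (intro add_mono mult_mono) auto
  also have "\<dots> \<le> 2 * R / (1 - R)"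
  proof -
    have "(2 * R + 5/4 * (R * R) + 1/4 * (R * R * R)) * (1 - R)
        = 2 * R - (3/4 * R^2 + R^2 * R + 1/4 * R^2 * R^2)"
      by (simp add: field_simps power2_eq_square)
    moreover have "0 \<le> 3/4 * R^2 + R^2 * R + 1/4 * R^2 * R^2" using R0 by simp
    ultimately show ?thesis using assms by (simp add: pos_le_divide_eq)
  qed
  finally show "norm (comp_map (1 + u) - 1) \<le> 2 * R / (1 - R)" unfolding e2 .
qed

text \<open>The majorant \<open>u \<mapsto> 2u/(1-u)\<close> of \<open>P(1+u) - 1\<close> is a Moebius map, so its iterates are explicit.\<close>

lemma comp_map_pow_near_1:
  assumes "norm u \<le> r" "norm v \<le> r" "(2^N - 1) * r < 1"
  shows "norm ((comp_map ^^ N) (1 + u) - (comp_map ^^ N) (1 + v))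
           \<le> 2^N * norm (u - v) / (1 - (2^N - 1) * r)^2"
    and "norm ((comp_map ^^ N) (1 + u) - 1) \<le> 2^N * r / (1 - (2^N - 1) * r)"
proof -
  have r0: "0 \<le> r" using assms(1) norm_ge_zero order_trans by blast
  \<comment> \<open>The Lipschitz bound for one more step needs both orbits to stay within R of 1,
    so the three bounds go through one induction.\<close>
  have "norm ((comp_map ^^ N) (1 + u) - (comp_map ^^ N) (1 + v))
           \<le> 2^N * norm (u - v) / (1 - (2^N - 1) * r)^2 \<and>
        norm ((comp_map ^^ N) (1 + u) - 1) \<le> 2^N * r / (1 - (2^N - 1) * r) \<and>
        norm ((comp_map ^^ N) (1 + v) - 1) \<le> 2^N * r / (1 - (2^N - 1) * r)"
    using assms(3)
  proof (induction N)
    case 0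
    then show ?case using assms by simp
  next
    case (Suc N)
    define D where "D = 1 - (2^N - 1) * r"
    define D' where "D' = 1 - (2^Suc N - 1) * r"
    define R where "R = 2^N * r / D"
    have D': "D' > 0" using Suc.prems by (simp add: D'_def)
    have DD: "D' = D - 2^N * r" by (simp add: D_def D'_def algebra_simps)
    have "0 \<le> 2^N * r" using r0 by simp
    then have D: "D > 0" using D' DD by linarith
    have IH: "norm ((comp_map ^^ N) (1 + u) - (comp_map ^^ N) (1 + v)) \<le> 2^N * norm (u - v) / D^2"
        "norm ((comp_map ^^ N) (1 + u) - 1) \<le> R"
        "norm ((comp_map ^^ N) (1 + v) - 1) \<le> R"
      using Suc.IH D unfolding D_def R_def by auto
    \<comment> \<open>The recursion D' = D - 2^N r of the denominators is what turns 2R/(1-R) into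
      the next Moebius iterate 2^(N+1) r / D'.\<close>
    have R1: "1 - R = D' / D" using D by (simp add: R_def DD field_simps)
    then have "R < 1" using D D' by (metis diff_gt_0_iff_gt divide_pos_pos)
    note near = comp_map_near_1[OF _ _ this]
    have a: "2 * R / (1 - R) = 2^Suc N * r / D'"
      using D D' unfolding R1 by (simp add: R_def)
    have "norm ((comp_map ^^ Suc N) (1 + u) - (comp_map ^^ Suc N) (1 + v))
        \<le> 2 * norm ((comp_map ^^ N) (1 + u) - (comp_map ^^ N) (1 + v)) / (1 - R)^2"
      using near(1)[OF IH(2,3)] by simp
    also have "\<dots> \<le> 2 * (2^N * norm (u - v) / D^2) / (1 - R)^2"
      using IH(1) by (intro divide_right_mono mult_left_mono) auto
    also have "\<dots> = 2^Suc N * norm (u - v) / D'^2"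
      using D D' unfolding R1 by (simp add: field_simps)
    finally show ?case
      using near(2)[OF IH(2,2)] near(2)[OF IH(3,3)] a by (simp add: D'_def)
  qed
  then show "norm ((comp_map ^^ N) (1 + u) - (comp_map ^^ N) (1 + v))
           \<le> 2^N * norm (u - v) / (1 - (2^N - 1) * r)^2"
    and "norm ((comp_map ^^ N) (1 + u) - 1) \<le> 2^N * r / (1 - (2^N - 1) * r)"
    by auto
qed

text \<open>The condition 2^N r \<le> 1/2 keeps the Moebius denominator at least 1/2; its square in
  the derivative gives the factor 4.\<close>

lemma comp_map_pow_lipschitz:
  assumes "norm u \<le> r" "norm v \<le> r" "2^N * r \<le> 1/2"
  shows "norm ((comp_map ^^ N) (1 + u) - (comp_map ^^ N) (1 + v)) \<le> 4 * 2^N * norm (u - v)"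
proof -
  have r0: "0 \<le> r" using assms(1) norm_ge_zero order_trans by blast
  have h: "(2^N - 1) * r \<le> 1/2" using assms(3) r0 by (simp add: algebra_simps)
  then have "norm ((comp_map ^^ N) (1 + u) - (comp_map ^^ N) (1 + v))
      \<le> 2^N * norm (u - v) / (1 - (2^N - 1) * r)^2"
    using assms by (intro comp_map_pow_near_1) auto
  also have "\<dots> \<le> 2^N * norm (u - v) / (1/2)^2"
    using h by (intro divide_left_mono power_mono mult_pos_pos) auto
  finally show ?thesis by (simp add: power2_eq_square)
qed

text \<open>The explicit error is what matters: it yields uniform convergence near 0, hence
  holomorphy of the limit, and with N = 0 the expansion \<open>poincare_near_0\<close>.\<close>

lemma geometric_cauchy_limit:
  fixes x :: "nat \<Rightarrow> 'a::banach"
  assumes "\<And>N. norm (x (Suc N) - x N) \<le> c / 2^N"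
  shows "\<exists>L. x \<longlonglongrightarrow> L \<and> (\<forall>N. norm (x N - L) \<le> 2 * c / 2^N)"
proof -
  have c0: "0 \<le> c" using order_trans[OF norm_ge_zero assms[of 0]] by simp
  have step: "norm (x (N + k) - x N) \<le> 2 * c / 2^N * (1 - 1 / 2^k)" for N k
  proof (induction k)
    case (Suc k)
    have "norm (x (N + Suc k) - x N) \<le> norm (x (Suc (N + k)) - x (N + k)) + norm (x (N + k) - x N)"
      using norm_triangle_ineq[of "x (Suc (N + k)) - x (N + k)" "x (N + k) - x N"] by simp
    also have "\<dots> \<le> c / 2^(N + k) + 2 * c / 2^N * (1 - 1 / 2^k)"
      by (intro add_mono assms Suc)
    also have "\<dots> = 2 * c / 2^N * (1 - 1 / 2^Suc k)"
      by (simp add: field_simps power_add)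
    finally show ?case .
  qed simp
  have bnd: "norm (x (N + k) - x N) \<le> 2 * c / 2^N" for N k
  proof -
    have "2 * c / 2^N * (1 - 1 / 2^k) \<le> 2 * c / 2^N * 1"
      using c0 by (intro mult_left_mono) auto
    then show ?thesis using step[of N k] by simp
  qed
  have lim0: "(\<lambda>N. 2 * c / 2^N) \<longlonglongrightarrow> 0"
    using tendsto_mult_right_zero[OF LIMSEQ_inverse_realpow_zero[of 2], of "2 * c"]
    by (simp add: field_simps)
  have "Cauchy x"
  proof (rule CauchyI)
    fix e :: real assume "e > 0"
    then obtain M where M: "2 * c / 2^M < e / 2"
      using order_tendstoD(2)[OF lim0, of "e / 2"] by (auto simp: eventually_sequentially)
    have "norm (x m - x n) < e" if "m \<ge> M" "n \<ge> M" for m n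
    proof -
      have "norm (x m - x M) < e / 2" "norm (x n - x M) < e / 2"
        using bnd[of M "m - M"] bnd[of M "n - M"] that M by auto
      then show ?thesis using norm_triangle_ineq4[of "x m - x M" "x n - x M"] by simp
    qed
    then show "\<exists>M. \<forall>m\<ge>M. \<forall>n\<ge>M. norm (x m - x n) < e" by blast
  qed
  then obtain L where L: "x \<longlonglongrightarrow> L" by (auto simp: Cauchy_convergent_iff convergent_def)
  have "norm (x N - L) \<le> 2 * c / 2^N" for N
  proof -
    have "(\<lambda>k. x (k + N) - x N) \<longlonglongrightarrow> L - x N"
      by (rule tendsto_diff[OF LIMSEQ_ignore_initial_segment[OF L] tendsto_const])
    then have "norm (L - x N) \<le> 2 * c / 2^N"
      by (rule Lim_norm_ubound[OF sequentially_bot]) (intro always_eventually allI, metis bnd add.commute)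
    then show ?thesis by (simp add: norm_minus_commute)
  qed
  then show ?thesis using L by blast
qed

text \<open>With y = z/2^(N+1), the first application of P sends 1 + y to 1 + u, where u differs
  from 2y = z/2^N only by O(|y|^2). The other N applications expand this error by at most 4 * 2^N,
  and 2^N |y|^2 is of order |z|^2 / 2^N.\<close>

lemma poincare_approx_step:
  assumes "norm z \<le> 1/4"
  shows "norm ((comp_map ^^ Suc N) (1 + z / 2^Suc N) - (comp_map ^^ N) (1 + z / 2^N))
           \<le> 3/2 * (norm z)^2 / 2^N"
proof -
  define y where "y = z / 2^Suc N"
  define u where "u = 2 * y + 5/4 * y^2 + y^3/4"
  have ny: "norm y = norm z / 2^Suc N" by (simp add: y_def norm_divide norm_power norm_mult)
  have y2: "2 * y = z / 2^N" by (simp add: y_def)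
  have ny1: "norm y \<le> 1/8"
  proof -
    have "norm z / 2^Suc N \<le> (1/4) / 2" using assms
      by (intro frac_le) (auto simp: self_le_power)
    then show ?thesis using ny by simp
  qed
  have "norm (u - 2 * y) = norm (y^2 * (5/4 + y/4))"
    by (simp add: u_def field_simps power2_eq_square power3_eq_cube)
  also have "\<dots> \<le> (norm y)^2 * (3/2)"
  proof -
    have "norm (5/4 + y/4) \<le> 3/2"
      using ny1 norm_triangle_ineq[of "5/4" "y/4"] by (simp add: norm_divide)
    then have "(norm y)^2 * norm (5/4 + y/4) \<le> (norm y)^2 * (3/2)" by (rule mult_left_mono) simp
    then show ?thesis by (simp only: norm_mult norm_power)
  qed
  finally have d: "norm (u - 2 * y) \<le> 3/2 * (norm y)^2" by simp
  also have "\<dots> \<le> norm y"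
    using mult_right_mono[OF ny1 norm_ge_zero[of y]] norm_ge_zero[of y]
    unfolding power2_eq_square by linarith
  finally have "norm (u - 2 * y) \<le> norm y" .
  then have nu: "norm u \<le> 4 * norm y"
    using norm_triangle_sub[of u "2 * y"] norm_ge_zero[of y] norm_mult[of 2 y]
    unfolding norm_numeral by linarith
  \<comment> \<open>The left side equals 2 |z|: this is where the radius 1/4 comes from.\<close>
  have r: "2^N * (4 * norm y) \<le> 1/2" using assms by (simp add: ny)
  have "(comp_map ^^ Suc N) (1 + z / 2^Suc N) = (comp_map ^^ N) (1 + u)"
    unfolding y_def[symmetric] funpow_Suc_right comp_def
    by (simp add: comp_map_one_plus u_def add.assoc)
  then have "norm ((comp_map ^^ Suc N) (1 + z / 2^Suc N) - (comp_map ^^ N) (1 + z / 2^N))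
      \<le> 4 * 2^N * norm (u - 2 * y)"
    using comp_map_pow_lipschitz[OF nu _ r, of "2 * y"] by (simp add: y2 norm_mult flip: y2)
  also have "\<dots> \<le> 4 * 2^N * (3/2 * (norm y)^2)" using d by (intro mult_left_mono) auto
  also have "\<dots> = 3/2 * (norm z)^2 / 2^N"
    by (simp add: ny field_simps power2_eq_square)
  finally show ?thesis .
qed

text \<open>Dividing by 2^k moves z into the disc of radius 1/4; the continuous map P^k carries the
  limit found there back to z.\<close>

lemma poincare_convergent: "\<exists>L. (\<lambda>N. (comp_map ^^ N) (1 + z / 2^N)) \<longlonglongrightarrow> L"
proof -
  obtain k where k: "4 * norm z < 2^k" using real_arch_pow[of 2 "4 * norm z"] by auto
  have "norm (z / 2^k) \<le> 1/4" using k by (simp add: norm_divide norm_power field_simps)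
  from geometric_cauchy_limit[OF poincare_approx_step[OF this]]
  obtain L where "(\<lambda>N. (comp_map ^^ N) (1 + z / 2^k / 2^N)) \<longlonglongrightarrow> L" by blast
  then have "(\<lambda>N. (comp_map ^^ k) ((comp_map ^^ N) (1 + z / 2^k / 2^N))) \<longlonglongrightarrow> (comp_map ^^ k) L"
    by (rule tendsto_comp_map_pow)
  then have "(\<lambda>N. (comp_map ^^ (N + k)) (1 + z / 2^(N + k))) \<longlonglongrightarrow> (comp_map ^^ k) L"
    by (simp add: funpow_add power_add mult.commute add.commute[of _ k])
  from LIMSEQ_offset[of "\<lambda>N. (comp_map ^^ N) (1 + z / 2^N)", OF this] show ?thesis by (rule exI)
qed

lemma poincare_lim: "(\<lambda>N. (comp_map ^^ N) (1 + z / 2^N)) \<longlonglongrightarrow> poincare_fn z"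
  using poincare_convergent[of z] unfolding poincare_fn_def
  by (metis convergent_LIMSEQ_iff convergent_def)

lemma poincare_double: "poincare_fn (2 * z) = comp_map (poincare_fn z)"
proof -
  have "(\<lambda>N. (comp_map ^^ Suc N) (1 + 2 * z / 2^Suc N)) \<longlonglongrightarrow> poincare_fn (2 * z)"
    using LIMSEQ_Suc[OF poincare_lim] .
  moreover have "(\<lambda>N. (comp_map ^^ Suc N) (1 + 2 * z / 2^Suc N)) \<longlonglongrightarrow> comp_map (poincare_fn z)"
    using tendsto_comp_map_pow[OF poincare_lim[of z], of 1] by simp
  ultimately show ?thesis by (rule LIMSEQ_unique)
qed

lemma poincare_double_pow: "poincare_fn (2^k * z) = (comp_map ^^ k) (poincare_fn z)"
  by (induction k) (simp_all add: poincare_double mult.assoc)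

lemma poincare_approx:
  assumes "norm z \<le> 1/4"
  shows "norm ((comp_map ^^ N) (1 + z / 2^N) - poincare_fn z) \<le> 3 * (norm z)^2 / 2^N"
proof -
  from geometric_cauchy_limit[OF poincare_approx_step[OF assms]]
  obtain L where L: "(\<lambda>N. (comp_map ^^ N) (1 + z / 2^N)) \<longlonglongrightarrow> L"
     "norm ((comp_map ^^ N) (1 + z / 2^N) - L) \<le> 2 * (3/2 * (norm z)^2) / 2^N" by blast
  from L(1) have "L = poincare_fn z" using LIMSEQ_unique poincare_lim by blast
  with L(2) show ?thesis by simp
qed

lemma poincare_near_0: "norm z \<le> 1/4 \<Longrightarrow> norm (poincare_fn z - 1 - z) \<le> 3 * (norm z)^2"
  using poincare_approx[of z 0] by (simp add: norm_minus_commute diff_diff_eq)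

lemma poincare_0 [simp]: "poincare_fn 0 = 1"
  using poincare_near_0[of 0] by simp

lemma holomorphic_poincare [holomorphic_intros]:
  assumes "f holomorphic_on A" shows "(\<lambda>z. poincare_fn (f z)) holomorphic_on A"
proof -
  have small: "poincare_fn holomorphic_on ball 0 (1/4)"
  proof (rule holomorphic_uniform_sequence)
    show "(\<lambda>z. (comp_map ^^ N) (1 + z / 2^N)) holomorphic_on ball 0 (1/4)" for N
    proof -
      have "((comp_map ^^ N) \<circ> (\<lambda>z. 1 + z / 2^N)) holomorphic_on ball 0 (1/4)"
        by (intro holomorphic_on_compose holomorphic_comp_map_pow holomorphic_intros) auto
      then show ?thesis by (simp add: comp_def)
    qed
    fix x :: complex assume "x \<in> ball 0 (1/4)"
    then obtain d where d: "0 < d" "cball x d \<subseteq> ball 0 (1/4)"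
      using open_contains_cball open_ball by blast
    have "uniform_limit (cball x d) (\<lambda>N z. (comp_map ^^ N) (1 + z / 2^N)) poincare_fn sequentially"
    proof (rule uniform_limitI)
      fix e :: real assume "e > 0"
      have "(\<lambda>N. (1/2::real)^N) \<longlonglongrightarrow> 0" by (intro LIMSEQ_realpow_zero) auto
      then have "\<forall>\<^sub>F N in sequentially. (1/2::real)^N < e" using \<open>e > 0\<close> by (rule order_tendstoD)
      then show "\<forall>\<^sub>F N in sequentially. \<forall>z\<in>cball x d.
          dist ((comp_map ^^ N) (1 + z / 2^N)) (poincare_fn z) < e"
      proof eventually_elim
        case (elim N)
        show ?case
        proof
          fix z assume "z \<in> cball x d"
          then have z: "norm z \<le> 1/4" using d(2) by force
          then have "(norm z)^2 \<le> (1/4)^2" by (intro power_mono) auto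
          then have "3 * (norm z)^2 / 2^N \<le> 1 / 2^N"
            by (intro divide_right_mono) (auto simp: power2_eq_square)
          then have "norm ((comp_map ^^ N) (1 + z / 2^N) - poincare_fn z) \<le> 1 / 2^N"
            using poincare_approx[OF z, of N] by linarith
          with elim show "dist ((comp_map ^^ N) (1 + z / 2^N)) (poincare_fn z) < e"
            by (simp add: dist_norm power_divide)
        qed
      qed
    qed
    with d show "\<exists>d>0. cball x d \<subseteq> ball 0 (1/4) \<and>
       uniform_limit (cball x d) (\<lambda>N z. (comp_map ^^ N) (1 + z / 2^N)) poincare_fn sequentially"
      by blast
  qed simp
  \<comment> \<open>The functional equation enlarges the disc of holomorphy from radius 1/4 to
    2^k/4.\<close>
  have ball: "poincare_fn holomorphic_on ball 0 (2^k / 4)" for k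
  proof -
    have "((comp_map ^^ k) \<circ> (poincare_fn \<circ> (\<lambda>z. z / 2^k))) holomorphic_on ball 0 (2^k / 4)"
      by (intro holomorphic_on_compose holomorphic_comp_map_pow holomorphic_intros
          holomorphic_on_subset[OF small]) (auto simp: norm_divide norm_power field_simps)
    then show ?thesis by (simp add: comp_def flip: poincare_double_pow)
  qed
  have "poincare_fn field_differentiable at z" for z
  proof -
    obtain k where k: "4 * norm z < 2^k" using real_arch_pow[of 2 "4 * norm z"] by auto
    then show ?thesis
      using holomorphic_on_imp_differentiable_at[OF ball[of k], of z] by auto
  qed
  then have "poincare_fn holomorphic_on UNIV" by (simp add: holomorphic_on_def field_differentiable_at_within)
  then show ?thesis using holomorphic_on_compose_gen[OF assms, of poincare_fn UNIV] by (simp add: comp_def)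
qed

text \<open>Replacing 1 + z/2^N by exp(z/2^N) has two uses: for Re z \<le> 0 the starting point lies
  in the closed unit disc, which P maps into itself, and for z = it it is the point of the unit
  circle that occurs in the coefficient formula. The constant 11 is 8 for the replacement plus 3
  from \<open>poincare_approx\<close>.\<close>

lemma poincare_exp_approx:
  assumes "norm z \<le> 1/8"
  shows "norm ((comp_map ^^ N) (exp (z / 2^N)) - poincare_fn z) \<le> 11 * (norm z)^2 / 2^N"
proof -
  define y where "y = z / 2^N"
  have ny: "norm y = norm z / 2^N" by (simp add: y_def norm_divide norm_power)
  have "norm z / 2^N \<le> (1/8) / 1" using assms by (intro frac_le) auto
  then have y1: "norm y \<le> 1/8" using ny by simp
  have "norm (exp y - (\<Sum>i\<le>1. y ^ i / fact i)) \<le> exp \<bar>Re y\<bar> * (norm y)^(Suc 1) / fact 1"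
    by (rule Taylor_exp)
  also have "\<dots> \<le> 2 * (norm y)^2"
  proof -
    have "exp \<bar>Re y\<bar> \<le> 1 + 2 * \<bar>Re y\<bar>"
      using exp_bound_lemma[of "\<bar>Re y\<bar>"] abs_Re_le_cmod[of y] y1 by simp
    then have "exp \<bar>Re y\<bar> \<le> 2" using abs_Re_le_cmod[of y] y1 by linarith
    then show ?thesis by (auto simp: power2_eq_square intro!: mult_right_mono)
  qed
  finally have d: "norm (exp y - 1 - y) \<le> 2 * (norm y)^2" by (simp add: diff_diff_eq)
  also have "\<dots> \<le> norm y"
    using mult_right_mono[OF y1 norm_ge_zero[of y]] norm_ge_zero[of y]
    unfolding power2_eq_square by linarith
  finally have e1: "norm (exp y - 1) \<le> 4 * norm y"
    using norm_triangle_ineq[of "exp y - 1 - y" y] norm_ge_zero[of y] by (simp del: norm_ge_zero)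
  have "2^N * (4 * norm y) \<le> 1/2" using assms by (simp add: ny)
  from comp_map_pow_lipschitz[OF e1 _ this, of y]
  have "norm ((comp_map ^^ N) (exp y) - (comp_map ^^ N) (1 + y)) \<le> 4 * 2^N * norm (exp y - 1 - y)"
    by simp
  also have "\<dots> \<le> 4 * 2^N * (2 * (norm y)^2)" using d by (intro mult_left_mono) auto
  also have "\<dots> = 8 * (norm z)^2 / 2^N" by (simp add: ny field_simps power2_eq_square)
  finally have "norm ((comp_map ^^ N) (exp y) - (comp_map ^^ N) (1 + y)) \<le> 8 * (norm z)^2 / 2^N" .
  moreover have "norm ((comp_map ^^ N) (1 + y) - poincare_fn z) \<le> 3 * (norm z)^2 / 2^N"
    unfolding y_def using assms by (intro poincare_approx) auto
  ultimately show ?thesis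
    using norm_triangle_ineq[of "(comp_map ^^ N) (exp y) - (comp_map ^^ N) (1 + y)"
        "(comp_map ^^ N) (1 + y) - poincare_fn z"]
    by (simp add: y_def)
qed

lemma poincare_exp_lim: "(\<lambda>N. (comp_map ^^ N) (exp (z / 2^N))) \<longlonglongrightarrow> poincare_fn z"
proof -
  obtain k where k: "8 * norm z < 2^k" using real_arch_pow[of 2 "8 * norm z"] by auto
  define w where "w = z / 2^k"
  have w: "norm w \<le> 1/8" using k by (simp add: w_def norm_divide norm_power field_simps)
  have "(\<lambda>N. (comp_map ^^ N) (exp (w / 2^N))) \<longlonglongrightarrow> poincare_fn w"
  proof (rule LIM_zero_cancel, rule Lim_null_comparison)
    show "\<forall>\<^sub>F N in sequentially. norm ((comp_map ^^ N) (exp (w / 2^N)) - poincare_fn w)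
        \<le> 11 * (norm w)^2 * inverse (2^N)"
      using poincare_exp_approx[OF w] by (simp add: field_simps)
    show "(\<lambda>N. 11 * (norm w)^2 * inverse (2^N)) \<longlonglongrightarrow> 0"
      by (intro tendsto_mult_right_zero LIMSEQ_inverse_realpow_zero) auto
  qed
  then have "(\<lambda>N. (comp_map ^^ k) ((comp_map ^^ N) (exp (w / 2^N)))) \<longlonglongrightarrow> poincare_fn z"
    using tendsto_comp_map_pow[of _ "poincare_fn w" sequentially k]
    by (simp add: w_def flip: poincare_double_pow)
  then have "(\<lambda>N. (comp_map ^^ (N + k)) (exp (z / 2^(N + k)))) \<longlonglongrightarrow> poincare_fn z"
    by (simp add: w_def funpow_add power_add mult.commute add.commute[of _ k])
  then show ?thesis by (rule LIMSEQ_offset)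
qed

section \<open>Decay on the left half-plane\<close>

lemma norm_comp_map_le: "norm (comp_map w) \<le> norm w * (1 + norm w)^2 / 4"
proof -
  have "norm (1 + w) \<le> 1 + norm w" using norm_triangle_ineq[of 1 w] by simp
  then have "norm w * (norm (1 + w))^2 \<le> norm w * (1 + norm w)^2"
    by (intro mult_left_mono power_mono) auto
  then show ?thesis by (simp add: comp_map_factor norm_mult norm_divide norm_power)
qed

lemma norm_comp_map_le_1: "norm w \<le> 1 \<Longrightarrow> norm (comp_map w) \<le> norm w"
proof -
  assume w: "norm w \<le> 1"
  then have "(1 + norm w)^2 \<le> 2^2" by (intro power_mono) auto
  then have "norm w * (1 + norm w)^2 \<le> norm w * 4" by (intro mult_left_mono) auto
  then show ?thesis using norm_comp_map_le[of w] by linarith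
qed

lemma norm_comp_map_pow_le_1: "norm w \<le> 1 \<Longrightarrow> norm ((comp_map ^^ N) w) \<le> norm w"
proof (induction N)
  case (Suc N)
  then show ?case using norm_comp_map_le_1[of "(comp_map ^^ N) w"] by simp
qed simp

text \<open>Equality in |w| |1+w|^2 \<le> 4 forces |1+w| \<ge> 2, hence Re w \<ge> 1. So 1 is the
  only point of the closed disc that P does not send into the open disc.\<close>

lemma norm_comp_map_eq_1:
  assumes "norm w \<le> 1" "norm (comp_map w) = 1" shows "w = 1"
proof -
  have "norm w * (norm (1 + w))^2 = 4"
    using assms(2) by (simp add: comp_map_factor norm_mult norm_divide norm_power)
  moreover have "norm w * (norm (1 + w))^2 \<le> 1 * (norm (1 + w))^2"
    using assms(1) by (intro mult_right_mono) auto
  ultimately have "4 \<le> (norm (1 + w))^2" by simp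
  also have "(norm (1 + w))^2 = 1 + 2 * Re w + (norm w)^2"
    unfolding cmod_power2 by (simp add: power2_eq_square algebra_simps)
  also have "(norm w)^2 \<le> 1" using assms(1) by (simp add: power_le_one)
  finally have "1 \<le> Re w" by simp
  then have "Re w = 1" using complex_Re_le_cmod[of w] assms(1) by linarith
  moreover have "(Re w)^2 + (Im w)^2 \<le> 1"
    using assms(1) by (simp add: power_le_one flip: cmod_power2)
  ultimately show ?thesis by (simp add: complex_eq_iff)
qed

text \<open>Two rates are carried in one induction. The crude rate q^n with q = ((1+r)/2)^2 < 1
  makes the factors (1 + |w_k|)^2 \<le> exp(2 q^k) multiply to a bounded product, which then
  upgrades the decay to the exact rate 4^-n.\<close>

lemma comp_map_pow_decay:
  assumes "r < 1"
  shows "\<exists>C\<ge>0. \<forall>w n. norm w \<le> r \<longrightarrow> norm ((comp_map ^^ n) w) \<le> C / 4^n"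
proof (cases "0 \<le> r")
  case True
  define q where "q = ((1 + r)/2)^2"
  have q1: "q < 1" unfolding q_def using assms True
    by (subst abs_square_less_1) auto
  have q0: "0 \<le> q" by (simp add: q_def)
  have main: "norm ((comp_map ^^ n) w) \<le> exp (2 * (\<Sum>k<n. q^k)) / 4^n \<and> norm ((comp_map ^^ n) w) \<le> q^n"
    if w: "norm w \<le> r" for w n
  proof (induction n)
    case 0
    then show ?case using w assms by simp
  next
    case (Suc n)
    let ?a = "norm ((comp_map ^^ n) w)"
    have ar: "?a \<le> r" using norm_comp_map_pow_le_1[of w n] w assms by linarith
    have b: "norm ((comp_map ^^ Suc n) w) \<le> ?a * (1 + ?a)^2 / 4"
      using norm_comp_map_le by simp
    have "(1 + ?a)^2 \<le> (1 + r)^2" using ar by (intro power_mono) auto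
    then have "?a * (1 + ?a)^2 \<le> q^n * (1 + r)^2"
      using Suc q0 by (intro mult_mono) auto
    then have "norm ((comp_map ^^ Suc n) w) \<le> q^Suc n"
      using b by (simp add: q_def power_divide mult.commute)
    moreover have "norm ((comp_map ^^ Suc n) w) \<le> exp (2 * (\<Sum>k<Suc n. q^k)) / 4^Suc n"
    proof -
      have "1 + ?a \<le> exp (q^n)" using Suc exp_ge_add_one_self[of "q^n"] by linarith
      then have "(1 + ?a)^2 \<le> (exp (q^n))^2" by (intro power_mono) auto
      then have "?a * (1 + ?a)^2 \<le> exp (2 * (\<Sum>k<n. q^k)) / 4^n * (exp (q^n))^2"
        using Suc by (intro mult_mono) auto
      also have "\<dots> = 4 * (exp (2 * (\<Sum>k<Suc n. q^k)) / 4^Suc n)"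
        by (simp add: distrib_left exp_add flip: exp_double)
      finally show ?thesis using b by simp
    qed
    ultimately show ?case by simp
  qed
  have "norm ((comp_map ^^ n) w) \<le> exp (2 * (1 / (1 - q))) / 4^n" if w: "norm w \<le> r" for w n
  proof -
    have "(\<Sum>k<n. q^k) \<le> (\<Sum>k. q^k)"
      using q0 q1 by (intro sum_le_suminf summable_geometric) auto
    also have "\<dots> = 1 / (1 - q)" using q0 q1 by (intro suminf_geometric) auto
    finally have "exp (2 * (\<Sum>k<n. q^k)) / 4^n \<le> exp (2 * (1 / (1 - q))) / 4^n"
      by (intro divide_right_mono) auto
    then show ?thesis using main[OF w, of n] by linarith
  qed
  then show ?thesis by (intro exI[of _ "exp (2 * (1 / (1 - q)))"]) auto
next
  case False
  then have "\<not> norm w \<le> r" for w :: complex using norm_ge_zero[of w] by linarith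
  then show ?thesis by auto
qed

lemma norm_poincare_le_1:
  assumes "Re z \<le> 0" shows "norm (poincare_fn z) \<le> 1"
proof (rule Lim_norm_ubound[OF sequentially_bot poincare_exp_lim])
  have "norm ((comp_map ^^ N) (exp (z / 2^N))) \<le> 1" for N
  proof -
    have "Re (z / 2^N) = Re z / 2^N" using Re_divide_of_real[of z "2^N"] by simp
    then have "norm (exp (z / 2^N)) \<le> 1" using assms by (simp add: divide_le_0_iff)
    then show ?thesis using norm_comp_map_pow_le_1 order_trans by blast
  qed
  then show "\<forall>\<^sub>F N in sequentially. norm ((comp_map ^^ N) (exp (z / 2^N))) \<le> 1" by simp
qed

text \<open>If the norm were 1, the equality case of the disc estimate would propagate down the
  halving sequence and give \<open>poincare_fn (z / 2^k) = 1\<close> for all k \<ge> 1. This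
  contradicts the expansion 1 + y + O(|y|^2) at small y \<noteq> 0.\<close>

lemma norm_poincare_less_1:
  assumes "Re z \<le> 0" "z \<noteq> 0" shows "norm (poincare_fn z) < 1"
proof (rule ccontr)
  assume "\<not> norm (poincare_fn z) < 1"
  then have n1: "norm (poincare_fn z) = 1" using norm_poincare_le_1[OF assms(1)] by linarith
  have Re: "Re (z / 2^k) \<le> 0" for k
    using Re_divide_of_real[of z "2^k"] assms(1) by (simp add: divide_le_0_iff)
  have step: "poincare_fn (z / 2^Suc k) = 1" if "norm (poincare_fn (z / 2^k)) = 1" for k
  proof (rule norm_comp_map_eq_1)
    show "norm (poincare_fn (z / 2^Suc k)) \<le> 1" by (rule norm_poincare_le_1[OF Re])
    show "norm (comp_map (poincare_fn (z / 2^Suc k))) = 1"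
      using that by (simp flip: poincare_double)
  qed
  have "norm (poincare_fn (z / 2^k)) = 1" for k
  proof (induction k)
    case (Suc k)
    then show ?case using step[of k] by simp
  qed (use n1 in simp)
  then have one: "poincare_fn (z / 2^Suc k) = 1" for k using step by blast
  obtain k where k: "4 * norm z < 2^k" using real_arch_pow[of 2 "4 * norm z"] by auto
  define y where "y = z / 2^Suc k"
  have "norm z < 1/4 * (2 * 2^k)" using k norm_ge_zero[of z] by linarith
  then have ny: "norm y < 1/4"
    by (simp add: y_def norm_divide norm_mult norm_power field_simps)
  have y0: "norm y > 0" using assms by (simp add: y_def)
  have "norm y \<le> 3 * (norm y)^2" using poincare_near_0[of y] ny one[of k] by (simp add: y_def)
  also have "\<dots> < 3 * (norm y * (1/3))"
    using y0 ny unfolding power2_eq_square by (intro mult_strict_left_mono) auto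
  finally show False by simp
qed

lemma dyadic_scale:
  fixes x :: real
  assumes "1/8 \<le> x"
  obtains k :: nat and y where "x = 2^k * y" "1/16 \<le> y" "y \<le> 1/8"
proof -
  have ex: "\<exists>n. 8 * x \<le> 2^n" using real_arch_pow[of 2 "8 * x"] by (auto intro: less_imp_le)
  define n where "n = (LEAST n. 8 * x \<le> 2^n)"
  have n: "8 * x \<le> 2^n" unfolding n_def using ex by (rule LeastI_ex)
  have "2^n \<le> 16 * x"
  proof (cases n)
    case (Suc m)
    have "\<not> 8 * x \<le> 2^m" using not_less_Least[of m "\<lambda>n. 8 * x \<le> 2^n"] Suc
      by (simp add: n_def)
    then show ?thesis by (simp add: Suc)
  qed (use assms in simp)
  with n show ?thesis by (intro that[of n "x / 2^n"]) (auto simp: field_simps)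
qed

text \<open>A fundamental domain for doubling in the closed left half-plane without 0. The outer
  radius 1/8 is the radius of validity of \<open>poincare_exp_approx\<close>; compactness makes the
  bound below 1 uniform.\<close>

definition half_annulus :: "complex set" where
  "half_annulus = {z. Re z \<le> 0 \<and> 1/16 \<le> norm z \<and> norm z \<le> 1/8}"

lemma poincare_half_annulus: "\<exists>r<1. \<forall>z\<in>half_annulus. norm (poincare_fn z) \<le> r"
proof -
  have eq: "half_annulus = cball 0 (1/8) \<inter> {z. Re z \<le> 0} \<inter> {z. 1/16 \<le> norm z}"
    by (auto simp: half_annulus_def)
  have "closed {z::complex. 1/16 \<le> norm z}"
    by (intro closed_Collect_le continuous_intros)
  then have c: "compact half_annulus"
    unfolding eq by (intro compact_Int_closed compact_cball closed_halfspace_Re_le)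
  have "-1/16 \<in> half_annulus" by (simp add: half_annulus_def norm_divide)
  then have "half_annulus \<noteq> {}" by blast
  moreover have "continuous_on half_annulus (\<lambda>z. norm (poincare_fn z))"
    using holomorphic_on_imp_continuous_on[OF holomorphic_poincare[OF holomorphic_on_ident]]
    by (intro continuous_intros)
  ultimately obtain z0 where z0: "z0 \<in> half_annulus"
      "\<forall>z\<in>half_annulus. norm (poincare_fn z) \<le> norm (poincare_fn z0)"
    using continuous_attains_sup[OF c] by blast
  moreover have "norm (poincare_fn z0) < 1"
    using z0(1) by (intro norm_poincare_less_1) (auto simp: half_annulus_def)
  ultimately show ?thesis by blast
qed

text \<open>For z = 2^k w with w in \<open>half_annulus\<close>, k contracting steps give C/4^k, and
  4^k is comparable to |z|^2.\<close>

lemma poincare_decay: "\<exists>C\<ge>0. \<forall>z. Re z \<le> 0 \<longrightarrow> norm (poincare_fn z) \<le> C / (1 + (norm z)^2)"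
proof -
  obtain r where r: "r < 1" "\<And>z. z \<in> half_annulus \<Longrightarrow> norm (poincare_fn z) \<le> r"
    using poincare_half_annulus by blast
  obtain C where C: "C \<ge> 0" "\<And>w n. norm w \<le> r \<Longrightarrow> norm ((comp_map ^^ n) w) \<le> C / 4^n"
    using comp_map_pow_decay[OF r(1)] by blast
  have "norm (poincare_fn z) \<le> (2 + 2 * C) / (1 + (norm z)^2)" if z: "Re z \<le> 0" for z
  proof (cases "norm z \<le> 1/8")
    case True
    then have "(norm z)^2 \<le> 1" by (intro power_le_one) auto
    then have "1 \<le> (2 + 2 * C) / (1 + (norm z)^2)" using C(1) by (simp add: divide_simps add_pos_nonneg)
    then show ?thesis using norm_poincare_le_1[OF z] by linarith
  next
    case False
    then obtain k y where ky: "norm z = 2^k * y" "1/16 \<le> y" "y \<le> 1/8"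
      using dyadic_scale[of "norm z"] by (metis less_imp_le not_le)
    define w where "w = z / 2^k"
    have nw: "norm w = y" using ky by (simp add: w_def norm_divide norm_power)
    have "w \<in> half_annulus" unfolding half_annulus_def
      using nw ky z Re_divide_of_real[of z "2^k"] by (simp add: w_def divide_le_0_iff)
    then have "norm ((comp_map ^^ k) (poincare_fn w)) \<le> C / 4^k" by (intro C(2) r(2))
    then have "norm (poincare_fn z) \<le> C / 4^k" by (simp add: w_def flip: poincare_double_pow)
    also have "\<dots> \<le> (2 + 2 * C) / (1 + (norm z)^2)"
    proof -
      have k4: "(norm z)^2 = 4^k * y^2" by (simp add: ky power_mult_distrib power2_eq_square flip: power_mult_distrib)
      have "y^2 \<le> (1/8)^2" using ky by (intro power_mono) auto
      then have "4^k * y^2 \<le> 4^k * 1" by (intro mult_left_mono) (auto simp: power2_eq_square)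
      moreover have "(1::real) \<le> 4^k" by simp
      ultimately have "1 + (norm z)^2 \<le> 2 * 4^k" using k4 by linarith
      then have "C * (1 + (norm z)^2) \<le> C * (2 * 4^k)" using C(1) by (rule mult_left_mono)
      also have "\<dots> \<le> (2 + 2 * C) * 4^k" by (simp add: distrib_right)
      finally have "C * (1 + (norm z)^2) \<le> (2 + 2 * C) * 4^k" .
      then show ?thesis by (simp add: field_simps add_pos_nonneg)
    qed
    finally show ?thesis .
  qed
  then show ?thesis using C(1) by (intro exI[of _ "2 + 2 * C"]) auto
qed

text \<open>The majorant for dominated convergence in the coefficient formula; it has to hold up to
  |t| = pi 2^N, that is on the whole unit circle, with a constant independent of N.\<close>

lemma comp_map_pow_cis_decay:
  "\<exists>C\<ge>0. \<forall>N t. \<bar>t\<bar> \<le> pi * 2^N \<longrightarrow> norm ((comp_map ^^ N) (cis (t / 2^N))) \<le> C / (1 + t^2)"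
proof -
  obtain r where r: "r < 1" "\<And>z. z \<in> half_annulus \<Longrightarrow> norm (poincare_fn z) \<le> r"
    using poincare_half_annulus by blast
  define r1 where "r1 = (1 + r) / 2"
  have r1: "r1 < 1" using r by (simp add: r1_def)
  obtain C1 where C1: "C1 \<ge> 0" "\<And>w n. norm w \<le> r1 \<Longrightarrow> norm ((comp_map ^^ n) w) \<le> C1 / 4^n"
    using comp_map_pow_decay[OF r1] by blast
  obtain M where M: "1 / (1 - r1) < 2^M" using real_arch_pow[of 2 "1 / (1 - r1)"] by auto
  \<comment> \<open>M makes the approximation error 2^-M smaller than 1 - r1 = r1 - r. An angle
    |t|/2^N below \<theta>0 together with |t| \<ge> 2^k/16 forces k + M < N, so at least M steps
    remain before the last k.\<close>
  define \<theta>0 :: real where "\<theta>0 = 1 / (16 * 2^M)"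
  have \<theta>0: "\<theta>0 > 0" by (simp add: \<theta>0_def)
  \<comment> \<open>Angles bounded away from 0. The points \<open>cis \<theta>\<close> have norm 1
    and no decay by themselves, but one application of P puts them into a disc of radius below 1, by
    compactness and \<open>norm_comp_map_eq_1\<close>.\<close>
  define S where "S = cball 0 pi \<inter> {\<theta>. \<theta>0 \<le> \<bar>\<theta>\<bar>}"
  have "(1::real) \<le> 2^M" by simp
  then have "(1::real) \<le> 16 * 2^M" by linarith
  then have "\<theta>0 \<le> 1" by (simp add: \<theta>0_def)
  then have "\<theta>0 \<le> pi" using pi_gt3 by linarith
  then have "pi \<in> S" by (simp add: S_def)
  moreover have "compact S"
    unfolding S_def by (intro compact_Int_closed compact_cball closed_Collect_le continuous_intros)
  moreover have "continuous_on S (\<lambda>\<theta>. norm (comp_map (cis \<theta>)))"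
    unfolding comp_map_def by (intro continuous_intros)
  ultimately obtain s where s: "s \<in> S" "\<And>\<theta>. \<theta> \<in> S \<Longrightarrow> norm (comp_map (cis \<theta>)) \<le> norm (comp_map (cis s))"
    using continuous_attains_sup[of S "\<lambda>\<theta>. norm (comp_map (cis \<theta>))"] by blast
  have "norm (comp_map (cis s)) \<noteq> 1"
  proof
    assume "norm (comp_map (cis s)) = 1"
    then have "cis s = 1" using norm_comp_map_eq_1[of "cis s"] by simp
    then have "cos s = 1" by (simp add: complex_eq_iff)
    moreover have "cos \<bar>s\<bar> < cos 0"
      using s(1) \<theta>0 by (intro cos_monotone_0_pi) (auto simp: S_def)
    ultimately show False by simp
  qed
  then have s1: "norm (comp_map (cis s)) < 1"
    using norm_comp_map_le_1[of "cis s"] by simp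
  obtain C2 where C2: "C2 \<ge> 0"
      "\<And>w n. norm w \<le> norm (comp_map (cis s)) \<Longrightarrow> norm ((comp_map ^^ n) w) \<le> C2 / 4^n"
    using comp_map_pow_decay[OF s1] by blast
  define C where "C = 2 + 2 * C1 + (1 + pi^2) * (4 * C2 + 1)"
  have Cge: "2 + 2 * C1 \<le> C" "(1 + pi^2) * (4 * C2 + 1) \<le> C"
    using C1(1) C2(1) by (auto simp: C_def)
  have "norm ((comp_map ^^ N) (cis (t / 2^N))) \<le> C / (1 + t^2)" if t: "\<bar>t\<bar> \<le> pi * 2^N" for N t
  proof -
    have pos: "0 < 1 + t^2" by (simp add: add_pos_nonneg)
    have le1: "norm ((comp_map ^^ N) (cis (t / 2^N))) \<le> 1"
      using norm_comp_map_pow_le_1[of "cis (t / 2^N)" N] by simp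
    \<comment> \<open>Case 1 uses the trivial bound 1. In case 2 the angle is small: the first m = N
      - k steps land near the value of \<open>poincare_fn\<close> on the half-annulus, the last k
      contract. In case 3 the angle is large and all steps but the first contract.\<close>
    consider "\<bar>t\<bar> \<le> 1/8" | "\<bar>t\<bar> > 1/8" "\<bar>t\<bar> / 2^N < \<theta>0" | "\<bar>t\<bar> / 2^N \<ge> \<theta>0" by linarith
    then show ?thesis
    proof cases
      case 1
      then have "\<bar>t\<bar>^2 \<le> 1" by (intro power_le_one) auto
      then have "1 \<le> C / (1 + t^2)" using Cge(1) C1(1) pos by (simp add: pos_le_divide_eq)
      then show ?thesis using le1 by linarith
    next
      case 2
      then obtain k y where ky: "\<bar>t\<bar> = 2^k * y" "1/16 \<le> y" "y \<le> 1/8"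
        using dyadic_scale[of "\<bar>t\<bar>"] by (metis less_imp_le)
      have "2^k / 16 \<le> \<bar>t\<bar>" using ky by simp
      also have "\<dots> < 2^N / (16 * 2^M)" using 2(2) by (simp add: \<theta>0_def field_simps)
      finally have "(2::real)^(k + M) < 2^N" by (simp add: power_add field_simps)
      then have kN: "k + M < N" by simp
      define m where "m = N - k"
      have m: "N = k + m" "M \<le> m" using kN by (auto simp: m_def)
      define w where "w = \<i> * of_real (t / 2^k)"
      have nw: "norm w = y" using ky by (simp add: w_def norm_mult norm_divide norm_power)
      have w: "w \<in> half_annulus" using ky nw by (simp add: half_annulus_def) (simp add: w_def)
      have "norm ((comp_map ^^ m) (exp (w / 2^m)) - poincare_fn w) \<le> 11 * (norm w)^2 / 2^m"
        using nw ky by (intro poincare_exp_approx) auto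
      also have "\<dots> \<le> 1 / 2^M"
      proof -
        have "(norm w)^2 \<le> (1/8)^2" using nw ky by (intro power_mono) auto
        then have "11 * (norm w)^2 \<le> 1" by (simp add: power2_eq_square)
        then show ?thesis using m(2) by (intro frac_le) auto
      qed
      also have "\<dots> \<le> 1 - r1" using M r1 by (simp add: field_simps)
      finally have "norm ((comp_map ^^ m) (exp (w / 2^m)) - poincare_fn w) \<le> 1 - r1" .
      moreover have "a \<le> r1" if "d \<le> 1 - r1" "a \<le> p + d" "p \<le> r" for a d p :: real
        using that by (simp add: r1_def field_simps)
      ultimately have "norm ((comp_map ^^ m) (exp (w / 2^m))) \<le> r1"
        using norm_triangle_sub[of "(comp_map ^^ m) (exp (w / 2^m))" "poincare_fn w"] r(2)[OF w]
        by blast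
      then have "norm ((comp_map ^^ k) ((comp_map ^^ m) (exp (w / 2^m)))) \<le> C1 / 4^k" by (rule C1(2))
      moreover have "exp (w / 2^m) = cis (t / 2^N)"
        by (simp add: w_def m cis_conv_exp power_add)
      ultimately have "norm ((comp_map ^^ N) (cis (t / 2^N))) \<le> C1 / 4^k"
        by (simp add: m funpow_add)
      also have "\<dots> \<le> C / (1 + t^2)"
      proof -
        have "t^2 = \<bar>t\<bar>^2" by simp
        also have "\<dots> = 4^k * y^2" by (simp add: ky power2_eq_square flip: power_mult_distrib)
        finally have k4: "t^2 = 4^k * y^2" .
        have "y^2 \<le> (1/8)^2" using ky by (intro power_mono) auto
        then have "4^k * y^2 \<le> 4^k * 1" by (intro mult_left_mono) (auto simp: power2_eq_square)
        moreover have "(1::real) \<le> 4^k" by simp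
        ultimately have "1 + t^2 \<le> 2 * 4^k" using k4 by linarith
        then have "C1 * (1 + t^2) \<le> C1 * (2 * 4^k)" using C1(1) by (rule mult_left_mono)
        also have "\<dots> \<le> C * 4^k" using Cge(1) by (simp add: mult_right_mono flip: mult.assoc)
        finally show ?thesis using pos by (simp add: field_simps)
      qed
      finally show ?thesis .
    next
      case 3
      have tN: "\<bar>t / 2^N\<bar> \<le> pi" using t by (simp add: field_simps)
      then have S: "t / 2^N \<in> S" using 3 by (simp add: S_def)
      \<comment> \<open>One step is spent on leaving the unit circle, whence 4 * C2 instead of C2;
        the summand 1 covers N = 0.\<close>
      have "norm ((comp_map ^^ N) (cis (t / 2^N))) \<le> (4 * C2 + 1) / 4^N"
      proof (cases N)
        case 0
        then show ?thesis using le1 C2(1) by simp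
      next
        case (Suc n)
        have "norm ((comp_map ^^ n) (comp_map (cis (t / 2^N)))) \<le> C2 / 4^n"
          by (intro C2(2) s(2) S)
        then have "norm ((comp_map ^^ N) (cis (t / 2^N))) \<le> C2 / 4^n"
          by (simp add: Suc funpow_Suc_right del: funpow.simps)
        also have "\<dots> \<le> (4 * C2 + 1) / 4^N" by (simp add: Suc field_simps)
        finally show ?thesis .
      qed
      also have "\<dots> \<le> C / (1 + t^2)"
      proof -
        have "\<bar>t\<bar>^2 \<le> (pi * 2^N)^2" using t by (intro power_mono) auto
        also have "\<dots> = pi^2 * 4^N" by (simp add: power2_eq_square flip: power_mult_distrib)
        finally have "1 + t^2 \<le> 1 * 4^N + pi^2 * 4^N" by (simp add: add_mono)
        then have "(4 * C2 + 1) * (1 + t^2) \<le> (4 * C2 + 1) * ((1 + pi^2) * 4^N)"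
          using C2(1) by (intro mult_left_mono) (auto simp: algebra_simps)
        also have "\<dots> = ((1 + pi^2) * (4 * C2 + 1)) * 4^N" by (simp only: mult_ac)
        also have "\<dots> \<le> C * 4^N" using Cge(2) by (intro mult_right_mono) auto
        finally show ?thesis using pos by (simp add: field_simps)
      qed
      finally show ?thesis .
    qed
  qed
  moreover have "C \<ge> 0" using C1(1) C2(1) by (simp add: C_def)
  ultimately show ?thesis by blast
qed

section \<open>The limit density as a Fourier integral\<close>

lemma map_poly_of_real_mult:
  "map_poly (of_real :: real \<Rightarrow> complex) (p * q) = map_poly of_real p * map_poly of_real q"
  by (rule poly_eqI) (simp add: coeff_map_poly coeff_mult)

lemma map_poly_of_real_add:
  "map_poly (of_real :: real \<Rightarrow> complex) (p + q) = map_poly of_real p + map_poly of_real q"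
  by (rule poly_eqI) (simp add: coeff_map_poly)

lemma poly_cell_poly:
  "poly (map_poly of_real ((pcompose comp_poly ^^ N) [:0, 1:])) z = (comp_map ^^ N) z"
proof (induction N)
  case (Suc N)
  have "poly (map_poly of_real (pcompose comp_poly q)) z = comp_map (poly (map_poly of_real q) z)"
    for q :: "real poly"
    by (simp add: comp_poly_def comp_map_def pcompose_pCons map_poly_of_real_add
        map_poly_of_real_mult map_poly_pCons map_poly_smult algebra_simps power2_eq_square power3_eq_cube)
  then show ?case using Suc by simp
qed (simp add: map_poly_pCons)

lemma comp_map_pow_expand:
  obtains d where "\<And>i. i > d \<Longrightarrow> cell_density i N = 0"
    "\<And>z. (comp_map ^^ N) z = (\<Sum>i\<le>d. of_real (cell_density i N) * z ^ i)"
proof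
  let ?p = "(pcompose comp_poly ^^ N) [:0, 1:] :: real poly"
  show "cell_density i N = 0" if "i > degree ?p" for i
    using that by (simp add: cell_density_def coeff_eq_0)
  fix z
  have "(comp_map ^^ N) z = poly (map_poly of_real ?p) z" by (simp add: poly_cell_poly)
  also have "\<dots> = (\<Sum>i\<le>degree ?p. of_real (coeff ?p i) * z ^ i)"
    unfolding poly_altdef by (simp add: degree_map_poly coeff_map_poly)
  finally show "(comp_map ^^ N) z = (\<Sum>i\<le>degree ?p. of_real (cell_density i N) * z ^ i)"
    by (simp add: cell_density_def)
qed

lemma integral_cis_period:
  fixes j :: int and a :: real
  assumes "a > 0"
  shows "(\<integral>t. indicator {-pi * a..pi * a} t *\<^sub>R cis (of_int j * t / a) \<partial>lborel)
       = (if j = 0 then of_real (2 * pi * a) else 0)"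
proof (cases "j = 0")
  case True
  have "(\<integral>t. indicator {-pi * a..pi * a} t *\<^sub>R (1::complex) \<partial>lborel) = of_real (2 * pi * a)"
    using assms by (simp add: scaleR_conv_of_real)
  then show ?thesis using True by simp
next
  case False
  define c where "c = of_int j / a"
  define F where "F = (\<lambda>z. - \<i> / of_real c * exp (\<i> * of_real c * z))"
  have c: "c \<noteq> 0" using assms False by (simp add: c_def)
  have cis: "cis (of_int j * t / a) = exp (\<i> * of_real c * of_real t)" for t
    by (simp add: cis_conv_exp c_def mult.assoc)
  have "(\<integral>t. indicator {-pi * a..pi * a} t *\<^sub>R cis (of_int j * t / a) \<partial>lborel)
     = F (of_real (pi * a)) - F (of_real (-pi * a))"
  proof (rule integral_FTC_atLeastAtMost)
    show "-pi * a \<le> pi * a" using assms by simp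
    show "continuous_on {-pi * a..pi * a} (\<lambda>t. cis (of_int j * t / a))"
      by (intro continuous_intros) (use assms in auto)
    fix x
    have "(F has_field_derivative exp (\<i> * of_real c * of_real x)) (at (of_real x))"
      unfolding F_def by (rule derivative_eq_intros refl)+ (use c in simp)
    then show "((\<lambda>t. F (of_real t)) has_vector_derivative cis (of_int j * x / a)) (at x within {-pi * a..pi * a})"
      unfolding cis by (rule has_vector_derivative_real_field)
  qed
  also have "\<dots> = 0"
  proof -
    have "cis (of_int j * pi) = cis (of_int j * (- pi))"
      by (simp add: complex_eq_iff sin_integer_2pi)
         (metis add.inverse_inverse mult.commute sin_npi_int)
    then have "exp (\<i> * of_real c * of_real (pi * a)) = exp (\<i> * of_real c * of_real (-pi * a))"
      unfolding cis[symmetric] using assms by simp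
    then show ?thesis by (simp only: F_def) simp
  qed
  finally show ?thesis using False by simp
qed

text \<open>Cauchy's coefficient formula on the unit circle with the angle stretched by a, so that a
  = 2^N gives the rescaled density. The index k may be any integer; this is what later yields
  vanishing on the negative half-line.\<close>

lemma integral_comp_map_pow_cis:
  fixes k :: int and a :: real
  assumes "a > 0"
  shows "(\<integral>t. indicator {-pi * a..pi * a} t *\<^sub>R
      ((comp_map ^^ N) (cis (t / a)) * cis (- of_int k * t / a)) \<partial>lborel)
       = of_real (2 * pi * a * cell_density (nat k) N)"
proof -
  obtain d where d: "\<And>i. i > d \<Longrightarrow> cell_density i N = 0"
    "\<And>z. (comp_map ^^ N) z = (\<Sum>i\<le>d. of_real (cell_density i N) * z ^ i)"
    using comp_map_pow_expand by blast
  have e: "(comp_map ^^ N) (cis (t / a)) * cis (- of_int k * t / a)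
      = (\<Sum>i\<le>d. of_real (cell_density i N) * cis (of_int (int i - k) * t / a))" for t
    unfolding d(2) sum_distrib_right
  proof (intro sum.cong refl)
    fix i
    have "cis (t / a) ^ i * cis (- of_int k * t / a) = cis (of_int (int i - k) * t / a)"
      unfolding Complex.DeMoivre cis_mult
      by (rule arg_cong[where f = cis]) (simp add: diff_divide_distrib left_diff_distrib)
    then show "of_real (cell_density i N) * cis (t / a) ^ i * cis (- of_int k * t / a)
      = of_real (cell_density i N) * cis (of_int (int i - k) * t / a)" by (simp only: mult.assoc)
  qed
  have int: "integrable lborel (\<lambda>t. indicator {-pi * a..pi * a} t *\<^sub>R cis (of_int j * t / a))" for j :: int
    unfolding set_integrable_def[symmetric]
    by (intro borel_integrable_atLeastAtMost' continuous_intros) (use assms in auto)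
  have "(\<integral>t. indicator {-pi * a..pi * a} t *\<^sub>R
      ((comp_map ^^ N) (cis (t / a)) * cis (- of_int k * t / a)) \<partial>lborel)
    = (\<integral>t. (\<Sum>i\<le>d. of_real (cell_density i N) *
        (indicator {-pi * a..pi * a} t *\<^sub>R cis (of_int (int i - k) * t / a))) \<partial>lborel)"
    unfolding e scaleR_sum_right by (simp add: mult.assoc)
  also have "\<dots> = (\<Sum>i\<le>d. \<integral>t. of_real (cell_density i N) *
        (indicator {-pi * a..pi * a} t *\<^sub>R cis (of_int (int i - k) * t / a)) \<partial>lborel)"
    by (intro Bochner_Integration.integral_sum integrable_mult_right int)
  also have "\<dots> = (\<Sum>i\<le>d. of_real (cell_density i N) * (if int i - k = 0 then of_real (2 * pi * a) else 0))"
    unfolding Bochner_Integration.integral_mult_right_zero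
    by (intro sum.cong refl arg_cong2[where f = "(*)"] integral_cis_period assms)
  also have "\<dots> = (\<Sum>i\<le>d. if i = nat k then of_real (2 * pi * a * cell_density (nat k) N) else 0)"
  proof (intro sum.cong refl)
    fix i
    show "of_real (cell_density i N) * (if int i - k = 0 then of_real (2 * pi * a) else 0)
      = (if i = nat k then complex_of_real (2 * pi * a * cell_density (nat k) N) else 0)"
    \<comment> \<open>For negative k the default \<open>nat k = 0\<close> selects the term i = 0 on
      the right, which is 0 because \<open>cell_density 0 N = 0\<close>.\<close>
    proof (cases "k \<ge> 0")
      case False
      then show ?thesis by (cases "i = 0") auto
    qed auto
  qed
  also have "\<dots> = of_real (2 * pi * a * cell_density (nat k) N)"
    using d(1)[of "nat k"] by (auto simp: not_le)
  finally show ?thesis .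
qed

lemma integrable_inv_1_plus_sq: "integrable lborel (\<lambda>t::real. C / (1 + t^2))"
  using integrable_mult_right[of C lborel "\<lambda>t. inverse (1 + t^2)"] integrable_inverse_1_plus_square
  by (simp add: set_integrable_def einterval_eq_UNIV divide_inverse)

lemma continuous_poincare [continuous_intros]:
  assumes "continuous_on A f" shows "continuous_on A (\<lambda>x. poincare_fn (f x))"
  using continuous_on_compose2[OF holomorphic_on_imp_continuous_on[OF
      holomorphic_poincare[OF holomorphic_on_ident, of UNIV]] assms] by simp

lemma integrable_continuous_bound:
  fixes f :: "real \<Rightarrow> 'a::{banach, second_countable_topology}"
  assumes "continuous_on UNIV f" "\<And>t. norm (f t) \<le> C / (1 + t^2)"
  shows "integrable lborel f"
proof (rule Bochner_Integration.integrable_bound)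
  show "integrable lborel (\<lambda>t::real. C / (1 + t^2))" by (rule integrable_inv_1_plus_sq)
  show "f \<in> borel_measurable lborel" using borel_measurable_continuous_onI[OF assms(1)] by simp
  show "AE t in lborel. norm (f t) \<le> norm (C / (1 + t^2))"
    using assms(2) by (intro AE_I2) (metis abs_ge_self order_trans real_norm_def)
qed

lemma poincare_it_decay: "\<exists>C\<ge>0. \<forall>t::real. norm (poincare_fn (\<i> * of_real t)) \<le> C / (1 + t^2)"
proof -
  obtain C where "C \<ge> 0" "\<And>z. Re z \<le> 0 \<Longrightarrow> norm (poincare_fn z) \<le> C / (1 + (norm z)^2)"
    using poincare_decay by blast
  moreover from this have "norm (poincare_fn (\<i> * of_real t)) \<le> C / (1 + (norm (\<i> * of_real t))^2)"
    for t :: real by simp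
  ultimately show ?thesis by (auto simp: norm_mult)
qed

lemma integrable_poincare_fourier: "integrable lborel (\<lambda>t. cis (- (x * t)) * poincare_fn (\<i> * of_real t))"
proof -
  obtain C where "\<And>t::real. norm (poincare_fn (\<i> * of_real t)) \<le> C / (1 + t^2)"
    using poincare_it_decay by blast
  then show ?thesis
    by (intro integrable_continuous_bound[of _ C] continuous_intros) (simp_all add: norm_mult)
qed

lemma floor_scaled_tendsto: "(\<lambda>N. of_int \<lfloor>x * 2^N\<rfloor> / 2^N) \<longlonglongrightarrow> (x::real)"
proof (rule tendsto_sandwich)
  have "(\<lambda>N. x - inverse (2^N)) \<longlonglongrightarrow> x - 0"
    by (intro tendsto_intros LIMSEQ_inverse_realpow_zero) auto
  then show "(\<lambda>N. x - inverse (2^N)) \<longlonglongrightarrow> x" by simp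
  show "\<forall>\<^sub>F N in sequentially. x - inverse (2^N) \<le> of_int \<lfloor>x * 2^N\<rfloor> / 2^N"
  proof (intro always_eventually allI)
    fix N
    have "x * 2^N - 1 \<le> of_int \<lfloor>x * 2^N\<rfloor>" by linarith
    then have "(x * 2^N - 1) / 2^N \<le> of_int \<lfloor>x * 2^N\<rfloor> / 2^N" by (rule divide_right_mono) simp
    then show "x - inverse (2^N) \<le> of_int \<lfloor>x * 2^N\<rfloor> / 2^N"
      by (simp add: diff_divide_distrib inverse_eq_divide)
  qed
  show "\<forall>\<^sub>F N in sequentially. of_int \<lfloor>x * 2^N\<rfloor> / 2^N \<le> x"
    by (intro always_eventually allI) (simp add: field_simps)
qed auto

lemma density_limit:
  "(\<lambda>N. complex_of_real (2^N * cell_density (nat \<lfloor>x * 2^N\<rfloor>) N)) \<longlonglongrightarrow>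
     1 / (2 * pi) * (\<integral>t. cis (- (x * t)) * poincare_fn (\<i> * of_real t) \<partial>lborel)"
proof -
  obtain C where C: "C \<ge> 0" "\<And>N t. \<bar>t\<bar> \<le> pi * 2^N \<Longrightarrow> norm ((comp_map ^^ N) (cis (t / 2^N))) \<le> C / (1 + t^2)"
    using comp_map_pow_cis_decay by blast
  \<comment> \<open>The Cauchy integrand after the substitution t = 2^N \<theta>, cut off at the
    ends of one period.\<close>
  define s where "s = (\<lambda>N t. indicator {-pi * 2^N..pi * 2^N} t *\<^sub>R
      ((comp_map ^^ N) (cis (t / 2^N)) * cis (- of_int \<lfloor>x * 2^N\<rfloor> * t / 2^N)))"
  have "(\<lambda>N. \<integral>t. s N t \<partial>lborel) \<longlonglongrightarrow> (\<integral>t. cis (- (x * t)) * poincare_fn (\<i> * of_real t) \<partial>lborel)"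
  proof (rule integral_dominated_convergence)
    show "integrable lborel (\<lambda>t. C / (1 + t^2))" by (rule integrable_inv_1_plus_sq)
    show "(\<lambda>t. cis (- (x * t)) * poincare_fn (\<i> * of_real t)) \<in> borel_measurable lborel"
      by (rule borel_measurable_integrable[OF integrable_poincare_fourier])
    show "s N \<in> borel_measurable lborel" for N
    proof -
      have "continuous_on UNIV (\<lambda>t. (comp_map ^^ N) (cis (t / 2^N)) * cis (- of_int \<lfloor>x * 2^N\<rfloor> * t / 2^N))"
        by (intro continuous_intros continuous_on_compose2[OF continuous_comp_map_pow[of UNIV]]) auto
      then have "(\<lambda>t. (comp_map ^^ N) (cis (t / 2^N)) * cis (- of_int \<lfloor>x * 2^N\<rfloor> * t / 2^N)) \<in> borel_measurable borel"
        by (rule borel_measurable_continuous_onI)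
      then show ?thesis unfolding s_def by measurable
    qed
    show "AE t in lborel. norm (s N t) \<le> C / (1 + t^2)" for N
    proof (rule AE_I2)
      fix t
      have "0 \<le> C / (1 + t^2)" using C(1) by (simp add: add_nonneg_nonneg)
      then show "norm (s N t) \<le> C / (1 + t^2)"
        using C(2)[of t N] by (auto simp: s_def norm_mult indicator_def abs_le_iff)
    qed
    show "AE t in lborel. (\<lambda>N. s N t) \<longlonglongrightarrow> cis (- (x * t)) * poincare_fn (\<i> * of_real t)"
    proof (rule AE_I2)
      fix t
      have e: "exp (\<i> * of_real t / 2^N) = cis (t / 2^N)" for N by (simp add: cis_conv_exp)
      have "(\<lambda>N. - (of_int \<lfloor>x * 2^N\<rfloor> / 2^N * t)) \<longlonglongrightarrow> - (x * t)"
        by (intro tendsto_intros floor_scaled_tendsto)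
      then have "(\<lambda>N. cis (- (of_int \<lfloor>x * 2^N\<rfloor> / 2^N * t))) \<longlonglongrightarrow> cis (- (x * t))"
        by (intro tendsto_cis)
      then have c: "(\<lambda>N. cis (- of_int \<lfloor>x * 2^N\<rfloor> * t / 2^N)) \<longlonglongrightarrow> cis (- (x * t))"
        by simp
      have "(\<lambda>N. (comp_map ^^ N) (cis (t / 2^N)) * cis (- of_int \<lfloor>x * 2^N\<rfloor> * t / 2^N))
          \<longlonglongrightarrow> poincare_fn (\<i> * of_real t) * cis (- (x * t))"
        using poincare_exp_lim[of "\<i> * of_real t"] unfolding e by (intro tendsto_mult c)
      moreover have "\<forall>\<^sub>F N in sequentially.
          (comp_map ^^ N) (cis (t / 2^N)) * cis (- of_int \<lfloor>x * 2^N\<rfloor> * t / 2^N) = s N t"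
      proof -
        obtain M where M: "\<bar>t\<bar> < 2^M" using real_arch_pow[of 2 "\<bar>t\<bar>"] by auto
        show ?thesis
        proof (rule eventually_sequentiallyI)
          fix N assume "N \<ge> M"
          then have "(2::real)^M \<le> 2^N" by (intro power_increasing) auto
          moreover have "1 * 2^N \<le> pi * 2^N" using pi_gt3 by (intro mult_right_mono) auto
          ultimately have "t \<le> pi * 2^N \<and> - (pi * 2^N) \<le> t" using M by linarith
          then have "t \<in> {-pi * 2^N..pi * 2^N}" by simp
          then show "(comp_map ^^ N) (cis (t / 2^N)) * cis (- of_int \<lfloor>x * 2^N\<rfloor> * t / 2^N) = s N t"
            by (simp add: s_def)
        qed
      qed
      ultimately show "(\<lambda>N. s N t) \<longlonglongrightarrow> cis (- (x * t)) * poincare_fn (\<i> * of_real t)"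
        by (simp add: mult.commute Lim_transform_eventually)
    qed
  qed
  moreover have "(\<integral>t. s N t \<partial>lborel) = 2 * pi * of_real (2^N * cell_density (nat \<lfloor>x * 2^N\<rfloor>) N)" for N
    unfolding s_def by (subst integral_comp_map_pow_cis) auto
  ultimately have "(\<lambda>N. 2 * pi * complex_of_real (2^N * cell_density (nat \<lfloor>x * 2^N\<rfloor>) N))
    \<longlonglongrightarrow> (\<integral>t. cis (- (x * t)) * poincare_fn (\<i> * of_real t) \<partial>lborel)" by simp
  then have "(\<lambda>N. 1 / (2 * pi) * (2 * pi * complex_of_real (2^N * cell_density (nat \<lfloor>x * 2^N\<rfloor>) N)))
    \<longlonglongrightarrow> 1 / (2 * pi) * (\<integral>t. cis (- (x * t)) * poincare_fn (\<i> * of_real t) \<partial>lborel)"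
    by (intro tendsto_mult tendsto_const)
  then show ?thesis by simp
qed

text \<open>Taking real parts in \<open>density_limit\<close> identifies the real limit that defines
  the density; uniqueness of limits then shows that the Fourier integral has no imaginary
  part.\<close>

lemma rescaled_density_fourier:
  "complex_of_real (rescaled_density x) =
     1 / (2 * pi) * (\<integral>t. cis (- (x * t)) * poincare_fn (\<i> * of_real t) \<partial>lborel)" (is "_ = ?L")
proof -
  have "(\<lambda>N. 2^N * cell_density (nat \<lfloor>x * 2^N\<rfloor>) N) \<longlonglongrightarrow> Re ?L"
    using tendsto_Re[OF density_limit[of x]] by simp
  moreover from this have "rescaled_density x = Re ?L"
    unfolding rescaled_density_def by (rule limI)
  ultimately have "(\<lambda>N. complex_of_real (2^N * cell_density (nat \<lfloor>x * 2^N\<rfloor>) N)) \<longlonglongrightarrow> of_real (rescaled_density x)"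
    by (simp only: tendsto_of_real)
  then show ?thesis using density_limit[of x] LIMSEQ_unique by blast
qed

text \<open>The default of \<open>nat\<close> matters: negative indices become 0, where every cell
  density is 0. The Fourier formula holds for all real x, so this becomes a family of vanishing
  integrals, the source of the moment identities below.\<close>

lemma rescaled_density_nonpos:
  assumes "x \<le> 0" shows "rescaled_density x = 0"
proof -
  have "x * 2^N \<le> 0" for N using assms by (simp add: mult_le_0_iff)
  then have "nat \<lfloor>x * 2^N\<rfloor> = 0" for N
    by (metis floor_le_zero floor_mono floor_zero nat_eq_iff2 nat_le_0)
  then show ?thesis by (simp add: rescaled_density_def)
qed

section \<open>The functions H and sigma\<close>

text \<open>From 4 P(w) = w + 2 w^2 + w^3 at w = Pi(z), the weight is 4 Pi(2z) - Pi(z). Rescaling t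
  by 2 under the Fourier integral turns the factor 4 into 2 and x into x/2.\<close>

definition weight_density :: "real \<Rightarrow> real" where
  "weight_density x = 2 * rescaled_density (x / 2) - rescaled_density x"

lemma weight_fn_eq: "weight_fn z = 4 * poincare_fn (2 * z) - poincare_fn z"
  unfolding weight_fn_def poincare_double comp_map_def by (simp add: field_simps)

lemma holomorphic_weight [holomorphic_intros]:
  "f holomorphic_on A \<Longrightarrow> (\<lambda>z. weight_fn (f z)) holomorphic_on A"
  unfolding weight_fn_def by (intro holomorphic_intros)

lemma continuous_weight [continuous_intros]:
  "continuous_on A f \<Longrightarrow> continuous_on A (\<lambda>x. weight_fn (f x))"
  unfolding weight_fn_def by (intro continuous_intros)

lemma weight_decay: "\<exists>K\<ge>0. \<forall>z. Re z \<le> 0 \<longrightarrow> norm (weight_fn z) \<le> K / (1 + (norm z)^2)^2"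
proof -
  obtain C where C: "C \<ge> 0" "\<And>z. Re z \<le> 0 \<Longrightarrow> norm (poincare_fn z) \<le> C / (1 + (norm z)^2)"
    using poincare_decay by blast
  have "norm (weight_fn z) \<le> 3 * C^2 / (1 + (norm z)^2)^2" if z: "Re z \<le> 0" for z
  proof -
    let ?p = "norm (poincare_fn z)"
    have "norm (weight_fn z) \<le> 2 * ?p^2 + ?p^2 * ?p"
      using norm_triangle_ineq[of "2 * (poincare_fn z)^2" "(poincare_fn z)^3"]
      by (simp add: weight_fn_def norm_mult norm_power power2_eq_square power3_eq_cube)
    also have "\<dots> \<le> 2 * ?p^2 + ?p^2 * 1"
      using norm_poincare_le_1[OF z] by (intro add_mono mult_left_mono) auto
    also have "\<dots> \<le> 3 * (C / (1 + (norm z)^2))^2"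
      using C(2)[OF z] by (simp add: power_mono)
    finally show ?thesis by (simp add: power_divide)
  qed
  then show ?thesis by (intro exI[of _ "3 * C^2"]) auto
qed

lemma weight_it_decay: "\<exists>K\<ge>0. \<forall>t::real. norm (weight_fn (\<i> * of_real t)) \<le> K / (1 + t^2)^2"
proof -
  obtain K where "K \<ge> 0" "\<And>z. Re z \<le> 0 \<Longrightarrow> norm (weight_fn z) \<le> K / (1 + (norm z)^2)^2"
    using weight_decay by blast
  moreover from this have "norm (weight_fn (\<i> * of_real t)) \<le> K / (1 + (norm (\<i> * of_real t))^2)^2"
    for t :: real by simp
  ultimately show ?thesis by (auto simp: norm_mult)
qed

lemma integrable_mult_weight_aux:
  assumes "0 \<le> B" "0 \<le> K" "a \<le> B * (1 + t^2)" "b \<le> K / (1 + t^2)^2" "0 \<le> (b::real)"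
  shows "a * b \<le> B * K / (1 + t^2)"
proof -
  have p: "0 < 1 + t^2" by (simp add: add_pos_nonneg)
  have "a * b \<le> (B * (1 + t^2)) * (K / (1 + t^2)^2)"
    using assms p by (intro mult_mono) auto
  also have "\<dots> = B * K / (1 + t^2)" using p by (simp add: power2_eq_square)
  finally show ?thesis .
qed

text \<open>The weight decays like |t|^-4 on the imaginary axis, which leaves room for a continuous
  factor of quadratic growth, the growth of the kernel with H.\<close>

lemma integrable_mult_weight:
  assumes "continuous_on UNIV g" "\<And>t. norm (g t) \<le> B * (1 + t^2)"
  shows "integrable lborel (\<lambda>t. g t * weight_fn (\<i> * of_real t))"
proof -
  obtain K where K: "K \<ge> 0" "\<And>t::real. norm (weight_fn (\<i> * of_real t)) \<le> K / (1 + t^2)^2"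
    using weight_it_decay by blast
  have B: "B \<ge> 0" using order_trans[OF norm_ge_zero assms(2)[of 0]] by simp
  show ?thesis
  proof (rule integrable_continuous_bound)
    show "continuous_on UNIV (\<lambda>t. g t * weight_fn (\<i> * of_real t))"
      by (intro continuous_intros assms)
    show "norm (g t * weight_fn (\<i> * of_real t)) \<le> B * K / (1 + t^2)" for t
      unfolding norm_mult using assms(2) K B by (intro integrable_mult_weight_aux) auto
  qed
qed

lemma integrable_weight: "integrable lborel (\<lambda>t. weight_fn (\<i> * of_real t))"
  using integrable_mult_weight[of "\<lambda>_. 1" 1] by simp

lemma abs_le_1_plus_sq: "\<bar>t\<bar> \<le> 1 + (t::real)^2"
proof -
  have "0 \<le> (\<bar>t\<bar> - 1)^2" by simp
  then have "2 * \<bar>t\<bar> \<le> 1 + t^2" by (simp add: power2_diff)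
  then show ?thesis using abs_ge_zero[of t] by linarith
qed

lemma integrable_t_weight: "integrable lborel (\<lambda>t. of_real t * weight_fn (\<i> * of_real t))"
  using abs_le_1_plus_sq by (intro integrable_mult_weight[of _ 1] continuous_intros) auto

lemma weight_fourier:
  "(\<integral>t. cis (- (x * t)) * weight_fn (\<i> * of_real t) \<partial>lborel) = of_real (2 * pi * weight_density x)"
proof -
  define f where "f = (\<lambda>t. cis (- (x / 2 * t)) * poincare_fn (\<i> * of_real t))"
  have f: "integrable lborel f" unfolding f_def by (rule integrable_poincare_fourier)
  have g: "f (0 + 2 * t) = cis (- (x * t)) * poincare_fn (2 * (\<i> * of_real t))" for t
    by (simp add: f_def mult_ac)
  have i: "integrable lborel (\<lambda>t. cis (- (x * t)) * poincare_fn (2 * (\<i> * of_real t)))"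
    using lborel_integrable_real_affine[OF f, of 2 0] unfolding g by simp
  have "(\<integral>t. f t \<partial>lborel) = 2 * (\<integral>t. cis (- (x * t)) * poincare_fn (2 * (\<i> * of_real t)) \<partial>lborel)"
    using lborel_integral_real_affine[of 2 f 0] unfolding g by (simp add: scaleR_conv_of_real)
  moreover have "(\<integral>t. f t \<partial>lborel) = 2 * pi * complex_of_real (rescaled_density (x / 2))"
    unfolding f_def rescaled_density_fourier by simp
  ultimately have a: "(\<integral>t. cis (- (x * t)) * poincare_fn (2 * (\<i> * of_real t)) \<partial>lborel)
     = pi * complex_of_real (rescaled_density (x / 2))" by simp
  have b: "(\<integral>t. cis (- (x * t)) * poincare_fn (\<i> * of_real t) \<partial>lborel) = 2 * pi * complex_of_real (rescaled_density x)"
    unfolding rescaled_density_fourier by simp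
  have "(\<integral>t. cis (- (x * t)) * weight_fn (\<i> * of_real t) \<partial>lborel)
     = (\<integral>t. 4 * (cis (- (x * t)) * poincare_fn (2 * (\<i> * of_real t)))
           - cis (- (x * t)) * poincare_fn (\<i> * of_real t) \<partial>lborel)"
    by (simp add: weight_fn_eq algebra_simps)
  also have "\<dots> = 4 * (pi * of_real (rescaled_density (x / 2))) - 2 * pi * complex_of_real (rescaled_density x)"
    using i integrable_poincare_fourier[of x] by (simp add: a b)
  finally show ?thesis by (simp add: weight_density_def algebra_simps)
qed

lemma weight_density_nonpos: "x \<le> 0 \<Longrightarrow> weight_density x = 0"
  by (simp add: weight_density_def rescaled_density_nonpos)

lemma integral_weight: "(\<integral>t. weight_fn (\<i> * of_real t) \<partial>lborel) = 0"
  using weight_fourier[of 0] by (simp add: weight_density_nonpos cis_zero)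

lemma norm_cis_minus_1_le: "norm (cis u - 1) \<le> \<bar>u\<bar>"
  using iexp_approx1[of u 0] by (simp add: cis_conv_exp)

text \<open>The weight density vanishes on the negative half-line, so its derivative at 0 vanishes too.\<close>

lemma integral_t_weight: "(\<integral>t. of_real t * weight_fn (\<i> * of_real t) \<partial>lborel) = 0"
proof -
  \<comment> \<open>Up to sign, \<open>s n\<close> integrates to the difference quotient between 0
    and -1/(n+1) of the Fourier integral of the weight, and both of its values there are 0.\<close>
  define s where "s = (\<lambda>n t. of_real (real (Suc n)) * (cis (t / real (Suc n)) - 1) * weight_fn (\<i> * of_real t))"
  have 0: "(\<integral>t. s n t \<partial>lborel) = 0" for n
  proof -
    have i: "integrable lborel (\<lambda>t. cis (t / real (Suc n)) * weight_fn (\<i> * of_real t))"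
      by (intro integrable_mult_weight[of _ 1] continuous_intros) auto
    have "(\<integral>t. cis (t / real (Suc n)) * weight_fn (\<i> * of_real t) \<partial>lborel) = 0"
      using weight_fourier[of "- 1 / real (Suc n)"] by (simp add: weight_density_nonpos)
    then have "(\<integral>t. of_real (real (Suc n)) * (cis (t / real (Suc n)) * weight_fn (\<i> * of_real t)
       - weight_fn (\<i> * of_real t)) \<partial>lborel) = 0"
      using i integrable_weight integral_weight by simp
    then show ?thesis unfolding s_def by (simp add: algebra_simps)
  qed
  have "(\<lambda>n. \<integral>t. s n t \<partial>lborel) \<longlonglongrightarrow> (\<integral>t. \<i> * of_real t * weight_fn (\<i> * of_real t) \<partial>lborel)"
  proof (rule integral_dominated_convergence)
    show "integrable lborel (\<lambda>t. norm (of_real t * weight_fn (\<i> * of_real t)))"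
      using integrable_t_weight by (rule integrable_norm)
    show "(\<lambda>t. \<i> * of_real t * weight_fn (\<i> * of_real t)) \<in> borel_measurable lborel"
      using borel_measurable_continuous_onI[of "\<lambda>t. \<i> * of_real t * weight_fn (\<i> * of_real t)"]
      by (simp add: continuous_intros)
    have cont: "continuous_on UNIV (s n)" for n
      unfolding s_def by (intro continuous_intros) auto
    show "s n \<in> borel_measurable lborel" for n
      using borel_measurable_continuous_onI[OF cont] by simp
    show "AE t in lborel. norm (s n t) \<le> norm (of_real t * weight_fn (\<i> * of_real t))" for n
    proof (rule AE_I2)
      fix t
      have "real (Suc n) * norm (cis (t / real (Suc n)) - 1) \<le> real (Suc n) * \<bar>t / real (Suc n)\<bar>"
        by (intro mult_left_mono norm_cis_minus_1_le) auto
      also have "\<dots> = \<bar>t\<bar>" by (simp add: abs_divide)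
      finally have "real (Suc n) * norm (cis (t / real (Suc n)) - 1) \<le> \<bar>t\<bar>" .
      then show "norm (s n t) \<le> norm (of_real t * weight_fn (\<i> * of_real t))"
        unfolding s_def norm_mult norm_of_real abs_of_nat by (intro mult_right_mono) auto
    qed
    show "AE t in lborel. (\<lambda>n. s n t) \<longlonglongrightarrow> \<i> * of_real t * weight_fn (\<i> * of_real t)"
    proof (rule AE_I2)
      fix t :: real
      have "((\<lambda>z. exp (\<i> * of_real t * z)) has_field_derivative \<i> * of_real t) (at 0)"
        by (rule derivative_eq_intros refl)+ simp
      then have "((\<lambda>h. (exp (\<i> * of_real t * h) - 1) / h) \<longlongrightarrow> \<i> * of_real t) (at 0)"
        by (simp add: has_field_derivative_iff)
      moreover have "filterlim (\<lambda>n. inverse (of_nat (Suc n) :: complex)) (at 0) sequentially"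
        unfolding filterlim_at using LIMSEQ_inverse_real_of_nat[THEN tendsto_of_real[where 'a = complex]]
        by (auto simp del: of_nat_Suc)
      ultimately have "(\<lambda>n. (exp (\<i> * of_real t * inverse (of_nat (Suc n))) - 1) / inverse (of_nat (Suc n)))
          \<longlonglongrightarrow> \<i> * of_real t"
        by (rule filterlim_compose)
      then have "(\<lambda>n. (exp (\<i> * of_real t * inverse (of_nat (Suc n))) - 1) / inverse (of_nat (Suc n))
          * weight_fn (\<i> * of_real t)) \<longlonglongrightarrow> \<i> * of_real t * weight_fn (\<i> * of_real t)"
        by (intro tendsto_mult tendsto_const)
      then show "(\<lambda>n. s n t) \<longlonglongrightarrow> \<i> * of_real t * weight_fn (\<i> * of_real t)"
        by (simp add: s_def cis_conv_exp divide_inverse mult_ac del: of_nat_Suc)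
    qed
  qed
  then have "(\<integral>t. \<i> * of_real t * weight_fn (\<i> * of_real t) \<partial>lborel) = 0"
    unfolding 0 by (simp add: LIMSEQ_const_iff)
  then show ?thesis by (simp add: mult.assoc)
qed

section \<open>The entire function H: series, functional equation, growth on the imaginary
  axis\<close>

lemma H_term_bound:
  assumes "2 \<le> n"
  shows "norm (z^n / (fact n * (2^(n-1) - 1)) :: complex) \<le> norm z^n / fact n"
proof -
  have "(2::real)^1 \<le> 2^(n-1)" using assms by (intro power_increasing) auto
  then have d: "1 \<le> (2::real)^(n-1) - 1" by simp
  have "(2::complex)^(n-1) - 1 = of_real (2^(n-1) - 1)" by simp
  then have "norm ((2::complex)^(n-1) - 1) = 2^(n-1) - 1"
    using d by (metis norm_of_real abs_of_nonneg order_trans zero_le_one)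
  then have "norm (z^n / (fact n * (2^(n-1) - 1))) = norm z^n / fact n / (2^(n-1) - 1)"
    by (simp add: norm_divide norm_mult norm_power)
  also have "\<dots> \<le> norm z^n / fact n / 1"
    using d by (intro divide_left_mono) auto
  finally show ?thesis by simp
qed

lemma H_summable: "summable (\<lambda>n. norm (z^n / (fact n * (2^(n-1) - 1)) :: complex))"
proof (rule summable_comparison_test')
  show "summable (\<lambda>n. norm z^n / fact n)"
    using summable_exp[of "norm z"] by (simp add: field_simps)
  show "norm (norm (z^n / (fact n * (2^(n-1) - 1)))) \<le> norm z^n / fact n" if "n \<ge> 2" for n
    using H_term_bound[OF that, of z] by simp
qed

lemma H_has_sum: "((\<lambda>n. z^n / (fact n * (2^(n-1) - 1))) has_sum H_fn z) {2..}"
proof -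
  have "(\<lambda>n. z^n / (fact n * (2^(n-1) - 1))) summable_on UNIV"
    using norm_summable_imp_summable_on[OF H_summable] .
  then have "(\<lambda>n. z^n / (fact n * (2^(n-1) - 1))) summable_on {2..}"
    by (rule summable_on_subset_banach) simp
  then show ?thesis unfolding H_fn_def by (rule has_sum_infsum)
qed

text \<open>The terms of index 0 and 1 vanish, the latter because \<open>x / 0 = 0\<close>.\<close>

lemma H_sums: "(\<lambda>n. z^n / (fact n * (2^(n-1) - 1))) sums H_fn z"
proof -
  have "((\<lambda>n. z^n / (fact n * (2^(n-1) - 1))) has_sum H_fn z) UNIV"
  proof (rule has_sum_cong_neutral[THEN iffD1, OF _ _ _ H_has_sum])
    fix n :: nat assume "n \<in> UNIV - {2..}"
    then have "n = 0 \<or> n = 1" by auto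
    then show "z^n / (fact n * (2^(n-1) - 1)) = 0" by auto
  qed auto
  then show ?thesis by (rule has_sum_imp_sums)
qed

lemma H_holomorphic: "H_fn holomorphic_on UNIV"
proof -
  have "H_fn holomorphic_on ball 0 r" for r
  proof (rule power_series_holomorphic)
    show "(\<lambda>n. 1 / (fact n * (2^(n-1) - 1)) * (w - 0)^n) sums H_fn w" for w
      using H_sums[of w] by simp
  qed
  then have "H_fn field_differentiable at z" for z
    using holomorphic_on_imp_differentiable_at[of H_fn "ball 0 (norm z + 1)" z] by auto
  then show ?thesis by (simp add: holomorphic_on_def field_differentiable_at_within)
qed

lemma continuous_H [continuous_intros]:
  "continuous_on A f \<Longrightarrow> continuous_on A (\<lambda>x. H_fn (f x))"
  using continuous_on_compose2[OF holomorphic_on_imp_continuous_on[OF H_holomorphic]] by auto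

lemma exp_has_sum_from_2: "((\<lambda>n. z^n / fact n) has_sum (exp z - 1 - z)) {2..}" for z :: complex
proof -
  have s: "summable (\<lambda>n. norm (z^n / fact n))"
    using summable_norm_exp[of z] by (simp add: scaleR_conv_of_real field_simps norm_divide norm_mult norm_power)
  have "(\<lambda>n. z^n / fact n) sums exp z"
    using exp_converges[of z] by (simp add: scaleR_conv_of_real field_simps)
  then have "((\<lambda>n. z^n / fact n) has_sum exp z) UNIV"
    using norm_summable_imp_has_sum[OF s] by blast
  moreover have "((\<lambda>n. z^n / fact n) has_sum (\<Sum>n\<in>{0, 1}. z^n / fact n)) {0, 1}"
    by (rule has_sum_finite) simp
  ultimately have "((\<lambda>n. z^n / fact n) has_sum (exp z - (\<Sum>n\<in>{0, 1}. z^n / fact n))) (UNIV - {0, 1})"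
    by (rule has_sum_Diff) simp
  moreover have "UNIV - {0, 1::nat} = {2..}" by auto
  ultimately show ?thesis by (simp add: diff_diff_eq)
qed

text \<open>Termwise this is 2^n / (2^(n-1) - 1) = 2 / (2^(n-1) - 1) + 2, valid for n \<ge>
  2.\<close>

lemma H_double: "H_fn (2 * z) = 2 * H_fn z + 2 * (exp z - 1 - z)"
proof -
  have "((\<lambda>n. 2 * (z^n / (fact n * (2^(n-1) - 1))) + 2 * (z^n / fact n)) has_sum
      (2 * H_fn z + 2 * (exp z - 1 - z))) {2..}"
    by (intro has_sum_add has_sum_cmult_right H_has_sum exp_has_sum_from_2)
  also have "?this \<longleftrightarrow> ((\<lambda>n. (2 * z)^n / (fact n * (2^(n-1) - 1))) has_sum
      (2 * H_fn z + 2 * (exp z - 1 - z))) {2..}"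
  proof (rule has_sum_cong)
    fix n :: nat assume "n \<in> {2..}"
    then obtain m where m: "n = Suc (Suc m)" by (metis Suc_le_D atLeast_iff numeral_2_eq_2 Suc_le_mono)
    have "(2::real)^Suc m \<noteq> 1" by (metis one_less_numeral_iff semiring_norm(76) one_less_power zero_less_Suc less_irrefl)
    then have "complex_of_real (2^Suc m) \<noteq> complex_of_real 1" using of_real_eq_iff by blast
    then have "(2::complex)^Suc m - 1 \<noteq> 0" by simp
    then show "2 * (z^n / (fact n * (2^(n-1) - 1))) + 2 * (z^n / fact n) = (2 * z)^n / (fact n * (2^(n-1) - 1))"
      by (simp add: m field_simps power_mult_distrib del: fact_Suc)
  qed
  finally show ?thesis using H_has_sum[of "2 * z"] has_sum_unique by blast
qed

lemma norm_H_small: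
  assumes "norm z \<le> 1" shows "norm (H_fn z) \<le> (norm z)^2"
proof -
  define a where "a = (\<lambda>n. z^n / (fact n * (2^(n-1) - 1)))"
  have as: "((\<lambda>n. norm (a n)) summable_on {2..})"
    by (rule summable_on_subset_banach[OF norm_summable_imp_summable_on]) (use H_summable in \<open>auto simp: a_def\<close>)
  have c: "((\<lambda>n. complex_of_real (norm z)^n / fact n) has_sum (exp (of_real (norm z)) - 1 - of_real (norm z))) {2..}"
    by (rule exp_has_sum_from_2)
  have "((\<lambda>n. complex_of_real (norm z^n / fact n)) has_sum complex_of_real (exp (norm z) - 1 - norm z)) {2..}"
    using c by (simp add: exp_of_real)
  then have e: "((\<lambda>n. norm z^n / fact n) has_sum (exp (norm z) - 1 - norm z)) {2..}"
    unfolding has_sum_of_real_iff .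
  have "infsum (\<lambda>n. norm (a n)) {2..} \<le> exp (norm z) - 1 - norm z"
    by (rule has_sum_mono[OF has_sum_infsum[OF as] e]) (unfold a_def, rule H_term_bound, simp)
  moreover have "norm (H_fn z) \<le> infsum (\<lambda>n. norm (a n)) {2..}"
    using norm_infsum_bound[OF as] by (simp add: H_fn_def a_def)
  moreover have "exp (norm z) \<le> 1 + norm z + (norm z)^2" by (intro exp_bound assms) auto
  ultimately show ?thesis by linarith
qed

lemma norm_H_double: "norm (H_fn (2 * z)) \<le> 2 * norm (H_fn z) + 2 * norm (exp z - 1 - z)"
proof -
  have "norm (2 * H_fn z + 2 * (exp z - 1 - z)) \<le> norm (2 * H_fn z) + norm (2 * (exp z - 1 - z))"
    by (rule norm_triangle_ineq)
  then show ?thesis unfolding H_double norm_mult by simp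
qed

text \<open>Induction on the dyadic size of u along the functional equation. With u = 2v the step
  gives 2 v^2 + 2 (v^2 / 2) = 3 v^2 \<le> u^2; the Taylor remainder of exp is this small because the
  argument is imaginary.\<close>

lemma norm_H_it: "norm (H_fn (\<i> * of_real u)) \<le> u^2"
proof -
  have *: "\<bar>u\<bar> \<le> 2^k \<Longrightarrow> norm (H_fn (\<i> * of_real u)) \<le> u^2" for k :: nat and u :: real
  proof (induction k arbitrary: u)
    case 0
    then show ?case using norm_H_small[of "\<i> * of_real u"] by (simp add: norm_mult)
  next
    case (Suc k)
    define v where "v = u / 2"
    have u: "u = 2 * v" by (simp add: v_def)
    have "norm (H_fn (\<i> * of_real v)) \<le> v^2" using Suc by (simp add: u)
    moreover have "norm (exp (\<i> * of_real v) - 1 - \<i> * of_real v) \<le> v^2 / 2"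
      using iexp_approx1[of v 1] by (simp add: diff_diff_eq power2_eq_square)
    moreover have e: "\<i> * of_real u = 2 * (\<i> * of_real v)" and "u^2 = 4 * v^2"
      by (simp_all add: u power_mult_distrib)
    ultimately show ?case unfolding e
      using norm_H_double[of "\<i> * of_real v"] zero_le_power2[of v] by linarith
  qed
  obtain k where "\<bar>u\<bar> < 2^k" using real_arch_pow[of 2 "\<bar>u\<bar>"] by auto
  then show ?thesis using *[of u k] by simp
qed

text \<open>The same doubling with the linear remainder bound 2|v|: each of the about log2 |u|
  doublings adds at most 4|v| = 2|u|, within the allowed 3|u|.\<close>

lemma norm_H_it_log: "\<bar>u\<bar> \<le> 2^k \<Longrightarrow> norm (H_fn (\<i> * of_real u)) \<le> \<bar>u\<bar> * (1 + 3 * real k)"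
proof (induction k arbitrary: u)
  case 0
  then have "\<bar>u\<bar> * \<bar>u\<bar> \<le> \<bar>u\<bar> * 1" by (intro mult_left_mono) auto
  then show ?case using norm_H_it[of u] by (simp add: power2_eq_square)
next
  case (Suc k)
  define v where "v = u / 2"
  have u: "u = 2 * v" by (simp add: v_def)
  have "norm (H_fn (\<i> * of_real v)) \<le> \<bar>v\<bar> * (1 + 3 * real k)" using Suc by (simp add: u)
  moreover have "norm (exp (\<i> * of_real v) - 1 - \<i> * of_real v) \<le> 2 * \<bar>v\<bar>"
    using iexp_approx2[of v 1] by (simp add: diff_diff_eq)
  moreover have e: "\<i> * of_real u = 2 * (\<i> * of_real v)" by (simp add: u)
  moreover have "\<bar>u\<bar> * (1 + 3 * real (Suc k)) = 2 * (\<bar>v\<bar> * (1 + 3 * real k)) + 2 * (2 * \<bar>v\<bar>) + 2 * \<bar>v\<bar>"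
    by (simp add: u algebra_simps abs_mult)
  ultimately show ?case unfolding e
    using norm_H_double[of "\<i> * of_real v"] abs_ge_zero[of v] by linarith
qed

lemma H_it_bigo: "(\<lambda>t::real. norm (H_fn (\<i> * of_real t))) \<in> O[at_infinity](\<lambda>t. \<bar>t\<bar> * ln \<bar>t\<bar>)"
proof (rule bigoI)
  show "\<forall>\<^sub>F t in at_infinity. norm (norm (H_fn (\<i> * of_real t))) \<le> (7 / ln 2) * norm (\<bar>t\<bar> * ln \<bar>t\<bar>)"
    unfolding eventually_at_infinity
  proof (intro exI[of _ 2] allI impI)
    fix t :: real assume "2 \<le> norm t"
    then have t: "2 \<le> \<bar>t\<bar>" by simp
    define k where "k = nat \<lceil>log 2 \<bar>t\<bar>\<rceil>"
    have l: "1 \<le> log 2 \<bar>t\<bar>" using t by (simp add: le_log_iff)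
    have "log 2 \<bar>t\<bar> \<le> real k" unfolding k_def by (rule real_nat_ceiling_ge)
    then have "\<bar>t\<bar> \<le> 2 powr real k" using t by (simp add: log_le_iff)
    then have k: "\<bar>t\<bar> \<le> 2^k" by (simp add: powr_realpow)
    have "real k \<le> log 2 \<bar>t\<bar> + 1" using l unfolding k_def by linarith
    then have "1 + 3 * real k \<le> 7 * log 2 \<bar>t\<bar>" using l by linarith
    then have "\<bar>t\<bar> * (1 + 3 * real k) \<le> \<bar>t\<bar> * (7 * log 2 \<bar>t\<bar>)" by (intro mult_left_mono) auto
    also have "\<dots> = 7 / ln 2 * norm (\<bar>t\<bar> * ln \<bar>t\<bar>)" using t by (simp add: log_def abs_mult)
    finally show "norm (norm (H_fn (\<i> * of_real t))) \<le> (7 / ln 2) * norm (\<bar>t\<bar> * ln \<bar>t\<bar>)"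
      using norm_H_it_log[OF k] by simp
  qed
qed

text \<open>The integral term S of the overview as a function of y = 2^x, without the prefactor
  2^-x: y sigma(log2 y) = rho(y) + S(y) for y > 0. Scaling and the behaviour at 0 are then free of
  logarithms.\<close>

definition sigma_tail :: "real \<Rightarrow> complex" where
  "sigma_tail y = 1 / (4 * pi) * (\<integral>t. H_fn (- \<i> * of_real (t * (2 * y))) * weight_fn (\<i> * of_real t) \<partial>lborel)"

lemma norm_H_kernel: "norm (H_fn (- \<i> * of_real (t * (2 * y)))) \<le> 4 * y^2 * t^2"
  using norm_H_it[of "- (t * (2 * y))"] by (simp add: power_mult_distrib mult_ac)

lemma integrable_H_weight: "integrable lborel (\<lambda>t. H_fn (- \<i> * of_real (t * (2 * y))) * weight_fn (\<i> * of_real t))"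
proof (rule integrable_mult_weight)
  show "continuous_on UNIV (\<lambda>t. H_fn (- \<i> * of_real (t * (2 * y))))" by (intro continuous_intros)
  fix t
  have "4 * y^2 * t^2 \<le> 4 * y^2 * (1 + t^2)" by (intro mult_left_mono) auto
  then show "norm (H_fn (- \<i> * of_real (t * (2 * y)))) \<le> 4 * y^2 * (1 + t^2)"
    using norm_H_kernel[of t y] by linarith
qed

lemma sigma_tail_bound: "\<exists>K\<ge>0. \<forall>y. norm (sigma_tail y) \<le> K * y^2"
proof -
  have i: "integrable lborel (\<lambda>t. norm (of_real t ^ 2 * weight_fn (\<i> * of_real t)))"
    by (intro integrable_norm integrable_mult_weight[of _ 1] continuous_intros) (simp add: norm_power)
  define K where "K = (\<integral>t. norm (of_real t ^ 2 * weight_fn (\<i> * of_real t)) \<partial>lborel)"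
  have "norm (sigma_tail y) \<le> (K / pi) * y^2" for y
  proof -
    have "norm (\<integral>t. H_fn (- \<i> * of_real (t * (2 * y))) * weight_fn (\<i> * of_real t) \<partial>lborel)
       \<le> (\<integral>t. 4 * y^2 * norm (of_real t ^ 2 * weight_fn (\<i> * of_real t)) \<partial>lborel)"
    proof (rule Bochner_Integration.integral_norm_bound_integral)
      show "norm (H_fn (- \<i> * of_real (t * (2 * y))) * weight_fn (\<i> * of_real t))
          \<le> 4 * y^2 * norm (of_real t ^ 2 * weight_fn (\<i> * of_real t))" for t
        using mult_right_mono[OF norm_H_kernel[of t y], of "norm (weight_fn (\<i> * of_real t))"]
        by (simp add: norm_mult norm_power mult.assoc)
    qed (intro integrable_H_weight integrable_mult_right i)+
    also have "\<dots> = 4 * y^2 * K" using i by (simp add: K_def)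
    finally have "1 / (4 * pi) * norm (\<integral>t. H_fn (- \<i> * of_real (t * (2 * y))) * weight_fn (\<i> * of_real t) \<partial>lborel)
       \<le> 1 / (4 * pi) * (4 * y^2 * K)" by (intro mult_left_mono) auto
    then show ?thesis by (simp add: sigma_tail_def norm_mult norm_divide mult.commute)
  qed
  moreover have "0 \<le> K / pi" by (simp add: K_def)
  ultimately show ?thesis by blast
qed

lemma sigma_tail_double: "sigma_tail (2 * y) = 2 * sigma_tail y + of_real (weight_density (2 * y))"
proof -
  define A where "A = (\<lambda>t. H_fn (- \<i> * of_real (t * (2 * y))) * weight_fn (\<i> * of_real t))"
  define B where "B = (\<lambda>t. cis (- (2 * y * t)) * weight_fn (\<i> * of_real t))"
  have iA: "integrable lborel A" unfolding A_def by (rule integrable_H_weight)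
  have vB: "(\<integral>t. B t \<partial>lborel) = of_real (2 * pi * weight_density (2 * y))"
    unfolding B_def by (rule weight_fourier)
  have iB: "integrable lborel B" unfolding B_def
    by (intro integrable_mult_weight[of _ 1] continuous_intros) auto
  have "H_fn (- \<i> * of_real (t * (2 * (2 * y)))) * weight_fn (\<i> * of_real t)
      = 2 * A t + 2 * (B t - weight_fn (\<i> * of_real t) + \<i> * of_real (2 * y) * (of_real t * weight_fn (\<i> * of_real t)))" for t
  proof -
    have e1: "- \<i> * complex_of_real (t * (2 * (2 * y))) = 2 * (- \<i> * of_real (t * (2 * y)))" by simp
    have e2: "cis (- (2 * y * t)) = exp (- \<i> * of_real (t * (2 * y)))" by (simp add: cis_conv_exp mult_ac)
    show ?thesis unfolding A_def B_def e1 e2 H_double by (simp add: algebra_simps)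
  qed
  then have "(\<integral>t. H_fn (- \<i> * of_real (t * (2 * (2 * y)))) * weight_fn (\<i> * of_real t) \<partial>lborel)
     = 2 * (\<integral>t. A t \<partial>lborel) + 2 * (of_real (2 * pi * weight_density (2 * y)) - 0 + \<i> * of_real (2 * y) * 0)"
    using iA iB integrable_weight integrable_t_weight
    by (simp add: integral_weight integral_t_weight vB)
  then show ?thesis unfolding sigma_tail_def A_def by (simp add: field_simps)
qed

text \<open>The inhomogeneous term of the doubling equation is real, so Im S(y) = 2^n Im S(y/2^n).
  Since S(y) = O(y^2), the right side is O(2^-n).\<close>

lemma sigma_tail_real: "Im (sigma_tail y) = 0"
proof -
  obtain K where K: "K \<ge> 0" "\<And>y. norm (sigma_tail y) \<le> K * y^2" using sigma_tail_bound by blast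
  have pow: "Im (sigma_tail y) = 2^n * Im (sigma_tail (y / 2^n))" for n
  proof (induction n)
    case (Suc n)
    have "sigma_tail (y / 2^n) = 2 * sigma_tail (y / 2^Suc n) + of_real (weight_density (y / 2^n))"
      using sigma_tail_double[of "y / 2^Suc n"] by simp
    then show ?case using Suc by simp
  qed simp
  have "\<bar>Im (sigma_tail y)\<bar> \<le> K * y^2 * inverse (2^n)" for n
  proof -
    have "\<bar>Im (sigma_tail y)\<bar> = 2^n * \<bar>Im (sigma_tail (y / 2^n))\<bar>"
      by (subst pow[of n]) (simp add: abs_mult)
    also have "\<dots> \<le> 2^n * (K * (y / 2^n)^2)"
      by (intro mult_left_mono order_trans[OF abs_Im_le_cmod K(2)]) auto
    also have "\<dots> = K * y^2 * inverse (2^n)" by (simp add: power2_eq_square field_simps)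
    finally show ?thesis .
  qed
  moreover have "(\<lambda>n. K * y^2 * inverse (2^n)) \<longlonglongrightarrow> 0"
    by (intro tendsto_mult_right_zero LIMSEQ_inverse_realpow_zero) auto
  ultimately have "\<bar>Im (sigma_tail y)\<bar> \<le> 0"
    by (intro LIMSEQ_le_const) auto
  then show ?thesis by simp
qed

text \<open>The factor 1 + x^2 accommodates the quadratic growth of the kernel of
  \<open>sigma_tail\<close> in its parameter; along a convergent sequence it is bounded by a
  constant.\<close>

lemma continuous_integral_dominated:
  fixes f :: "real \<Rightarrow> real \<Rightarrow> complex"
  assumes "\<And>t. continuous_on UNIV (\<lambda>x. f x t)" "\<And>x. f x \<in> borel_measurable lborel"
    and "integrable lborel g" "\<And>x t. norm (f x t) \<le> (1 + x^2) * g t"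
  shows "continuous_on UNIV (\<lambda>x. \<integral>t. f x t \<partial>lborel)"
proof -
  have "isCont (\<lambda>x. \<integral>t. f x t \<partial>lborel) x" for x
    unfolding continuous_at_sequentially comp_def
  proof (intro allI impI)
    fix X :: "nat \<Rightarrow> real" assume X: "X \<longlonglongrightarrow> x"
    have g0: "0 \<le> g t" for t using order_trans[OF norm_ge_zero assms(4)[of 0 t]] by simp
    obtain B where B: "\<And>n. norm (X n) \<le> B"
      using convergent_imp_Bseq[OF convergentI[OF X]] by (auto simp: Bseq_def)
    show "(\<lambda>n. \<integral>t. f (X n) t \<partial>lborel) \<longlonglongrightarrow> (\<integral>t. f x t \<partial>lborel)"
    proof (rule integral_dominated_convergence)
      show "integrable lborel (\<lambda>t. (1 + B^2) * g t)" using assms(3) by simp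
      show "AE t in lborel. (\<lambda>n. f (X n) t) \<longlonglongrightarrow> f x t"
        using assms(1) X continuous_on_tendsto_compose[of UNIV _ X x] by (intro AE_I2) auto
      show "AE t in lborel. norm (f (X n) t) \<le> (1 + B^2) * g t" for n
      proof (rule AE_I2)
        fix t
        have "(X n)^2 \<le> B^2" using B[of n] by (simp add: abs_le_square_iff[symmetric])
        then have "(1 + (X n)^2) * g t \<le> (1 + B^2) * g t" using g0 by (intro mult_right_mono) auto
        then show "norm (f (X n) t) \<le> (1 + B^2) * g t" using assms(4)[of "X n" t] by linarith
      qed
    qed (use assms(2) in auto)
  qed
  then show ?thesis by (simp add: continuous_on_eq_continuous_at)
qed

lemma continuous_rescaled_density: "continuous_on UNIV (\<lambda>x. complex_of_real (rescaled_density x))"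
proof -
  obtain C where C: "\<And>t::real. norm (poincare_fn (\<i> * of_real t)) \<le> C / (1 + t^2)"
    using poincare_it_decay by blast
  have "continuous_on UNIV (\<lambda>x. \<integral>t. cis (- (x * t)) * poincare_fn (\<i> * of_real t) \<partial>lborel)"
  proof (rule continuous_integral_dominated)
    show "integrable lborel (\<lambda>t. norm (poincare_fn (\<i> * of_real t)))"
      using integrable_norm[OF integrable_poincare_fourier[of 0]] by (simp add: norm_mult)
    show "norm (cis (- (x * t)) * poincare_fn (\<i> * of_real t)) \<le> (1 + x^2) * norm (poincare_fn (\<i> * of_real t))" for x t
      using mult_right_mono[of 1 "1 + x^2" "norm (poincare_fn (\<i> * of_real t))"] by (simp add: norm_mult)
    show "(\<lambda>t. cis (- (x * t)) * poincare_fn (\<i> * of_real t)) \<in> borel_measurable lborel" for x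
      by (rule borel_measurable_integrable[OF integrable_poincare_fourier])
  qed (intro continuous_intros)
  then show ?thesis unfolding rescaled_density_fourier by (intro continuous_intros)
qed

lemma continuous_sigma_tail: "continuous_on UNIV sigma_tail"
proof -
  have "continuous_on UNIV (\<lambda>y. \<integral>t. H_fn (- \<i> * of_real (t * (2 * y))) * weight_fn (\<i> * of_real t) \<partial>lborel)"
  proof (rule continuous_integral_dominated)
    show "integrable lborel (\<lambda>t. 4 * norm (of_real t ^ 2 * weight_fn (\<i> * of_real t)))"
      by (intro integrable_norm integrable_mult_right integrable_mult_weight[of _ 1] continuous_intros) (simp add: norm_power)
    show "norm (H_fn (- \<i> * of_real (t * (2 * x))) * weight_fn (\<i> * of_real t))
       \<le> (1 + x^2) * (4 * norm (of_real t ^ 2 * weight_fn (\<i> * of_real t)))" for x t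
    proof -
      have "4 * x^2 * t^2 \<le> (1 + x^2) * 4 * t^2" by (intro mult_right_mono) auto
      then have "norm (H_fn (- \<i> * of_real (t * (2 * x)))) \<le> (1 + x^2) * 4 * t^2"
        using norm_H_kernel[of t x] by linarith
      from mult_right_mono[OF this, of "norm (weight_fn (\<i> * of_real t))"]
      show ?thesis by (simp add: norm_mult norm_power algebra_simps)
    qed
    show "(\<lambda>t. H_fn (- \<i> * of_real (t * (2 * x))) * weight_fn (\<i> * of_real t)) \<in> borel_measurable lborel" for x
      by (rule borel_measurable_integrable[OF integrable_H_weight])
  qed (intro continuous_intros)
  then show ?thesis unfolding sigma_tail_def by (intro continuous_intros)
qed

lemma sigma_fn_eq:
  "sigma_fn x = of_real (2 powr - x) * (of_real (rescaled_density (2 powr x)) + sigma_tail (2 powr x))"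
proof -
  have e: "2 powr (x + 1) = 2 * 2 powr x" by (simp add: powr_add)
  show ?thesis unfolding sigma_fn_def sigma_tail_def e by (simp add: distrib_left)
qed

lemma sigma_fn_real: "sigma_fn x \<in> \<real>"
  using sigma_tail_real[of "2 powr x"] by (simp add: sigma_fn_eq complex_is_Real_iff)

lemma continuous_sigma_fn: "continuous_on UNIV sigma_fn"
proof -
  have p: "continuous_on UNIV (\<lambda>x::real. 2 powr x)" "continuous_on UNIV (\<lambda>x::real. 2 powr - x)"
    by (intro continuous_intros; simp)+
  have "continuous_on UNIV (\<lambda>x. of_real (2 powr - x) * (of_real (rescaled_density (2 powr x)) + sigma_tail (2 powr x)))"
    by (intro continuous_on_mult continuous_on_add continuous_on_of_real p(2)
        continuous_on_compose2[OF continuous_rescaled_density p(1)]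
        continuous_on_compose2[OF continuous_sigma_tail p(1)]) auto
  then show ?thesis by (simp add: sigma_fn_eq[abs_def])
qed

text \<open>Since w(2y) = 2 rho(y) - rho(2y), the doubling equation of S says that rho + S is
  multiplied by 2 when y is doubled.\<close>

lemma sigma_fn_periodic: "sigma_fn (x + 1) = sigma_fn x"
proof -
  define y :: real where "y = 2 powr x"
  have y1: "2 powr (x + 1) = 2 * y" by (simp add: y_def powr_add)
  have y: "2 powr (x + 1) = 2 * y" "2 powr - (x + 1) = 1 / (2 * y)" "2 powr - x = 1 / y"
    using y1 by (simp_all only: powr_minus_divide y_def)
  have "y \<noteq> 0" by (simp add: y_def)
  then show ?thesis
    unfolding sigma_fn_eq y y_def[symmetric] sigma_tail_double
    by (simp add: weight_density_def field_simps)
qed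

text \<open>The difference is exactly -S(x), which is O(x^2).\<close>

lemma rescaled_density_asymp:
  "(\<lambda>x. of_real (rescaled_density x) - of_real x * sigma_fn (log 2 x)) \<in> o[at_right 0](\<lambda>x. of_real x)"
proof -
  obtain K where K: "K \<ge> 0" "\<And>y. norm (sigma_tail y) \<le> K * y^2" using sigma_tail_bound by blast
  show ?thesis
  proof (rule landau_o.smallI)
    fix c :: real assume "c > 0"
    show "\<forall>\<^sub>F x in at_right 0. norm (complex_of_real (rescaled_density x) - of_real x * sigma_fn (log 2 x))
        \<le> c * norm (complex_of_real x)"
      unfolding eventually_at_right_field
    proof (intro exI[of _ "c / (K + 1)"] conjI allI impI)
      show "0 < c / (K + 1)" using \<open>c > 0\<close> K(1) by simp
      fix x :: real assume x: "0 < x" "x < c / (K + 1)"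
      then have "K * x \<le> c" using K(1) by (simp add: field_simps)
      then have "K * x^2 \<le> c * x" using x(1) by (simp add: power2_eq_square mult_right_mono flip: mult.assoc)
      moreover have "of_real (rescaled_density x) - of_real x * sigma_fn (log 2 x) = - sigma_tail x"
        using x(1) by (simp add: sigma_fn_eq powr_minus field_simps)
      ultimately show "norm (complex_of_real (rescaled_density x) - of_real x * sigma_fn (log 2 x))
        \<le> c * norm (complex_of_real x)"
        using K(2)[of x] x(1) by simp
    qed
  qed
qed

section \<open>The mean of sigma\<close>

lemma comp_map_pow_cnj: "(comp_map ^^ N) (cnj z) = cnj ((comp_map ^^ N) z)"
  by (induction N) (simp_all add: comp_map_def)

lemma poincare_cnj: "poincare_fn (cnj z) = cnj (poincare_fn z)"
proof -
  have "(\<lambda>N. cnj ((comp_map ^^ N) (1 + z / 2^N))) \<longlonglongrightarrow> cnj (poincare_fn z)"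
    by (intro tendsto_cnj poincare_lim)
  then have "(\<lambda>N. (comp_map ^^ N) (1 + cnj z / 2^N)) \<longlonglongrightarrow> cnj (poincare_fn z)"
    by (simp flip: comp_map_pow_cnj)
  then show ?thesis using poincare_lim LIMSEQ_unique by blast
qed

lemma weight_cnj: "weight_fn (cnj z) = cnj (weight_fn z)"
  by (simp add: weight_fn_def poincare_cnj)

lemma weight_it_minus: "weight_fn (\<i> * of_real (- t)) = cnj (weight_fn (\<i> * of_real t))"
  using weight_cnj[of "\<i> * of_real t"] by simp

text \<open>Substituting y = t 2^x gives (t / ln 2) times the integral of (1 - cos y)/y^2 over (0,
  \<infinity>), which is pi/2. Integration by parts produces the primitive A = Si y - (1 - cos y)/y,
  so only the limit of \<open>Si\<close> at infinity is needed.\<close>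

lemma cos_kernel_integral_pos:
  assumes "t > 0"
  shows "has_bochner_integral lborel (\<lambda>x. 2 powr - x * (1 - cos (t * 2 powr x))) (t * pi / (2 * ln 2))"
proof -
  define A where "A = (\<lambda>y. Si y - (1 - cos y) / y)"
  define F where "F = (\<lambda>x. t / ln 2 * A (t * 2 powr x))"
  have A': "(A has_real_derivative (1 - cos y) / y^2) (at y)" if "y > 0" for y
  proof -
    have "(A has_real_derivative sinc y - (sin y * y - (1 - cos y)) / (y * y)) (at y)"
      unfolding A_def by (rule derivative_eq_intros DERIV_Si refl | use that in simp)+
    also have "sinc y - (sin y * y - (1 - cos y)) / (y * y) = (1 - cos y) / y^2"
      using that by (simp add: field_simps power2_eq_square)
    finally show ?thesis .
  qed
  have F': "(F has_real_derivative 2 powr - x * (1 - cos (t * 2 powr x))) (at x)" for x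
  proof -
    define y where "y = t * 2 powr x"
    have y: "y > 0" using assms by (simp add: y_def)
    have "((\<lambda>x. t * 2 powr x) has_real_derivative y * ln 2) (at x)"
      unfolding y_def by (rule derivative_eq_intros refl | simp)+
    then have "((\<lambda>x. A (t * 2 powr x)) has_real_derivative (1 - cos y) / y^2 * (y * ln 2)) (at x)"
      using A'[OF y] unfolding y_def by (intro DERIV_chain2[where f = A])
    then have "(F has_real_derivative t / ln 2 * ((1 - cos y) / y^2 * (y * ln 2))) (at x)"
      unfolding F_def by (rule DERIV_cmult)
    also have "t / ln 2 * ((1 - cos y) / y^2 * (y * ln 2)) = t / y * (1 - cos y)"
      using y by (simp add: power2_eq_square)
    also have "t / y = 2 powr - x" using assms by (simp add: y_def powr_minus divide_inverse)
    finally show ?thesis by (simp add: y_def)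
  qed
  have lim0: "(A \<longlongrightarrow> 0) (at_right 0)"
  proof -
    have "((\<lambda>y. (1 - cos y) / y) \<longlongrightarrow> (0::real)) (at_right 0)" by real_asymp
    moreover have "(Si \<longlongrightarrow> 0) (at_right 0)"
      using isCont_Si[of 0] by (auto simp: isCont_def Si_def zero_ereal_def[symmetric] intro: tendsto_mono[OF at_le])
    ultimately have "(A \<longlongrightarrow> 0 - 0) (at_right 0)" unfolding A_def by (intro tendsto_diff)
    then show ?thesis by simp
  qed
  have lim1: "(A \<longlongrightarrow> pi / 2) at_top"
  proof -
    have "((\<lambda>y. (1 - cos y) / y) \<longlongrightarrow> (0::real)) at_top" by real_asymp
    then have "(A \<longlongrightarrow> pi / 2 - 0) at_top" unfolding A_def by (intro tendsto_diff Si_at_top)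
    then show ?thesis by simp
  qed
  have "filterlim (\<lambda>x. t * 2 powr x) (at_right 0) at_bot" using assms by real_asymp
  then have "(F \<longlongrightarrow> t / ln 2 * 0) at_bot"
    unfolding F_def by (intro tendsto_mult tendsto_const filterlim_compose[OF lim0])
  moreover have "filterlim (\<lambda>x. t * 2 powr x) at_top at_top" using assms by real_asymp
  then have "(F \<longlongrightarrow> t / ln 2 * (pi / 2)) at_top"
    unfolding F_def by (intro tendsto_mult tendsto_const filterlim_compose[OF lim1])
  ultimately have "set_integrable lborel (einterval (-\<infinity>) \<infinity>) (\<lambda>x. 2 powr - x * (1 - cos (t * 2 powr x)))"
      "(LBINT x=-\<infinity>..\<infinity>. 2 powr - x * (1 - cos (t * 2 powr x))) = t / ln 2 * (pi / 2) - t / ln 2 * 0"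
    by (intro interval_integral_FTC_nonneg[where F = F] F';
        simp add: ereal_tendsto_simps continuous_intros)+
  then show ?thesis
    by (simp add: has_bochner_integral_iff set_integrable_def interval_lebesgue_integral_def
        set_lebesgue_integral_def)
qed

lemma cos_kernel_integral:
  "has_bochner_integral lborel (\<lambda>x. 2 powr - x * (1 - cos (t * 2 powr x))) (\<bar>t\<bar> * pi / (2 * ln 2))"
proof -
  consider "t > 0" | "t = 0" | "- t > 0" by linarith
  then show ?thesis
  proof cases
    case 3
    then show ?thesis using cos_kernel_integral_pos[OF 3] by simp
  qed (use cos_kernel_integral_pos[of t] in auto)
qed

text \<open>Adding the Fourier integrals at y and -y costs nothing, as the density vanishes at -y.
  The constant 1 is free because the weight has integral 0, and it makes the kernel
  \<open>2 powr - x * (1 - cos (t * 2 powr x))\<close> integrable as x tends to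
  -\<infinity>.\<close>

lemma weight_density_cos:
  assumes "y > 0"
  shows "(\<integral>t. of_real (1 - cos (y * t)) * weight_fn (\<i> * of_real t) \<partial>lborel) = - of_real (pi * weight_density y)"
proof -
  have i: "integrable lborel (\<lambda>t. cis (- (x * t)) * weight_fn (\<i> * of_real t))" for x
    by (intro integrable_mult_weight[of _ 1] continuous_intros) auto
  have "(\<integral>t. cis (- (y * t)) * weight_fn (\<i> * of_real t) + cis (- (- y * t)) * weight_fn (\<i> * of_real t) \<partial>lborel)
      = of_real (2 * pi * weight_density y)"
    using assms i[of y] i[of "- y"] weight_fourier[of y] weight_fourier[of "- y"]
    by (simp add: weight_density_nonpos)
  also have "(\<lambda>t. cis (- (y * t)) * weight_fn (\<i> * of_real t) + cis (- (- y * t)) * weight_fn (\<i> * of_real t))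
      = (\<lambda>t. 2 * (of_real (cos (y * t)) * weight_fn (\<i> * of_real t)))"
    by (rule ext) (simp add: complex_eq_iff algebra_simps)
  finally have c: "(\<integral>t. of_real (cos (y * t)) * weight_fn (\<i> * of_real t) \<partial>lborel) = of_real (pi * weight_density y)"
    by simp
  have "integrable lborel (\<lambda>t. of_real (cos (y * t)) * weight_fn (\<i> * of_real t))"
    by (intro integrable_mult_weight[of _ 1] continuous_intros) (auto intro: order_trans[OF abs_cos_le_one])
  then show ?thesis using integrable_weight c by (simp add: left_diff_distrib integral_weight)
qed

text \<open>Because the kernel k is nonnegative, its L1 norm in x is the value pi |t| / (2 ln 2)
  computed above. Fubini's hypothesis therefore reduces to integrability of t W(it).\<close>

lemma integral_weight_density_log:
  shows "integrable lborel (\<lambda>x. complex_of_real (2 powr - x * weight_density (2 powr x)))" (is ?I)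
    and "(\<integral>x. complex_of_real (2 powr - x * weight_density (2 powr x)) \<partial>lborel)
       = - complex_of_real (1 / (2 * ln 2)) * (\<integral>t. of_real \<bar>t\<bar> * weight_fn (\<i> * of_real t) \<partial>lborel)" (is ?E)
proof -
  define k where "k = (\<lambda>t x. 2 powr - x * (1 - cos (t * 2 powr x)) :: real)"
  define f where "f = (\<lambda>t x. of_real (k t x) * weight_fn (\<i> * of_real t))"
  have k0: "0 \<le> k t x" for t x by (simp add: k_def)
  have kint: "integrable lborel (k t)" "(\<integral>x. k t x \<partial>lborel) = \<bar>t\<bar> * pi / (2 * ln 2)" for t
    using cos_kernel_integral[of t] by (simp_all add: k_def has_bochner_integral_iff)
  have "continuous_on UNIV (\<lambda>p::real \<times> real. f (fst p) (snd p))"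
    unfolding f_def k_def by (intro continuous_intros) auto
  then have meas: "case_prod f \<in> borel_measurable (lborel \<Otimes>\<^sub>M lborel)"
    using borel_measurable_continuous_onI by (simp add: lborel_prod case_prod_unfold)
  have norm_f: "norm (f t x) = k t x * norm (weight_fn (\<i> * of_real t))" for t x
    using k0 by (simp add: f_def norm_mult)
  have "integrable (lborel \<Otimes>\<^sub>M lborel) (case_prod f)"
  proof (rule lborel_pair.Fubini_integrable[OF meas])
    have "integrable lborel (\<lambda>t. norm (of_real t * weight_fn (\<i> * of_real t)) * (pi / (2 * ln 2)))"
      by (intro integrable_mult_left integrable_norm integrable_t_weight)
    then show "integrable lborel (\<lambda>t. \<integral>x. norm (case (t, x) of (t, x) \<Rightarrow> f t x) \<partial>lborel)"
      by (simp add: norm_f kint norm_mult mult_ac)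
    show "AE t in lborel. integrable lborel (\<lambda>x. case (t, x) of (t, x) \<Rightarrow> f t x)"
      using kint by (simp add: f_def)
  qed
  note Fub = lborel_pair.Fubini_integral[OF this] lborel_pair.integrable_snd[OF this]
  have inner: "(\<integral>t. f t x \<partial>lborel) = - of_real pi * of_real (2 powr - x * weight_density (2 powr x))" for x
    using weight_density_cos[of "2 powr x"] unfolding f_def k_def
    by (simp add: mult.assoc mult.commute[of _ "2 powr x"])
  have "integrable lborel (\<lambda>x. - (1 / of_real pi) * (- of_real pi * complex_of_real (2 powr - x * weight_density (2 powr x))))"
    using Fub(2) unfolding inner by (rule integrable_mult_right)
  then show ?I by simp
  have "(\<integral>x. f t x \<partial>lborel) = of_real (pi / (2 * ln 2)) * (of_real \<bar>t\<bar> * weight_fn (\<i> * of_real t))" for t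
    using kint[of t] unfolding f_def by simp
  with Fub(1) inner have e: "- of_real pi * (\<integral>x. complex_of_real (2 powr - x * weight_density (2 powr x)) \<partial>lborel)
     = of_real (pi / (2 * ln 2)) * (\<integral>t. of_real \<bar>t\<bar> * weight_fn (\<i> * of_real t) \<partial>lborel)"
    by simp
  let ?V = "\<integral>x. complex_of_real (2 powr - x * weight_density (2 powr x)) \<partial>lborel"
  have "?V = - (1 / of_real pi) * (- of_real pi * ?V)" by simp
  also have "\<dots> = - complex_of_real (1 / (2 * ln 2)) * (\<integral>t. of_real \<bar>t\<bar> * weight_fn (\<i> * of_real t) \<partial>lborel)"
    unfolding e by simp
  finally show ?E .
qed

lemma rescaled_density_bounded: "\<exists>B. \<forall>x. \<bar>rescaled_density x\<bar> \<le> B"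
proof -
  define B where "B = 1 / (2 * pi) * (\<integral>t. norm (poincare_fn (\<i> * of_real t)) \<partial>lborel)"
  have "\<bar>rescaled_density x\<bar> \<le> B" for x
  proof -
    have "\<bar>rescaled_density x\<bar> = norm (complex_of_real (rescaled_density x))" by simp
    also have "\<dots> = 1 / (2 * pi) * norm (\<integral>t. cis (- (x * t)) * poincare_fn (\<i> * of_real t) \<partial>lborel)"
      unfolding rescaled_density_fourier by (simp add: norm_mult norm_divide)
    also have "\<dots> \<le> 1 / (2 * pi) * (\<integral>t. norm (cis (- (x * t)) * poincare_fn (\<i> * of_real t)) \<partial>lborel)"
      by (intro mult_left_mono integral_norm_bound) auto
    finally show ?thesis by (simp add: B_def norm_mult)
  qed
  then show ?thesis by blast
qed

text \<open>With \<open>r x = 2\<^sup>-\<^sup>x \<rho>(2\<^sup>x)\<close> the integrand is \<open>r (x - 1) - r x\<close>, so its integral telescopes;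
  \<open>r\<close> vanishes at \<open>\<infinity>\<close> and approaches the periodic function \<open>\<sigma>\<close> at \<open>-\<infinity>\<close>.\<close>

lemma sigma_mean_eq:
  "(LBINT x=0..1. sigma_fn x) = (\<integral>x. complex_of_real (2 powr - x * weight_density (2 powr x)) \<partial>lborel)"
proof -
  define r where "r = (\<lambda>x. 2 powr - x * rescaled_density (2 powr x))"
  define sg where "sg = (\<lambda>x. Re (sigma_fn x))"
  define v where "v = (\<lambda>x. 2 powr - x * weight_density (2 powr x))"
  have dens: "continuous_on UNIV rescaled_density"
    using continuous_on_Re[OF continuous_rescaled_density] by simp
  have contr: "continuous_on UNIV r"
    unfolding r_def by (intro continuous_intros continuous_on_compose2[OF dens]) auto
  have contsg: "continuous_on UNIV sg" unfolding sg_def by (intro continuous_intros continuous_sigma_fn)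
  have vr: "v x = r (x - 1) - r x" for x
    by (simp add: v_def r_def weight_density_def powr_diff powr_minus field_simps)
  have sgfn: "sigma_fn x = of_real (sg x)" for x
    using sigma_fn_real[of x] by (simp add: sg_def)
  have per: "sg (x + 1) = sg x" for x by (simp add: sg_def sigma_fn_periodic)
  obtain K where K: "K \<ge> 0" "\<And>y. norm (sigma_tail y) \<le> K * y^2" using sigma_tail_bound by blast
  have near: "\<bar>sg x - r x\<bar> \<le> K * 2 powr x" for x
  proof -
    have "sg x - r x = Re (of_real (2 powr - x) * sigma_tail (2 powr x))"
      by (simp add: sg_def r_def sigma_fn_eq algebra_simps)
    also have "\<bar>\<dots>\<bar> \<le> 2 powr - x * norm (sigma_tail (2 powr x))"
      using abs_Re_le_cmod[of "of_real (2 powr - x) * sigma_tail (2 powr x)"] by (simp add: norm_mult)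
    also have "\<dots> \<le> 2 powr - x * (K * (2 powr x)^2)" by (intro mult_left_mono K) auto
    also have "\<dots> = K * 2 powr x" by (simp add: powr_minus power2_eq_square field_simps)
    finally show ?thesis .
  qed
  obtain B where B: "\<And>x. \<bar>rescaled_density x\<bar> \<le> B" using rescaled_density_bounded by blast
  have rB: "\<bar>r x\<bar> \<le> B * 2 powr - x" for x
    using mult_left_mono[OF B[of "2 powr x"], of "2 powr - x"] by (simp add: r_def abs_mult mult.commute)
  obtain \<Phi> where \<Phi>: "\<And>x. (\<Phi> has_real_derivative r x) (at x)"
    using einterval_antiderivative[of "-\<infinity>" "\<infinity>" r] contr
    by (auto simp: continuous_on_eq_continuous_at has_real_derivative_iff_has_vector_derivative)
  obtain \<Sigma> where \<Sigma>: "\<And>x. (\<Sigma> has_real_derivative sg x) (at x)"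
    using einterval_antiderivative[of "-\<infinity>" "\<infinity>" sg] contsg
    by (auto simp: continuous_on_eq_continuous_at has_real_derivative_iff_has_vector_derivative)
  \<comment> \<open>V(x) is minus the integral of r over (x - 1, x) and a primitive of v, so the
    whole-line integral of v is the difference of two limits of V.\<close>
  define V where "V = (\<lambda>x. \<Phi> (x - 1) - \<Phi> x)"
  have V': "(V has_real_derivative v x) (at x)" for x
  proof -
    have "((\<lambda>x. \<Phi> (x - 1)) has_real_derivative r (x - 1)) (at x)"
      using DERIV_shift[of \<Phi> "r (x - 1)" x "-1"] \<Phi>[of "x - 1"] by simp
    then show ?thesis unfolding V_def vr by (intro DERIV_diff \<Phi>)
  qed
  define m where "m = \<Sigma> 1 - \<Sigma> 0"
  have mean: "\<Sigma> (x + 1) - \<Sigma> x = m" for x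
  proof -
    have "((\<lambda>x. \<Sigma> (x + 1) - \<Sigma> x) has_real_derivative sg (x + 1) - sg x) (at x)" for x
      using DERIV_shift[of \<Sigma> "sg (x + 1)" x 1] \<Sigma> by (intro DERIV_diff) simp_all
    then have "((\<lambda>x. \<Sigma> (x + 1) - \<Sigma> x) has_real_derivative 0) (at x)" for x by (simp add: per)
    then have "\<Sigma> (x + 1) - \<Sigma> x = \<Sigma> (0 + 1) - \<Sigma> 0" using DERIV_isconst_all by blast
    then show ?thesis by (simp add: m_def)
  qed
  have lim_top: "(V \<longlongrightarrow> 0) at_top"
  proof (rule Lim_null_comparison)
    show "\<forall>\<^sub>F x in at_top. norm (V x) \<le> B * 2 powr - (x - 1)"
    proof (intro always_eventually allI)
      fix x
      obtain z where z: "x - 1 < z" "z < x" "\<Phi> x - \<Phi> (x - 1) = (x - (x - 1)) * r z"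
        using MVT2[of "x - 1" x \<Phi> r] \<Phi> by auto
      have "0 \<le> B" using order_trans[OF abs_ge_zero B] .
      then have "B * 2 powr - z \<le> B * 2 powr - (x - 1)" using z by (intro mult_left_mono powr_mono) auto
      then show "norm (V x) \<le> B * 2 powr - (x - 1)"
        using rB[of z] z(3) by (simp add: V_def abs_minus_commute)
    qed
    show "((\<lambda>x. B * 2 powr - (x - 1)) \<longlongrightarrow> 0) at_top"
      by (intro tendsto_mult_right_zero) real_asymp
  qed
  have lim_bot: "(V \<longlongrightarrow> - m) at_bot"
  proof (rule LIM_zero_cancel, rule Lim_null_comparison)
    show "\<forall>\<^sub>F x in at_bot. norm (V x - - m) \<le> K * 2 powr x"
    proof (intro always_eventually allI)
      fix x
      \<comment> \<open>By periodicity m is the mean of sg over (x - 1, x) too, so V x + m is the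
        integral of sg - r over that interval; the mean value theorem reduces it to the pointwise
        bound \<open>near\<close>.\<close>
      obtain z where z: "x - 1 < z" "z < x"
         "(\<Sigma> x - \<Phi> x) - (\<Sigma> (x - 1) - \<Phi> (x - 1)) = (x - (x - 1)) * (sg z - r z)"
        using MVT2[of "x - 1" x "\<lambda>x. \<Sigma> x - \<Phi> x" "\<lambda>x. sg x - r x"] \<Phi> \<Sigma> DERIV_diff by fastforce
      have "V x - - m = sg z - r z" using mean[of "x - 1"] z(3) by (simp add: V_def)
      moreover have "K * 2 powr z \<le> K * 2 powr x" using z K(1) by (intro mult_left_mono powr_mono) auto
      ultimately show "norm (V x - - m) \<le> K * 2 powr x" using near[of z] by simp
    qed
    show "((\<lambda>x. K * 2 powr x) \<longlongrightarrow> 0) at_bot"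
      by (intro tendsto_mult_right_zero) real_asymp
  qed
  have vint: "integrable lborel v"
    using integrable_Re[OF integral_weight_density_log(1)] by (simp add: v_def)
  have contv: "continuous_on UNIV v"
    unfolding vr by (intro continuous_intros contr continuous_on_compose2[OF contr]) auto
  have "(LBINT x=-\<infinity>..\<infinity>. v x) = 0 - - m"
  proof (rule interval_integral_FTC_integrable)
    show "(V has_vector_derivative v x) (at x)" for x
      using V' by (simp add: has_real_derivative_iff_has_vector_derivative)
    show "isCont v x" for x using contv by (simp add: continuous_on_eq_continuous_at)
    show "set_integrable lborel (einterval (-\<infinity>) \<infinity>) v" using vint by (simp add: set_integrable_def)
  qed (use lim_top lim_bot in \<open>simp_all add: ereal_tendsto_simps\<close>)
  then have vm: "(\<integral>x. v x \<partial>lborel) = m"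
    by (simp add: interval_lebesgue_integral_def set_lebesgue_integral_def)
  have "(LBINT x=0..1. sg x) = m"
    using interval_integral_FTC_finite[of 0 1 sg \<Sigma>] \<Sigma> continuous_on_subset[OF contsg]
    by (simp add: m_def zero_ereal_def one_ereal_def has_field_derivative_at_within
        flip: has_real_derivative_iff_has_vector_derivative)
  then have "(LBINT x=0..1. sigma_fn x) = of_real m"
    unfolding sgfn by (simp add: interval_lebesgue_integral_of_real)
  also have "\<dots> = of_real (\<integral>x. v x \<partial>lborel)" by (simp add: vm)
  also have "\<dots> = (\<integral>x. complex_of_real (v x) \<partial>lborel)" by (rule integral_complex_of_real[symmetric])
  finally show ?thesis by (simp add: v_def)
qed

text \<open>Reality is read off from the preceding mean formula, in which all other quantities are
  real. The real part is even in t by \<open>weight_it_minus\<close>, which halves the line.\<close>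

lemma integral_abs_t_weight:
  "(\<integral>t. of_real \<bar>t\<bar> * weight_fn (\<i> * of_real t) \<partial>lborel)
     = of_real (2 * (LINT t:{0<..}|lborel. t * Re (weight_fn (\<i> * of_real t))))" (is "?L = of_real (2 * ?R)")
proof -
  have i: "integrable lborel (\<lambda>t. of_real \<bar>t\<bar> * weight_fn (\<i> * of_real t))"
    using abs_le_1_plus_sq by (intro integrable_mult_weight[of _ 1] continuous_intros) auto
  have e: "- complex_of_real (1 / (2 * ln 2)) * ?L = complex_of_real (\<integral>x. 2 powr - x * weight_density (2 powr x) \<partial>lborel)" (is "_ = of_real ?V")
    unfolding integral_weight_density_log(2)[symmetric] by (rule integral_complex_of_real)
  have "?L = of_real (- (2 * ln 2)) * (- complex_of_real (1 / (2 * ln 2)) * ?L)" by simp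
  also have "\<dots> = of_real (- (2 * ln 2) * ?V)" unfolding e by simp
  finally have "?L = of_real (- (2 * ln 2) * ?V)" .
  then have L: "?L = of_real (Re ?L)" by (metis Re_complex_of_real)
  have "Re ?L = (\<integral>t. \<bar>t\<bar> * Re (weight_fn (\<i> * of_real t)) \<partial>lborel)"
    using integral_Re[OF i] by simp
  also have "\<dots> = 2 * ?R"
  proof (rule has_bochner_integral_integral_eq)
    have "has_bochner_integral lborel (\<lambda>t. \<bar>t\<bar> * Re (weight_fn (\<i> * of_real t)))
      (2 *\<^sub>R (\<integral>t. indicator {0..} t *\<^sub>R (\<bar>t\<bar> * Re (weight_fn (\<i> * of_real t))) \<partial>lborel))"
    proof (rule has_bochner_integral_even_function)
      show "has_bochner_integral lborel (\<lambda>t. indicator {0..} t *\<^sub>R (\<bar>t\<bar> * Re (weight_fn (\<i> * of_real t))))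
        (\<integral>t. indicator {0..} t *\<^sub>R (\<bar>t\<bar> * Re (weight_fn (\<i> * of_real t))) \<partial>lborel)"
        using integrable_Re[OF i]
        by (intro has_bochner_integral_integrable integrable_mult_indicator[where f = "\<lambda>t. \<bar>t\<bar> * Re (weight_fn (\<i> * of_real t))"]) auto
      show "\<bar>- t\<bar> * Re (weight_fn (\<i> * of_real (- t))) = \<bar>t\<bar> * Re (weight_fn (\<i> * of_real t))" for t
        unfolding weight_it_minus by simp
    qed
    moreover have e: "indicator {0..} t *\<^sub>R (\<bar>t\<bar> * Re (weight_fn (\<i> * of_real t)))
       = indicator {0<..} t *\<^sub>R (t * Re (weight_fn (\<i> * of_real t)))" for t
      by (auto simp: indicator_def)
    ultimately show "has_bochner_integral lborel (\<lambda>t. \<bar>t\<bar> * Re (weight_fn (\<i> * of_real t))) (2 * ?R)"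
      unfolding e by (simp only: set_lebesgue_integral_def real_scaleR_def)
  qed
  finally show ?thesis using L by simp
qed

lemma sigma_mean_Re:
  "(LBINT x=0..1. sigma_fn x)
     = of_real (- 1 / ln 2 * (LINT t:{0<..}|lborel. t * Re (weight_fn (\<i> * of_real t))))"
  unfolding sigma_mean_eq integral_weight_density_log(2) integral_abs_t_weight by simp

section \<open>Contour rotation in the second quadrant\<close>

lemma set_integrable_half_line_bound:
  fixes g :: "real \<Rightarrow> complex"
  assumes "continuous_on {0<..} g" "\<And>s. s > 0 \<Longrightarrow> norm (g s) \<le> K / (1 + s^2)"
  shows "set_integrable lborel {0<..} g"
  unfolding set_integrable_def
proof (rule Bochner_Integration.integrable_bound[OF integrable_inv_1_plus_sq[of "\<bar>K\<bar>"]])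
  show "(\<lambda>s. indicator {0<..} s *\<^sub>R g s) \<in> borel_measurable lborel"
    using borel_measurable_continuous_on_indicator[OF _ assms(1)] by simp
  have "norm (g s) \<le> \<bar>K\<bar> / (1 + s^2)" if "s > 0" for s
  proof -
    have "K / (1 + s^2) \<le> \<bar>K\<bar> / (1 + s^2)" by (intro divide_right_mono) (auto simp: add_nonneg_nonneg)
    then show ?thesis using assms(2)[OF that] by linarith
  qed
  then show "AE s in lborel. norm (indicator {0<..} s *\<^sub>R g s) \<le> norm (\<bar>K\<bar> / (1 + s^2))"
    by (intro AE_I2) (auto simp: indicator_def abs_of_nonneg add_nonneg_nonneg)
qed

text \<open>The chord from -s to is replaces the usual quarter circle; it keeps distance s / sqrt 2
  from 0.\<close>

lemma quadrant_chord:
  assumes "s > 0" "z \<in> closed_segment (- of_real s) (\<i> * of_real s)"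
  shows "Re z \<le> 0" "0 \<le> Im z" "s^2 / 2 \<le> (norm z)^2"
proof -
  obtain u where u: "0 \<le> u" "u \<le> 1" "z = (1 - u) *\<^sub>R (- of_real s) + u *\<^sub>R (\<i> * of_real s)"
    using assms(2) by (auto simp: closed_segment_def)
  then have z: "Re z = - ((1 - u) * s)" "Im z = u * s" by simp_all
  show "Re z \<le> 0" "0 \<le> Im z" unfolding z using u assms(1) by auto
  have "(norm z)^2 - s^2 / 2 = 2 * ((u - 1/2) * s)^2"
    unfolding cmod_power2 z by (simp add: field_simps power2_eq_square)
  then show "s^2 / 2 \<le> (norm z)^2" using zero_le_power2[of "(u - 1/2) * s"] by linarith
qed

text \<open>No contour integral is formed. The half-plane Re z < Im z is convex and contains both
  open rays, so f has a primitive G there, and M(s) = G(is) - G(-s) has derivative i f(is) + f(-s).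
  Along the chord |M(s)| \<le> 2s K / (1 + s^2/2), which tends to 0 at both ends: the factor s
  handles the origin, the decay of f infinity.\<close>

lemma quadrant_rotation:
  assumes hol: "f holomorphic_on {z. Re z < Im z}" and K: "0 \<le> K"
    and bound: "\<And>z. Re z \<le> 0 \<Longrightarrow> 0 \<le> Im z \<Longrightarrow> z \<noteq> 0 \<Longrightarrow> norm (f z) \<le> K / (1 + (norm z)^2)"
  shows "set_integrable lborel {0<..} (\<lambda>s. f (- of_real s))"
    and "set_integrable lborel {0<..} (\<lambda>s. f (\<i> * of_real s))"
    and "(LINT s:{0<..}|lborel. f (- of_real s)) = - \<i> * (LINT s:{0<..}|lborel. f (\<i> * of_real s))"
proof -
  let ?D = "{z. Re z < Im z}"
  have opn: "open ?D" by (intro open_Collect_less continuous_intros)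
  have "?D = {z. inner (Complex 1 (-1)) z < 0}" by (auto simp: inner_complex_def)
  then have conv: "convex ?D" by (simp add: convex_halfspace_lt)
  have contf: "continuous_on ?D f" using hol by (rule holomorphic_on_imp_continuous_on)
  have c1: "continuous_on {0<..} (\<lambda>s. f (- of_real s))"
    by (rule continuous_on_compose2[OF contf]) (auto intro!: continuous_intros)
  have c2: "continuous_on {0<..} (\<lambda>s. f (\<i> * of_real s))"
    by (rule continuous_on_compose2[OF contf]) (auto intro!: continuous_intros)
  have b1: "norm (f (- of_real s)) \<le> K / (1 + s^2)" if "s > 0" for s
    using bound[of "- of_real s"] that by simp
  have b2: "norm (f (\<i> * of_real s)) \<le> K / (1 + s^2)" if "s > 0" for s
    using bound[of "\<i> * of_real s"] that by (simp add: norm_mult)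
  show i1: "set_integrable lborel {0<..} (\<lambda>s. f (- of_real s))"
    using c1 b1 by (rule set_integrable_half_line_bound)
  show i2: "set_integrable lborel {0<..} (\<lambda>s. f (\<i> * of_real s))"
    using c2 b2 by (rule set_integrable_half_line_bound)
  obtain G where G: "\<And>z. z \<in> ?D \<Longrightarrow> (G has_field_derivative f z) (at z)"
    using holomorphic_convex_primitive'[OF conv opn hol] at_within_open[OF _ opn] by metis
  define M where "M = (\<lambda>s. G (\<i> * of_real s) - G (- of_real s))"
  define m where "m = (\<lambda>s. \<i> * f (\<i> * of_real s) + f (- of_real s))"
  have M': "(M has_vector_derivative m s) (at s)" if "s > 0" for s
  proof -
    have "((\<lambda>z. G (\<i> * z) - G (- z)) has_field_derivative (f (\<i> * of_real s) * \<i> - f (- of_real s) * (- 1))) (at (of_real s))"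
      using that by (intro DERIV_diff DERIV_chain2[where f = G] G) (auto intro!: derivative_eq_intros)
    then have "((\<lambda>z. G (\<i> * z) - G (- z)) has_field_derivative m s) (at (of_real s))"
      by (simp add: m_def mult.commute)
    then show ?thesis unfolding M_def by (rule has_vector_derivative_real_field)
  qed
  have Mb: "norm (M s) \<le> 2 * s * (K / (1 + s^2 / 2))" if s: "s > 0" for s
  proof -
    let ?S = "closed_segment (- of_real s) (\<i> * of_real s)"
    have SD: "?S \<subseteq> ?D" using conv s by (intro closed_segment_subset) auto
    have "norm (G (\<i> * of_real s) - G (- of_real s)) \<le> K / (1 + s^2 / 2) * norm (\<i> * of_real s - (- of_real s))"
    proof (rule field_differentiable_bound)
      show "convex ?S" by simp
      show "(G has_field_derivative f z) (at z within ?S)" if "z \<in> ?S" for z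
        by (rule has_field_derivative_at_within[OF G[OF subsetD[OF SD that]]])
      show "norm (f z) \<le> K / (1 + s^2 / 2)" if "z \<in> ?S" for z
      proof -
        note q = quadrant_chord[OF s that]
        have "z \<noteq> 0" using q(3) s by auto
        then have "norm (f z) \<le> K / (1 + (norm z)^2)" using q by (intro bound)
        also have "\<dots> \<le> K / (1 + s^2 / 2)"
          using q(3) K by (intro divide_left_mono mult_pos_pos) (auto simp: add_pos_nonneg)
        finally show ?thesis .
      qed
    qed auto
    also have "\<dots> \<le> K / (1 + s^2 / 2) * (2 * s)"
    proof (rule mult_left_mono)
      show "norm (\<i> * of_real s - (- of_real s)) \<le> 2 * s"
        using norm_triangle_ineq[of "\<i> * of_real s" "of_real s"] s by (simp add: norm_mult)
    qed (use K in \<open>simp add: add_nonneg_nonneg\<close>)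
    finally show ?thesis by (simp only: M_def mult.commute)
  qed
  have lim0: "(M \<longlongrightarrow> 0) (at_right 0)"
  proof (rule Lim_null_comparison)
    show "\<forall>\<^sub>F s in at_right 0. norm (M s) \<le> 2 * s * (K / (1 + s^2 / 2))"
      using Mb eventually_at_right_less by (rule eventually_mono[rotated])
    show "((\<lambda>s. 2 * s * (K / (1 + s^2 / 2))) \<longlongrightarrow> 0) (at_right 0)" by real_asymp
  qed
  have lim1: "(M \<longlongrightarrow> 0) at_top"
  proof (rule Lim_null_comparison)
    show "\<forall>\<^sub>F s in at_top. norm (M s) \<le> 2 * s * (K / (1 + s^2 / 2))"
      using Mb eventually_gt_at_top by (rule eventually_mono[rotated])
    show "((\<lambda>s. 2 * s * (K / (1 + s^2 / 2))) \<longlongrightarrow> 0) at_top" by real_asymp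
  qed
  have im: "set_integrable lborel {0<..} m"
    unfolding m_def by (intro set_integral_add set_integrable_mult_right i1 i2)
  have "(LBINT s=ereal 0..\<infinity>. m s) = 0 - 0"
  proof (rule interval_integral_FTC_integrable)
    have "continuous_on {0<..} m" unfolding m_def by (intro continuous_intros c1 c2)
    then show "isCont m x" if "ereal 0 < ereal x" for x
      using that by (simp add: continuous_on_eq_continuous_at)
  qed (use M' im lim0 lim1 in \<open>auto simp: ereal_tendsto_simps simp del: zero_ereal_def\<close>)
  then have "(LINT s:{0<..}|lborel. m s) = 0" by (simp add: interval_integral_to_infinity_eq)
  moreover have "(LINT s:{0<..}|lborel. m s) = \<i> * (LINT s:{0<..}|lborel. f (\<i> * of_real s)) + (LINT s:{0<..}|lborel. f (- of_real s))"
    unfolding m_def using i1 i2 by (subst set_integral_add) auto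
  ultimately show "(LINT s:{0<..}|lborel. f (- of_real s)) = - \<i> * (LINT s:{0<..}|lborel. f (\<i> * of_real s))"
    by (simp add: add_eq_0_iff)
qed

lemma set_integral_Re:
  fixes f :: "real \<Rightarrow> complex"
  assumes "set_integrable lborel A f"
  shows "set_integrable lborel A (\<lambda>x. Re (f x))" "(LINT x:A|lborel. Re (f x)) = Re (LINT x:A|lborel. f x)"
  using integrable_Re[OF assms[unfolded set_integrable_def]] integral_Re[OF assms[unfolded set_integrable_def]]
  by (simp_all add: set_integrable_def set_lebesgue_integral_def)

lemma set_integral_Im:
  fixes f :: "real \<Rightarrow> complex"
  assumes "set_integrable lborel A f"
  shows "set_integrable lborel A (\<lambda>x. Im (f x))" "(LINT x:A|lborel. Im (f x)) = Im (LINT x:A|lborel. f x)"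
  using integrable_Im[OF assms[unfolded set_integrable_def]] integral_Im[OF assms[unfolded set_integrable_def]]
  by (simp_all add: set_integrable_def set_lebesgue_integral_def)

lemma mult_weight_quadrant_bound:
  assumes B: "0 \<le> B" and c: "\<And>z. Re z \<le> 0 \<Longrightarrow> 0 \<le> Im z \<Longrightarrow> z \<noteq> 0 \<Longrightarrow> norm (c z) \<le> B * (1 + (norm z)^2)"
  shows "\<exists>K\<ge>0. \<forall>z. Re z \<le> 0 \<longrightarrow> 0 \<le> Im z \<longrightarrow> z \<noteq> 0 \<longrightarrow> norm (c z * weight_fn z) \<le> K / (1 + (norm z)^2)"
proof -
  obtain K where K: "K \<ge> 0" "\<And>z. Re z \<le> 0 \<Longrightarrow> norm (weight_fn z) \<le> K / (1 + (norm z)^2)^2"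
    using weight_decay by blast
  have "norm (c z * weight_fn z) \<le> B * K / (1 + (norm z)^2)" if "Re z \<le> 0" "0 \<le> Im z" "z \<noteq> 0" for z
    unfolding norm_mult using c K that B by (intro integrable_mult_weight_aux) auto
  then show ?thesis using B K(1) by (intro exI[of _ "B * K"]) auto
qed

lemma weight_neg_real: "weight_fn (- of_real s) = of_real (Re (weight_fn (- of_real s)))"
  using weight_cnj[of "- of_real s"] by (simp add: complex_eq_iff)

text \<open>Rotation of f(z) = z W(z): on the imaginary axis f(is) = i s W(is), and the factor -i
  cancels the i. The integral over the negative axis is real, so only Re W survives on the
  right.\<close>

lemma negative_axis_integral:
  shows "set_integrable lborel {0<..} (\<lambda>s. - of_real s * weight_fn (- of_real s))"
    and "set_integrable lborel {0<..} (\<lambda>s. s * Re (weight_fn (\<i> * of_real s)))"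
    and "(LINT s:{0<..}|lborel. - of_real s * weight_fn (- of_real s))
       = of_real (LINT s:{0<..}|lborel. s * Re (weight_fn (\<i> * of_real s)))"
proof -
  obtain K where K: "K \<ge> 0" "\<And>z. Re z \<le> 0 \<Longrightarrow> 0 \<le> Im z \<Longrightarrow> z \<noteq> 0 \<Longrightarrow>
      norm (z * weight_fn z) \<le> K / (1 + (norm z)^2)"
    using mult_weight_quadrant_bound[of 1 "\<lambda>z. z"] abs_le_1_plus_sq[of "norm _"] by auto
  note rot = quadrant_rotation[OF _ K, OF holomorphic_on_mult[OF holomorphic_on_ident holomorphic_weight[OF holomorphic_on_ident]]]
  show "set_integrable lborel {0<..} (\<lambda>s. - of_real s * weight_fn (- of_real s))" by (rule rot(1))
  have i: "set_integrable lborel {0<..} (\<lambda>s. of_real s * weight_fn (\<i> * of_real s))"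
    using set_integrable_mult_right[OF rot(2), of "- \<i>"] by (simp add: mult.assoc)
  show "set_integrable lborel {0<..} (\<lambda>s. s * Re (weight_fn (\<i> * of_real s)))"
    using set_integral_Re(1)[OF i] by simp
  let ?L = "LINT s:{0<..}|lborel. - of_real s * weight_fn (- of_real s)"
  have "?L = - \<i> * (LINT s:{0<..}|lborel. \<i> * (of_real s * weight_fn (\<i> * of_real s)))"
    using rot(3) by (simp add: mult.assoc)
  then have L: "?L = (LINT s:{0<..}|lborel. of_real s * weight_fn (\<i> * of_real s))" by simp
  have "?L = (LINT s:{0<..}|lborel. complex_of_real (- s * Re (weight_fn (- of_real s))))"
    by (subst weight_neg_real) simp
  then have "?L = of_real (LINT s:{0<..}|lborel. (- s * Re (weight_fn (- of_real s))))"
    by (simp only: set_integral_complex_of_real)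
  then have "?L = of_real (Re ?L)" by (metis Re_complex_of_real)
  also have "Re ?L = (LINT s:{0<..}|lborel. s * Re (weight_fn (\<i> * of_real s)))"
    unfolding L using set_integral_Re(2)[OF i] by simp
  finally show "?L = of_real (LINT s:{0<..}|lborel. s * Re (weight_fn (\<i> * of_real s)))" .
qed

lemma mult_abs_ln_le: "r > 0 \<Longrightarrow> r * \<bar>ln r\<bar> \<le> 1 + r^2" for r :: real
proof -
  assume r: "r > 0"
  have "ln r \<le> r" using ln_le_minus_one[OF r] by linarith
  then have a: "r * ln r \<le> r * r" using r by (intro mult_left_mono) auto
  have "- ln r \<le> inverse r" using ln_le_minus_one[of "inverse r"] r by (simp add: ln_inverse)
  then have "r * (- ln r) \<le> r * inverse r" using r by (intro mult_left_mono) auto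
  then have b: "r * (- ln r) \<le> 1" using r by simp
  have "r * \<bar>ln r\<bar> = r * ln r \<or> r * \<bar>ln r\<bar> = r * (- ln r)" by (auto simp: abs_if)
  then show ?thesis
    using a b zero_le_square[of r] unfolding power2_eq_square by (elim disjE) linarith+
qed

text \<open>Rotation of z Ln(-z) W(z), which is real on the negative axis, so the imaginary part of
  the rotated integral is 0. As Ln(-is) = ln s - i pi/2, this imaginary part couples s ln s Im W
  with (pi/2) s Re W.\<close>

lemma Ln_weight_integral:
  shows "set_integrable lborel {0<..} (\<lambda>s. ln s * s * Im (weight_fn (\<i> * of_real s)))"
    and "(LINT s:{0<..}|lborel. ln s * s * Im (weight_fn (\<i> * of_real s)))
       = pi / 2 * (LINT s:{0<..}|lborel. s * Re (weight_fn (\<i> * of_real s)))"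
proof -
  define c where "c = (\<lambda>z. z * Ln (- z))"
  have cb: "norm (c z) \<le> (1 + pi) * (1 + (norm z)^2)" if z: "z \<noteq> 0" for z
  proof -
    have "norm (Ln (- z)) \<le> \<bar>Re (Ln (- z))\<bar> + \<bar>Im (Ln (- z))\<bar>" by (rule cmod_le)
    also have "\<bar>Im (Ln (- z))\<bar> \<le> pi" using mpi_less_Im_Ln[of "- z"] Im_Ln_le_pi[of "- z"] z by simp
    also have "Re (Ln (- z)) = ln (norm z)" using z by (simp add: Re_Ln)
    finally have "norm z * norm (Ln (- z)) \<le> norm z * (\<bar>ln (norm z)\<bar> + pi)" by (intro mult_left_mono) auto
    also have "\<dots> = norm z * \<bar>ln (norm z)\<bar> + pi * norm z" by (simp add: algebra_simps)
    also have "\<dots> \<le> (1 + (norm z)^2) + pi * (1 + (norm z)^2)"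
      using mult_abs_ln_le[of "norm z"] abs_le_1_plus_sq[of "norm z"] z
      by (intro add_mono mult_left_mono) auto
    finally show ?thesis by (simp add: c_def norm_mult distrib_right)
  qed
  obtain K where K: "K \<ge> 0" "\<And>z. Re z \<le> 0 \<Longrightarrow> 0 \<le> Im z \<Longrightarrow> z \<noteq> 0 \<Longrightarrow>
      norm (c z * weight_fn z) \<le> K / (1 + (norm z)^2)"
    using mult_weight_quadrant_bound[of "1 + pi" c] cb pi_ge_zero by auto
  have hol: "(\<lambda>z. c z * weight_fn z) holomorphic_on {z. Re z < Im z}"
    unfolding c_def by (intro holomorphic_intros) (auto simp: complex_nonpos_Reals_iff)
  note rot = quadrant_rotation[OF hol K]
  have neg: "c (- of_real s) * weight_fn (- of_real s) = of_real (- s * ln s * Re (weight_fn (- of_real s)))"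
    if "s > 0" for s
    using that by (subst weight_neg_real) (simp add: c_def Ln_of_real)
  have up: "- \<i> * (c (\<i> * of_real s) * weight_fn (\<i> * of_real s))
      = of_real s * (of_real (ln s) - \<i> * of_real (pi / 2)) * weight_fn (\<i> * of_real s)" if "s > 0" for s
  proof -
    have "Ln (- (\<i> * of_real s)) = of_real (ln s) - \<i> * of_real (pi / 2)"
    proof -
      have e: "- (\<i> * of_real s) = of_real s * (- \<i>)" by simp
      have "Ln (- (\<i> * of_real s)) = of_real (ln s) + Ln (- \<i>)"
        unfolding e using Ln_times_of_real[OF that, of "- \<i>"] that by (simp add: Ln_of_real)
      then show ?thesis by simp
    qed
    then show ?thesis by (simp add: c_def mult.assoc)
  qed
  have i: "set_integrable lborel {0<..} (\<lambda>s. - \<i> * (c (\<i> * of_real s) * weight_fn (\<i> * of_real s)))"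
    by (rule set_integrable_mult_right) (use rot(2) in auto)
  have Imup: "Im (- \<i> * (c (\<i> * of_real s) * weight_fn (\<i> * of_real s)))
     = ln s * s * Im (weight_fn (\<i> * of_real s)) - pi / 2 * (s * Re (weight_fn (\<i> * of_real s)))" if "s > 0" for s
    unfolding up[OF that] by (simp add: algebra_simps)
  have i2: "set_integrable lborel {0<..} (\<lambda>s. ln s * s * Im (weight_fn (\<i> * of_real s)) - pi / 2 * (s * Re (weight_fn (\<i> * of_real s))))"
    using set_integral_Im(1)[OF i] Imup by (subst (asm) set_integrable_cong[OF refl refl]) auto
  have i3: "set_integrable lborel {0<..} (\<lambda>s. pi / 2 * (s * Re (weight_fn (\<i> * of_real s))))"
    by (rule set_integrable_mult_right) (rule negative_axis_integral(2))
  show i4: "set_integrable lborel {0<..} (\<lambda>s. ln s * s * Im (weight_fn (\<i> * of_real s)))"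
    using set_integral_add(1)[OF i2 i3] by simp
  have "(LINT s:{0<..}|lborel. c (- of_real s) * weight_fn (- of_real s))
     = (LINT s:{0<..}|lborel. complex_of_real (- s * ln s * Re (weight_fn (- of_real s))))"
    by (rule set_lebesgue_integral_cong) (use neg in auto)
  also have "\<dots> = of_real (LINT s:{0<..}|lborel. - s * ln s * Re (weight_fn (- of_real s)))"
    by (simp only: set_integral_complex_of_real)
  finally have "Im (LINT s:{0<..}|lborel. c (- of_real s) * weight_fn (- of_real s)) = 0" by simp
  moreover have "(LINT s:{0<..}|lborel. c (- of_real s) * weight_fn (- of_real s))
     = (LINT s:{0<..}|lborel. - \<i> * (c (\<i> * of_real s) * weight_fn (\<i> * of_real s)))"
    by (rule trans[OF rot(3) set_integral_mult_right[symmetric]])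
  ultimately have "(LINT s:{0<..}|lborel. Im (- \<i> * (c (\<i> * of_real s) * weight_fn (\<i> * of_real s)))) = 0"
    using set_integral_Im(2)[OF i] by simp
  also have "(LINT s:{0<..}|lborel. Im (- \<i> * (c (\<i> * of_real s) * weight_fn (\<i> * of_real s))))
    = (LINT s:{0<..}|lborel. ln s * s * Im (weight_fn (\<i> * of_real s)) - pi / 2 * (s * Re (weight_fn (\<i> * of_real s))))"
    by (rule set_lebesgue_integral_cong) (use Imup in auto)
  also have "\<dots> = (LINT s:{0<..}|lborel. ln s * s * Im (weight_fn (\<i> * of_real s)))
     - pi / 2 * (LINT s:{0<..}|lborel. s * Re (weight_fn (\<i> * of_real s)))"
    by (subst set_integral_diff(2)[OF i4 i3]) simp
  finally show "(LINT s:{0<..}|lborel. ln s * s * Im (weight_fn (\<i> * of_real s)))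
       = pi / 2 * (LINT s:{0<..}|lborel. s * Re (weight_fn (\<i> * of_real s)))" by simp
qed

section \<open>The Schroeder function on the unit interval\<close>

text \<open>4 (P(w) - P(p)) = (w - p)(w^2 + (2+p) w + (1+p)^2). If Re w \<ge> 0, a zero of the
  quadratic factor would have Im w = 0, and at a nonnegative real w this factor is positive.\<close>

lemma comp_map_roots_real:
  assumes p: "p > 0" and eq: "comp_map w = comp_map (of_real p)"
  shows "w = of_real p \<or> Re w < 0"
proof (rule disjCI)
  assume "\<not> Re w < 0"
  then have a: "0 \<le> Re w" by simp
  have "(w - of_real p) * (w^2 + of_real (2 + p) * w + of_real ((1 + p)^2)) = 4 * (comp_map w - comp_map (of_real p))"
    by (simp add: comp_map_def field_simps power2_eq_square power3_eq_cube)
  then have f: "(w - of_real p) * (w^2 + of_real (2 + p) * w + of_real ((1 + p)^2)) = 0" using eq by simp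
  have "w^2 + of_real (2 + p) * w + of_real ((1 + p)^2) \<noteq> 0"
  proof
    assume q: "w^2 + of_real (2 + p) * w + of_real ((1 + p)^2) = 0"
    have im: "Im w * (2 * Re w + (2 + p)) = 0"
      using arg_cong[OF q, of Im] by (simp add: power2_eq_square algebra_simps)
    have "2 * Re w + (2 + p) > 0" using a p by linarith
    then have "Im w = 0" using im by simp
    then have "(Re w)^2 + (2 + p) * Re w + (1 + p)^2 = 0"
      using arg_cong[OF q, of Re] by (simp add: power2_eq_square)
    moreover have "0 < (1 + p)^2" "0 \<le> (2 + p) * Re w" "0 \<le> (Re w)^2" using p a by auto
    ultimately show False by linarith
  qed
  then show "w = of_real p" using f by simp
qed

lemma comp_map_of_real: "comp_map (of_real p) = of_real (p * (1 + p)^2 / 4)"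
  by (simp add: comp_map_factor)

lemma Re_csqrt_pos: "z \<notin> \<real>\<^sub>\<le>\<^sub>0 \<Longrightarrow> 0 < Re (csqrt z)"
proof (rule ccontr)
  assume z: "z \<notin> \<real>\<^sub>\<le>\<^sub>0" and "\<not> 0 < Re (csqrt z)"
  then have "Re (csqrt z) = 0" using csqrt_principal[of z] by auto
  then have "(csqrt z)^2 = of_real (- ((Im (csqrt z))^2))"
    by (simp add: complex_eq_iff power2_eq_square)
  then have "z = of_real (- ((Im (csqrt z))^2))" by simp
  then have "z \<in> \<real>\<^sub>\<le>\<^sub>0" by (metis nonpos_Reals_of_real_iff neg_le_0_iff_le zero_le_power2)
  then show False using z by blast
qed

text \<open>Cardano in hyperbolic form: \<open>w = 4/3 sinh\<^sup>2 u\<close> turns \<open>P(w) = z\<close> into \<open>sinh(3u) = 3 \<surd>(3z)\<close>.\<close>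

lemma comp_inv_exists:
  "\<exists>g. g holomorphic_on (- \<real>\<^sub>\<le>\<^sub>0) \<and> (\<forall>z \<in> - \<real>\<^sub>\<le>\<^sub>0. comp_map (g z) = z) \<and> g 1 = 1"
proof -
  \<comment> \<open>In terms of u: s = sinh(3u), \<open>csqrt (27 * z + 1)\<close> = cosh(3u), so e
    = exp(3u), a = exp(u), and (a - 1/a)/2 = sinh u.\<close>
  define s where "s = (\<lambda>z. of_real (3 * sqrt 3) * csqrt z)"
  define e where "e = (\<lambda>z. s z + csqrt (27 * z + 1))"
  define a where "a = (\<lambda>z. exp (Ln (e z) / 3))"
  define g where "g = (\<lambda>z. 4/3 * ((a z - inverse (a z)) / 2)^2)"
  have slit: "27 * z + 1 \<notin> \<real>\<^sub>\<le>\<^sub>0" if "z \<notin> \<real>\<^sub>\<le>\<^sub>0" for z :: complex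
    using that by (auto simp: complex_nonpos_Reals_iff)
  have s2: "(s z)^2 = 27 * z" for z
    by (simp add: s_def power_mult_distrib flip: of_real_power)
  \<comment> \<open>Off the cut both square roots have positive real part, so e stays in the right
    half-plane, where the principal logarithm in the cube root is holomorphic.\<close>
  have epos: "0 < Re (e z)" if "z \<notin> \<real>\<^sub>\<le>\<^sub>0" for z
  proof -
    have "Re (e z) = 3 * sqrt 3 * Re (csqrt z) + Re (csqrt (27 * z + 1))"
      by (simp only: e_def s_def plus_complex.sel times_complex.sel Re_complex_of_real
          Im_complex_of_real mult_zero_left diff_zero)
    moreover have "0 < 3 * sqrt 3 * Re (csqrt z)" using Re_csqrt_pos[OF that] by (intro mult_pos_pos) auto
    ultimately show ?thesis using Re_csqrt_pos[OF slit[OF that]] by linarith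
  qed
  have einv: "inverse (e z) = csqrt (27 * z + 1) - s z" for z
  proof (rule inverse_unique)
    have "e z * (csqrt (27 * z + 1) - s z) = (csqrt (27 * z + 1))^2 - (s z)^2"
      by (simp add: e_def algebra_simps power2_eq_square)
    then show "e z * (csqrt (27 * z + 1) - s z) = 1" by (simp add: s2)
  qed
  have a3: "a z ^ 3 = e z" if "z \<notin> \<real>\<^sub>\<le>\<^sub>0" for z
  proof -
    have "e z \<noteq> 0" using epos[OF that] by auto
    then show ?thesis by (simp add: a_def flip: exp_of_nat_mult)
  qed
  have a0: "a z \<noteq> 0" for z by (simp add: a_def)
  have P: "comp_map (g z) = z" if z: "z \<notin> \<real>\<^sub>\<le>\<^sub>0" for z
  proof -
    define h where "h = (a z - inverse (a z)) / 2"
    have "3 * h + 4 * h^3 = (a z ^ 3 - inverse (a z ^ 3)) / 2"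
      using a0[of z] by (simp add: h_def field_simps power3_eq_cube)
    also have "\<dots> = s z" unfolding a3[OF z] einv by (simp add: e_def)
    finally have h: "3 * h + 4 * h^3 = s z" .
    have gz: "g z = 4/3 * h^2" by (simp add: g_def h_def)
    have "comp_map (g z) = (3 * h + 4 * h^3)^2 / 27"
      unfolding comp_map_factor gz by (simp add: field_simps power2_eq_square power3_eq_cube)
    also have "\<dots> = z" unfolding h s2 by simp
    finally show ?thesis .
  qed
  \<comment> \<open>At z = 1 all quantities are real, so g 1 is a nonnegative real preimage of 1,
    and \<open>comp_map_roots_real\<close> leaves only 1.\<close>
  have g1: "g 1 = 1"
  proof -
    define er where "er = 3 * sqrt 3 + sqrt 28"
    have er: "er > 0" by (simp add: er_def add_pos_pos)
    have "csqrt 28 = of_real (sqrt 28)" using csqrt_of_real_nonneg[of 28] by simp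
    then have e1: "e 1 = of_real er" by (simp add: e_def s_def er_def)
    have "Ln (of_real er) / 3 = complex_of_real (ln er / 3)" using er by (simp add: Ln_of_real)
    then have "a 1 = of_real (exp (ln er / 3))" by (simp only: a_def e1 exp_of_real)
    then have "g 1 = of_real (4/3 * ((exp (ln er / 3) - inverse (exp (ln er / 3))) / 2)^2)"
      by (simp add: g_def)
    then have "Re (g 1) = 4/3 * ((exp (ln er / 3) - inverse (exp (ln er / 3))) / 2)^2"
      by (simp only: Re_complex_of_real)
    then have "0 \<le> Re (g 1)" by (rule ssubst) simp
    moreover have "comp_map (g 1) = comp_map (of_real 1)" using P[of 1] by simp
    ultimately show ?thesis using comp_map_roots_real[of 1 "g 1"] by auto
  qed
  have "g holomorphic_on (- \<real>\<^sub>\<le>\<^sub>0)"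
  proof -
    have "e z \<notin> \<real>\<^sub>\<le>\<^sub>0" if "z \<notin> \<real>\<^sub>\<le>\<^sub>0" for z
      using epos[OF that] by (auto simp: complex_nonpos_Reals_iff)
    moreover have "e holomorphic_on (- \<real>\<^sub>\<le>\<^sub>0)"
      unfolding e_def s_def using slit by (intro holomorphic_intros) auto
    ultimately have "a holomorphic_on (- \<real>\<^sub>\<le>\<^sub>0)"
      unfolding a_def by (intro holomorphic_intros) auto
    then show ?thesis unfolding g_def using a0 by (intro holomorphic_intros) auto
  qed
  with P g1 show ?thesis by (intro exI[of _ g]) auto
qed

lemma comp_inv_props:
  shows "comp_inv holomorphic_on (- \<real>\<^sub>\<le>\<^sub>0)" "z \<notin> \<real>\<^sub>\<le>\<^sub>0 \<Longrightarrow> comp_map (comp_inv z) = z" "comp_inv 1 = 1"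
  using someI_ex[OF comp_inv_exists] unfolding comp_inv_def[symmetric] by auto

text \<open>The other preimages of a positive real have negative real part, so the branch cannot leave
  the positive axis by continuity.\<close>

lemma comp_inv_comp_map:
  assumes "p > 0" shows "comp_inv (comp_map (of_real p)) = of_real p"
proof -
  define h where "h = (\<lambda>p::real. comp_inv (comp_map (of_real p)))"
  have slit: "comp_map (of_real p) \<notin> \<real>\<^sub>\<le>\<^sub>0" if "p > 0" for p
    unfolding comp_map_of_real nonpos_Reals_of_real_iff using that by (simp add: not_le)
  have "continuous_on {0<..} (\<lambda>p::real. comp_map (of_real p))"
    unfolding comp_map_def by (intro continuous_intros)
  then have "continuous_on {0<..} h" unfolding h_def
    by (rule continuous_on_compose2[OF holomorphic_on_imp_continuous_on[OF comp_inv_props(1)]]) (use slit in auto)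
  then have "connected ((\<lambda>p. Re (h p)) ` {0<..})"
    by (rule connected_continuous_image[OF continuous_on_Re connected_Ioi])
  note conn = connectedD_interval[OF this]
  have root: "h p = of_real p \<or> Re (h p) < 0" if "p > 0" for p
    using comp_map_roots_real[OF that] comp_inv_props(2)[OF slit[OF that]] by (simp add: h_def)
  have "\<not> Re (h p) < 0"
  proof
    assume "Re (h p) < 0"
    moreover have "h 1 = 1" by (simp add: h_def comp_inv_props(3))
    ultimately have "0 \<in> (\<lambda>p. Re (h p)) ` {0<..}"
      using conn[OF imageI[of p] imageI[of 1], of 0] assms by simp
    then obtain q where q: "q > 0" "Re (h q) = 0" by auto
    then show False using root[of q] by auto
  qed
  then show ?thesis using root[OF assms] by (auto simp: h_def)
qed

section \<open>The Poincare function on the real axis: positivity, monotonicity, limit at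
  -\<infinity>\<close>

definition real_poincare :: "real \<Rightarrow> real" where
  "real_poincare t = Re (poincare_fn (of_real t))"

definition real_poincare' :: "real \<Rightarrow> real" where
  "real_poincare' t = Re (deriv poincare_fn (of_real t))"

lemma poincare_of_real: "poincare_fn (of_real t) = of_real (real_poincare t)"
  using poincare_cnj[of "of_real t"] by (simp add: real_poincare_def complex_eq_iff)

lemma real_poincare_double: "real_poincare (2 * t) = (real_poincare t + 2 * real_poincare t ^ 2 + real_poincare t ^ 3) / 4"
proof -
  have "complex_of_real (real_poincare (2 * t)) = comp_map (of_real (real_poincare t))"
    using poincare_double[of "of_real t"] by (simp add: poincare_of_real[symmetric])
  also have "\<dots> = of_real ((real_poincare t + 2 * real_poincare t ^ 2 + real_poincare t ^ 3) / 4)"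
    by (simp add: comp_map_def)
  finally show ?thesis by (simp only: of_real_eq_iff)
qed

lemma real_poincare_near_0: "\<bar>t\<bar> \<le> 1/4 \<Longrightarrow> \<bar>real_poincare t - 1 - t\<bar> \<le> 3 * t^2"
proof -
  assume "\<bar>t\<bar> \<le> 1/4"
  then have "norm (poincare_fn (of_real t) - 1 - of_real t) \<le> 3 * (norm (complex_of_real t))^2"
    by (intro poincare_near_0) simp
  moreover have "real_poincare t - 1 - t = Re (poincare_fn (of_real t) - 1 - of_real t)"
    by (simp add: real_poincare_def)
  ultimately show ?thesis
    using abs_Re_le_cmod[of "poincare_fn (of_real t) - 1 - of_real t"] by simp
qed

lemma real_poincare_deriv: "(real_poincare has_real_derivative real_poincare' t) (at t)"
proof -
  have "(poincare_fn has_field_derivative deriv poincare_fn (of_real t)) (at (of_real t))"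
    by (rule holomorphic_derivI[OF holomorphic_poincare[OF holomorphic_on_ident] open_UNIV]) simp
  then have "((\<lambda>t. poincare_fn (of_real t)) has_vector_derivative deriv poincare_fn (of_real t)) (at t)"
    by (rule has_vector_derivative_real_field)
  then have "((\<lambda>t. Re (poincare_fn (of_real t))) has_vector_derivative Re (deriv poincare_fn (of_real t))) (at t)"
    by (rule bounded_linear.has_vector_derivative[OF bounded_linear_Re])
  then show ?thesis
    unfolding real_poincare_def[abs_def] real_poincare'_def by (simp add: has_real_derivative_iff_has_vector_derivative)
qed

lemma continuous_real_poincare': "continuous_on UNIV real_poincare'"
proof -
  have "deriv poincare_fn holomorphic_on UNIV"
    by (intro holomorphic_deriv holomorphic_poincare holomorphic_on_ident) auto
  then have "continuous_on UNIV (deriv poincare_fn)" by (rule holomorphic_on_imp_continuous_on)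
  then show ?thesis unfolding real_poincare'_def[abs_def]
    by (rule continuous_on_Re[OF continuous_on_compose2[OF _ continuous_on_of_real[OF continuous_on_id]]]) auto
qed

lemma real_poincare'_double:
  "real_poincare' (2 * t) = real_poincare' t * (1 + 4 * real_poincare t + 3 * real_poincare t ^ 2) / 8"
proof -
  have "((\<lambda>t. real_poincare (2 * t)) has_real_derivative real_poincare' (2 * t) * 2) (at t)"
    by (rule DERIV_chain2[OF real_poincare_deriv]) (auto intro!: derivative_eq_intros)
  moreover have "((\<lambda>t. (real_poincare t + 2 * real_poincare t ^ 2 + real_poincare t ^ 3) / 4) has_real_derivative
     real_poincare' t * (1 + 4 * real_poincare t + 3 * real_poincare t ^ 2) / 4) (at t)"
    by (auto intro!: derivative_eq_intros real_poincare_deriv simp: field_simps power2_eq_square)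
  ultimately have "real_poincare' (2 * t) * 2 = real_poincare' t * (1 + 4 * real_poincare t + 3 * real_poincare t ^ 2) / 4"
    unfolding real_poincare_double by (rule DERIV_unique)
  then show ?thesis by simp
qed

lemma real_poincare_0: "real_poincare 0 = 1" by (simp add: real_poincare_def)

lemma real_poincare'_0: "real_poincare' 0 = 1"
proof (rule DERIV_unique[OF real_poincare_deriv])
  have "((\<lambda>h. (real_poincare h - real_poincare 0) / h - 1) \<longlongrightarrow> 0) (at 0)"
  proof (rule Lim_null_comparison)
    have "norm ((real_poincare h - real_poincare 0) / h - 1) \<le> 3 * \<bar>h\<bar>" if "h \<noteq> 0" "\<bar>h\<bar> \<le> 1/4" for h
    proof -
      have "(real_poincare h - real_poincare 0) / h - 1 = (real_poincare h - 1 - h) / h"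
        using that by (simp add: real_poincare_0 field_simps)
      then have "norm ((real_poincare h - real_poincare 0) / h - 1) = \<bar>real_poincare h - 1 - h\<bar> / \<bar>h\<bar>"
        by (simp add: abs_divide)
      also have "\<dots> \<le> 3 * h^2 / \<bar>h\<bar>" using real_poincare_near_0[OF that(2)] by (intro divide_right_mono) auto
      also have "\<dots> = 3 * \<bar>h\<bar>" using that(1) by (simp add: power2_eq_square abs_mult_self_eq[of h, symmetric] del: abs_mult_self_eq)
      finally show ?thesis .
    qed
    then show "\<forall>\<^sub>F h in at 0. norm ((real_poincare h - real_poincare 0) / h - 1) \<le> 3 * \<bar>h\<bar>"
      unfolding eventually_at by (intro exI[of _ "1/4"]) (auto simp: dist_real_def)
    show "((\<lambda>h. 3 * \<bar>h\<bar>) \<longlongrightarrow> (0::real)) (at 0)" by (auto intro!: tendsto_eq_intros)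
  qed
  then show "(real_poincare has_real_derivative 1) (at 0)"
    unfolding has_field_derivative_iff by (simp add: LIM_zero_iff)
qed

lemma scaled_to_zero: "\<exists>n. \<bar>t / 2^n\<bar> < (d::real)" if "d > 0"
proof -
  obtain n where "\<bar>t\<bar> / d < 2^n" using real_arch_pow[of 2 "\<bar>t\<bar> / d"] by auto
  then show ?thesis using that by (intro exI[of _ n]) (simp add: field_simps abs_divide)
qed

text \<open>P preserves positivity, so positivity passes from t to 2t and it suffices to know it
  near 0, where the value is close to 1.\<close>

lemma real_poincare_pos: "real_poincare t > 0"
proof -
  have step: "real_poincare (2 * t) > 0" if "real_poincare t > 0" for t
    using that unfolding real_poincare_double by (simp add: add_pos_pos)
  have up: "real_poincare (t / 2^n) > 0 \<Longrightarrow> real_poincare t > 0" for n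
  proof (induction n)
    case (Suc n)
    then show ?case using step[of "t / 2^Suc n"] by simp
  qed simp
  obtain n where n: "\<bar>t / 2^n\<bar> < 1/4" using scaled_to_zero[of "1/4"] by auto
  define y where "y = t / 2^n"
  have "y^2 \<le> 1/16" using n power_mono[of "\<bar>y\<bar>" "1/4" 2] by (simp add: y_def[symmetric] power2_eq_square)
  then have "real_poincare y > 0" using real_poincare_near_0[of y] n unfolding y_def[symmetric] by linarith
  then show ?thesis using up[of n] by (simp add: y_def)
qed

text \<open>The same descent for the derivative, whose doubling factor 1 + 4p + 3p^2 is positive; it
  starts from the value 1 at 0 and continuity. Monotonicity is what the substitution z = Pi(t)
  needs.\<close>

lemma real_poincare'_pos: "real_poincare' t > 0"
proof -
  have step: "real_poincare' (2 * t) > 0" if "real_poincare' t > 0" for t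
    using that real_poincare_pos[of t] unfolding real_poincare'_double by (simp add: add_pos_pos)
  have up: "real_poincare' (t / 2^n) > 0 \<Longrightarrow> real_poincare' t > 0" for n
  proof (induction n)
    case (Suc n)
    then show ?case using step[of "t / 2^Suc n"] by simp
  qed simp
  have "isCont real_poincare' 0" using continuous_real_poincare' by (simp add: continuous_on_eq_continuous_at)
  then have "\<forall>\<^sub>F y in at 0. real_poincare' y > 0"
    unfolding isCont_def using real_poincare'_0 by (intro order_tendstoD) auto
  then obtain d where d: "d > 0" "\<And>y. y \<noteq> 0 \<Longrightarrow> \<bar>y\<bar> < d \<Longrightarrow> real_poincare' y > 0"
    by (auto simp: eventually_at dist_real_def)
  then have d2: "\<bar>y\<bar> < d \<Longrightarrow> real_poincare' y > 0" for y by (cases "y = 0") (auto simp: real_poincare'_0)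
  obtain n where "\<bar>t / 2^n\<bar> < d" using scaled_to_zero[OF d(1)] by blast
  then show ?thesis using d2 up by blast
qed

lemma real_poincare_less_1: "t < 0 \<Longrightarrow> real_poincare t < 1"
  using norm_poincare_less_1[of "of_real t"] real_poincare_pos[of t] by (simp add: poincare_of_real)

lemma real_poincare_decay: "\<exists>C\<ge>0. \<forall>t\<le>0. real_poincare t \<le> C / (1 + t^2)"
proof -
  obtain C where C: "C \<ge> 0" "\<And>z. Re z \<le> 0 \<Longrightarrow> norm (poincare_fn z) \<le> C / (1 + (norm z)^2)"
    using poincare_decay by blast
  have "real_poincare t \<le> C / (1 + t^2)" if "t \<le> 0" for t
    using C(2)[of "of_real t"] that real_poincare_pos[of t] by (simp add: poincare_of_real)
  then show ?thesis using C(1) by blast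
qed

lemma real_poincare_at_bot: "(real_poincare \<longlongrightarrow> 0) at_bot"
proof -
  obtain C where C: "\<And>t. t \<le> 0 \<Longrightarrow> real_poincare t \<le> C / (1 + t^2)" using real_poincare_decay by blast
  show ?thesis
  proof (rule Lim_null_comparison)
    show "\<forall>\<^sub>F t in at_bot. norm (real_poincare t) \<le> C / (1 + t^2)"
      using eventually_le_at_bot[of 0] by eventually_elim (use C real_poincare_pos in \<open>auto simp: abs_of_pos\<close>)
    show "((\<lambda>t. C / (1 + t^2)) \<longlongrightarrow> 0) at_bot" by real_asymp
  qed
qed

text \<open>As Pi(t/2) > 0, the inverse branch sends Pi(t) to Pi(t/2). Hence the N-th term of the
  defining limit is 2^N (Pi(t/2^N) - 1), which tends to t by the expansion at 0.\<close>

lemma schroeder_poincare: "schroeder_fn (of_real (real_poincare t)) = of_real t"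
proof -
  have one: "comp_inv (poincare_fn (of_real s)) = poincare_fn (of_real (s / 2))" for s
    using comp_inv_comp_map[OF real_poincare_pos[of "s / 2"]] poincare_double[of "of_real (s / 2)"]
    by (simp add: poincare_of_real[symmetric])
  have pow: "(comp_inv ^^ N) (poincare_fn (of_real t)) = poincare_fn (of_real (t / 2^N))" for N
  proof (induction N)
    case (Suc N)
    then show ?case using one[of "t / 2^N"] by (simp add: mult.commute)
  qed simp
  have "(\<lambda>N. 2^N * ((comp_inv ^^ N) (poincare_fn (of_real t)) - 1)) \<longlonglongrightarrow> of_real t"
  proof (rule LIM_zero_cancel, rule Lim_null_comparison)
    obtain M where M: "\<bar>t / 2^M\<bar> < 1/4" using scaled_to_zero[of "1/4"] by auto
    show "\<forall>\<^sub>F N in sequentially. norm (2^N * ((comp_inv ^^ N) (poincare_fn (of_real t)) - 1) - of_real t)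
        \<le> 3 * t^2 * inverse (2^N)"
    proof (rule eventually_sequentiallyI)
      fix N assume N: "M \<le> N"
      define y where "y = t / 2^N"
      have "\<bar>t\<bar> / 2^N \<le> \<bar>t\<bar> / 2^M" using N by (intro divide_left_mono power_increasing) auto
      then have y: "norm (complex_of_real y) \<le> 1/4"
      proof -
        have "\<bar>t\<bar> / 2^M < 1/4" using M by (simp only: abs_divide power_abs abs_numeral)
        moreover have "norm (complex_of_real y) = \<bar>t\<bar> / 2^N" by (simp add: y_def norm_divide norm_power)
        ultimately show ?thesis using \<open>\<bar>t\<bar> / 2^N \<le> \<bar>t\<bar> / 2^M\<close> by linarith
      qed
      have t: "t = 2^N * y" by (simp add: y_def)
      have "2^N * (poincare_fn (of_real y) - 1) - of_real t = 2^N * (poincare_fn (of_real y) - 1 - of_real y)"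
        by (simp add: t algebra_simps)
      then have "norm (2^N * (poincare_fn (of_real y) - 1) - of_real t) = 2^N * norm (poincare_fn (of_real y) - 1 - of_real y)"
        by (simp add: norm_mult norm_power)
      also have "\<dots> \<le> 2^N * (3 * (norm (complex_of_real y))^2)" by (intro mult_left_mono poincare_near_0 y) auto
      also have "\<dots> = 3 * t^2 * inverse (2^N)" by (simp add: t power2_eq_square field_simps)
      finally show "norm (2^N * ((comp_inv ^^ N) (poincare_fn (of_real t)) - 1) - of_real t) \<le> 3 * t^2 * inverse (2^N)"
        by (simp add: pow y_def)
    qed
    show "(\<lambda>N. 3 * t^2 * inverse (2^N)) \<longlonglongrightarrow> 0"
      by (intro tendsto_mult_right_zero LIMSEQ_inverse_realpow_zero) auto
  qed
  then show ?thesis unfolding schroeder_fn_def by (simp add: poincare_of_real limI)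
qed

text \<open>Under z = Pi(t) the integrand becomes t^2 (4 Pi + 3 Pi^2) Pi' = t^2 W'(t), because W = 2
  Pi^2 + Pi^3. Integration by parts gives -2 times the integral of t W; the boundary terms t^2 W
  vanish at 0 and, by the decay |t|^-4 of W, at -\<infinity>.\<close>

lemma schroeder_weight_integral:
  shows "interval_lebesgue_integrable lborel 0 1 (\<lambda>z. schroeder_fn (of_real z) ^ 2 * of_real (4 * z + 3 * z^2))"
    and "(LBINT z=0..1. schroeder_fn (of_real z) ^ 2 * of_real (4 * z + 3 * z^2))
       = -2 * (LBINT t=-\<infinity>..0. of_real t * weight_fn (of_real t))"
proof -
  define p where "p = real_poincare"
  define p' where "p' = real_poincare'"
  note pd = real_poincare_deriv[folded p_def p'_def] and p_pos = real_poincare_pos[folded p_def]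
    and p'_pos = real_poincare'_pos[folded p'_def] and p_bot = real_poincare_at_bot[folded p_def]
    and p_less = real_poincare_less_1[folded p_def]
  have p'_cont: "isCont p' x" for x
    using continuous_real_poincare' by (simp add: continuous_on_eq_continuous_at p'_def)
  have p_cont: "isCont p x" for x using pd by (rule DERIV_isCont)
  have p_left: "(p \<longlongrightarrow> 1) (at_left 0)"
    using p_cont[of 0] real_poincare_0 by (auto simp: isCont_def p_def intro: tendsto_mono[OF at_le])
  define W where "W = (\<lambda>t. 2 * p t ^ 2 + p t ^ 3)"
  have weight: "weight_fn (of_real t) = of_real (W t)" for t
    by (simp add: weight_fn_def W_def poincare_of_real p_def)
  define f where "f = (\<lambda>z. (Re (schroeder_fn (of_real z)))^2 * (4 * z + 3 * z^2))"
  have fp: "f (p t) = t^2 * (4 * p t + 3 * p t ^ 2)" for t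
    by (simp add: f_def p_def schroeder_poincare)
  obtain C where C: "C \<ge> 0" "\<And>t. t \<le> 0 \<Longrightarrow> p t \<le> C / (1 + t^2)" using real_poincare_decay by (auto simp: p_def)
  \<comment> \<open>p' is nonnegative and its primitive p increases from 0 at -\<infinity> to 1 at
    0, so p' is integrable. It serves as the majorant below.\<close>
  have p'_int: "set_integrable lborel (einterval (-\<infinity>) 0) p'"
    by (rule interval_integral_FTC_nonneg(1)[where F = p and A = 0 and B = 1])
       (use pd p'_cont p'_pos p_bot p_left in \<open>auto simp: ereal_tendsto_simps zero_ereal_def intro!: AE_I2 less_imp_le\<close>)
  \<comment> \<open>For t < 0 one has 0 < p < 1, hence t^2 (4p + 3p^2) \<le> 7 t^2 p \<le> 7 C: this
    bounds the factor in front of p'.\<close>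
  have fint: "set_integrable lborel (einterval (-\<infinity>) 0) (\<lambda>t. f (p t) * p' t)"
  proof (rule set_integrable_bound[OF set_integrable_mult_right[OF p'_int, of "7 * C"]])
    show "set_borel_measurable lborel (einterval (-\<infinity>) 0) (\<lambda>t. f (p t) * p' t)"
    proof -
      have "continuous_on (einterval (-\<infinity>) 0) (\<lambda>t. f (p t) * p' t)"
        unfolding fp using p_cont p'_cont
        by (intro continuous_intros) (auto simp: continuous_at_imp_continuous_on)
      from borel_measurable_continuous_on_indicator[OF borel_einterval this]
      show ?thesis by (simp add: set_borel_measurable_def)
    qed
    have "norm (f (p t) * p' t) \<le> norm (7 * C * p' t)" if t: "t < 0" for t
    proof -
      have "p t ^ 2 \<le> p t * 1" using p_pos[of t] p_less[OF t] unfolding power2_eq_square by (intro mult_left_mono) auto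
      then have "4 * p t + 3 * p t ^ 2 \<le> 7 * p t" by simp
      then have "t^2 * (4 * p t + 3 * p t ^ 2) \<le> t^2 * (7 * (C / (1 + t^2)))"
        using C(2)[of t] t by (intro mult_left_mono) auto
      also have "\<dots> \<le> 7 * C" using C(1) by (simp add: field_simps add_pos_nonneg)
      finally have "f (p t) * p' t \<le> 7 * C * p' t" using p'_pos[of t] unfolding fp by (intro mult_right_mono) auto
      moreover have "0 \<le> f (p t) * p' t" unfolding fp using p_pos[of t] p'_pos[of t] by (simp add: less_imp_le)
      ultimately show ?thesis by simp
    qed
    then show "AE t in lborel. t \<in> einterval (-\<infinity>) 0 \<longrightarrow> norm (f (p t) * p' t) \<le> norm (7 * C * p' t)"
      by (intro AE_I2) (auto simp: einterval_def zero_ereal_def)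
  qed
  \<comment> \<open>The Schroeder function is a left inverse of the continuous function p, so its
    continuity at p x follows from continuity of inverse functions rather than from its defining
    limit.\<close>
  have contf: "isCont f (p x)" if x: "x < 0" for x
  proof -
    have "isCont (\<lambda>z. Re (schroeder_fn (of_real z))) (p x)"
      by (rule isCont_inverse_function[of "\<bar>x\<bar>"]) (use x p_cont in \<open>auto simp: p_def schroeder_poincare\<close>)
    then show ?thesis unfolding f_def by (intro continuous_intros)
  qed
  have sub: "set_integrable lborel (einterval 0 1) f"
      "(LBINT z=0..1. f z) = (LBINT t=-\<infinity>..0. f (p t) * p' t)"
  proof -
    note S = interval_integral_substitution_nonneg[where f = f and g = p and g' = p' and a = "-\<infinity>" and b = 0 and A = 0 and B = 1]
    have "((ereal \<circ> p \<circ> real_of_ereal) \<longlongrightarrow> 0) (at_right (-\<infinity>))"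
      using p_bot by (simp add: ereal_tendsto_simps zero_ereal_def)
    moreover have "((ereal \<circ> p \<circ> real_of_ereal) \<longlongrightarrow> 1) (at_left 0)"
      using p_left by (simp add: ereal_tendsto_simps zero_ereal_def one_ereal_def)
    moreover have "0 \<le> f (p x)" for x unfolding fp using p_pos[of x] by (simp add: less_imp_le)
    ultimately show "set_integrable lborel (einterval 0 1) f"
      "(LBINT z=0..1. f z) = (LBINT t=-\<infinity>..0. f (p t) * p' t)"
      using S[OF _ pd _ p'_cont _ less_imp_le[OF p'_pos] _ _ fint] contf by (auto simp: zero_ereal_def)
  qed
  have W_int: "set_integrable lborel (einterval (-\<infinity>) 0) (\<lambda>t. t * W t)"
  proof -
    have "set_integrable lborel {0<..} (\<lambda>s. Re (- of_real s * weight_fn (- of_real s)))"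
      using negative_axis_integral(1) by (rule set_integral_Re)
    also have "(\<lambda>s. Re (- of_real s * weight_fn (- of_real s))) = (\<lambda>s. - s * W (- s))"
      using weight[of "- _"] by (auto simp: fun_eq_iff)
    finally have "interval_lebesgue_integrable lborel 0 \<infinity> (\<lambda>s. - s * W (- s))"
      by (simp add: interval_lebesgue_integral_0_infty)
    then have "interval_lebesgue_integrable lborel (-\<infinity>) 0 (\<lambda>s. s * W s)"
      using interval_integrable_mirror[of "-\<infinity>" 0 "\<lambda>s. - s * W (- s)"] by simp
    then show ?thesis by (simp add: interval_lebesgue_integrable_def)
  qed
  have parts: "(LBINT t=-\<infinity>..0. f (p t) * p' t + 2 * (t * W t)) = 0 - 0"
  proof (rule interval_integral_FTC_integrable[where F = "\<lambda>t. t^2 * W t"])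
    show "((\<lambda>t. t^2 * W t) has_vector_derivative f (p x) * p' x + 2 * (x * W x)) (at x)" for x
      unfolding has_real_derivative_iff_has_vector_derivative[symmetric] W_def fp
      by (rule derivative_eq_intros pd refl)+ (simp add: field_simps power2_eq_square)
    show "isCont (\<lambda>t. f (p t) * p' t + 2 * (t * W t)) x" for x
      unfolding W_def fp by (intro continuous_intros p_cont p'_cont)
    show "set_integrable lborel (einterval (-\<infinity>) 0) (\<lambda>t. f (p t) * p' t + 2 * (t * W t))"
      by (intro set_integral_add set_integrable_mult_right fint W_int)
    have "((\<lambda>t. t^2 * W t) \<longlongrightarrow> 0) at_bot"
    proof (rule Lim_null_comparison)
      have "norm (t^2 * W t) \<le> 3 * C^2 * (t^2 / (1 + t^2)^2)" if t: "t < 0" for t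
      proof -
        have "p t ^ 3 \<le> p t ^ 2 * 1"
          using p_pos[of t] p_less[OF t] unfolding power3_eq_cube power2_eq_square by (intro mult_left_mono) auto
        then have "W t \<le> 3 * p t ^ 2" by (simp add: W_def)
        also have "\<dots> \<le> 3 * (C / (1 + t^2))^2"
          using C(2)[of t] t p_pos[of t] by (intro mult_left_mono power_mono) auto
        finally have "t^2 * W t \<le> t^2 * (3 * (C / (1 + t^2))^2)" by (intro mult_left_mono) auto
        moreover have "0 \<le> W t" using p_pos[of t] by (simp add: W_def)
        ultimately show ?thesis by (simp add: power_divide mult_ac)
      qed
      then show "\<forall>\<^sub>F t in at_bot. norm (t^2 * W t) \<le> 3 * C^2 * (t^2 / (1 + t^2)^2)"
        using eventually_gt_at_bot[of 0] eventually_mono by (metis (mono_tags, lifting) eventually_at_bot_dense)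
      have "((\<lambda>t::real. t^2 / (1 + t^2)^2) \<longlongrightarrow> 0) at_bot" by real_asymp
      then show "((\<lambda>t. 3 * C^2 * (t^2 / (1 + t^2)^2)) \<longlongrightarrow> 0) at_bot"
        by (rule tendsto_mult_right_zero)
    qed
    then show "(((\<lambda>t. t^2 * W t) \<circ> real_of_ereal) \<longlongrightarrow> 0) (at_right (-\<infinity>))" by (simp add: ereal_tendsto_simps)
    have "isCont (\<lambda>t. t^2 * W t) 0" unfolding W_def by (intro continuous_intros p_cont)
    then have "((\<lambda>t. t^2 * W t) \<longlongrightarrow> 0) (at_left 0)"
      by (auto simp: isCont_def intro: tendsto_mono[OF at_le])
    then show "(((\<lambda>t. t^2 * W t) \<circ> real_of_ereal) \<longlongrightarrow> 0) (at_left 0)" by (simp add: ereal_tendsto_simps zero_ereal_def)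
  qed simp
  have fi: "interval_lebesgue_integrable lborel (-\<infinity>) 0 (\<lambda>t. f (p t) * p' t)"
    "interval_lebesgue_integrable lborel (-\<infinity>) 0 (\<lambda>t. t * W t)"
    using fint W_int by (simp_all add: interval_lebesgue_integrable_def)
  have "(LBINT t=-\<infinity>..0. f (p t) * p' t + 2 * (t * W t)) = (LBINT t=-\<infinity>..0. f (p t) * p' t) + 2 * (LBINT t=-\<infinity>..0. t * W t)"
    using fi by simp
  then have val: "(LBINT z=0..1. f z) = - 2 * (LBINT t=-\<infinity>..0. t * W t)" using parts sub(2) by simp
  \<comment> \<open>By the intermediate value theorem every z in (0, 1) is some p t, so the
    Schroeder function is real there and the real integrand f loses nothing.\<close>
  have feq: "schroeder_fn (of_real z) ^ 2 * of_real (4 * z + 3 * z^2) = of_real (f z)" if z: "0 < z" "z < 1" for z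
  proof -
    have "\<forall>\<^sub>F t in at_bot. p t < z" using p_bot z(1) by (rule order_tendstoD)
    then obtain t0 where t0: "t0 < 0" "p t0 < z"
      using eventually_happens'[OF _ eventually_conj[OF _ eventually_gt_at_bot[of 0]]]
      by (metis (no_types, lifting) trivial_limit_at_bot_linorder)
    obtain t where "p t = z"
      using IVT[of p t0 z 0] t0 z p_cont real_poincare_0 by (auto simp: p_def)
    then have "schroeder_fn (of_real z) = of_real t" using schroeder_poincare[of t] by (simp add: p_def)
    then show ?thesis by (simp add: f_def)
  qed
  have cong: "indicator (einterval 0 1) z *\<^sub>R (schroeder_fn (of_real z) ^ 2 * of_real (4 * z + 3 * z^2))
     = indicator (einterval 0 1) z *\<^sub>R complex_of_real (f z)" for z
    using feq[of z] by (auto simp: indicator_def einterval_def)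
  have "set_integrable lborel (einterval 0 1) (\<lambda>z. complex_of_real (f z))"
    using sub(1) by (simp add: set_integrable_def scaleR_conv_of_real flip: of_real_mult)
  then have "set_integrable lborel (einterval 0 1) (\<lambda>z. schroeder_fn (of_real z) ^ 2 * of_real (4 * z + 3 * z^2))"
    by (simp only: set_integrable_def cong)
  then show "interval_lebesgue_integrable lborel 0 1 (\<lambda>z. schroeder_fn (of_real z) ^ 2 * of_real (4 * z + 3 * z^2))"
    by (simp add: interval_lebesgue_integrable_def)
  have "(LINT z:einterval 0 1|lborel. schroeder_fn (of_real z) ^ 2 * of_real (4 * z + 3 * z^2))
     = (LINT z:einterval 0 1|lborel. complex_of_real (f z))"
    by (simp only: set_lebesgue_integral_def cong)
  then have "(LBINT z=0..1. schroeder_fn (of_real z) ^ 2 * of_real (4 * z + 3 * z^2)) = (LBINT z=0..1. complex_of_real (f z))"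
    by (simp add: interval_lebesgue_integral_def)
  also have "\<dots> = of_real (LBINT z=0..1. f z)" by (rule interval_lebesgue_integral_of_real)
  also have "\<dots> = - 2 * of_real (LBINT t=-\<infinity>..0. t * W t)" by (simp add: val)
  also have "of_real (LBINT t=-\<infinity>..0. t * W t) = (LBINT t=-\<infinity>..0. complex_of_real (t * W t))"
    by (rule interval_lebesgue_integral_of_real[symmetric])
  also have "\<dots> = (LBINT t=-\<infinity>..0. of_real t * weight_fn (of_real t))" by (simp add: weight)
  finally show "(LBINT z=0..1. schroeder_fn (of_real z) ^ 2 * of_real (4 * z + 3 * z^2))
       = -2 * (LBINT t=-\<infinity>..0. of_real t * weight_fn (of_real t))" .
qed

section \<open>Order estimates and assembly of the theorem\<close>

lemma poincare_it_bigo: "(\<lambda>t::real. norm (poincare_fn (\<i> * of_real t))) \<in> O[at_infinity](\<lambda>t. \<bar>t\<bar> powr (-2))"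
proof -
  obtain C where C: "C \<ge> 0" "\<And>t::real. norm (poincare_fn (\<i> * of_real t)) \<le> C / (1 + t^2)"
    using poincare_it_decay by blast
  show ?thesis
  proof (rule bigoI)
    show "\<forall>\<^sub>F t in at_infinity. norm (norm (poincare_fn (\<i> * of_real t))) \<le> C * norm (\<bar>t\<bar> powr (-2))"
      unfolding eventually_at_infinity
    proof (intro exI[of _ 1] allI impI)
      fix t :: real assume "1 \<le> norm t"
      then have t: "\<bar>t\<bar> > 0" by simp
      have "C / (1 + t^2) \<le> C / t^2" using C(1) t by (intro divide_left_mono) (auto simp: add_pos_nonneg)
      also have "\<dots> = C * norm (\<bar>t\<bar> powr (-2))" using t by (simp add: powr_minus divide_inverse)
      finally show "norm (norm (poincare_fn (\<i> * of_real t))) \<le> C * norm (\<bar>t\<bar> powr (-2))"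
        using C(2)[of t] by simp
    qed
  qed
qed

lemma poincare_half_plane_bigo:
  "(\<lambda>z. norm (poincare_fn z)) \<in> O[inf at_infinity (principal {z. Re z \<le> 0})](\<lambda>z. norm z powr (-2))"
proof -
  obtain C where C: "C \<ge> 0" "\<And>z. Re z \<le> 0 \<Longrightarrow> norm (poincare_fn z) \<le> C / (1 + (norm z)^2)"
    using poincare_decay by blast
  show ?thesis
  proof (rule bigoI)
    show "\<forall>\<^sub>F z in inf at_infinity (principal {z. Re z \<le> 0}).
        norm (norm (poincare_fn z)) \<le> C * norm (norm z powr (-2))"
      unfolding eventually_inf_principal eventually_at_infinity
    proof (intro exI[of _ 1] allI impI)
      fix z :: complex assume "1 \<le> norm z" "z \<in> {z. Re z \<le> 0}"
      then have z: "norm z > 0" "Re z \<le> 0" by auto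
      have "C / (1 + (norm z)^2) \<le> C / (norm z)^2"
        using C(1) z by (intro divide_left_mono) (auto simp: add_pos_nonneg)
      also have "\<dots> = C * norm (norm z powr (-2))" using z by (simp add: powr_minus divide_inverse)
      finally show "norm (norm (poincare_fn z)) \<le> C * norm (norm z powr (-2))"
        using C(2)[OF z(2)] by simp
    qed
  qed
qed

lemma negative_axis_interval_integral:
  shows "interval_lebesgue_integrable lborel (-\<infinity>) 0 (\<lambda>t. of_real t * weight_fn (of_real t))"
    and "(LBINT t=-\<infinity>..0. of_real t * weight_fn (of_real t))
       = of_real (LBINT t=0..\<infinity>. t * Re (weight_fn (\<i> * of_real t)))"
proof -
  have "interval_lebesgue_integrable lborel 0 \<infinity> (\<lambda>s. of_real (- s) * weight_fn (of_real (- s)))"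
    using negative_axis_integral(1) by (simp add: interval_lebesgue_integral_0_infty)
  then show "interval_lebesgue_integrable lborel (-\<infinity>) 0 (\<lambda>t. of_real t * weight_fn (of_real t))"
    using interval_integrable_mirror[of "-\<infinity>" 0 "\<lambda>s. of_real (- s) * weight_fn (of_real (- s))"] by simp
  have "(LBINT t=-\<infinity>..0. of_real t * weight_fn (of_real t))
      = (LBINT s=0..\<infinity>. of_real (- s) * weight_fn (of_real (- s)))"
    by (subst interval_integral_reflect) simp
  then show "(LBINT t=-\<infinity>..0. of_real t * weight_fn (of_real t))
       = of_real (LBINT t=0..\<infinity>. t * Re (weight_fn (\<i> * of_real t)))"
    using negative_axis_integral(3) by (simp add: interval_lebesgue_integral_0_infty)
qed

lemma integrable_sigma_integrand:
  "integrable lborel (\<lambda>t. H_fn (- \<i> * of_real (t * 2 powr (x + 1))) * weight_fn (\<i> * of_real t))"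
proof -
  have e: "2 powr (x + 1) = 2 * 2 powr x" by (simp add: powr_add)
  show ?thesis unfolding e by (rule integrable_H_weight)
qed

theorem theorem1p4:
  shows
    "((\<lambda>x. of_real (rescaled_density x) - of_real x * sigma_fn (log 2 x))
        \<in> o[at_right 0](\<lambda>x. of_real x))
     \<and> (\<forall>x. sigma_fn x \<in> \<real>) \<and> (\<forall>x. sigma_fn (x + 1) = sigma_fn x) \<and> continuous_on UNIV sigma_fn
     \<and> H_fn holomorphic_on UNIV
     \<and> (\<forall>z. ((\<lambda>n. z^n / (fact n * (2^(n-1) - 1))) has_sum H_fn z) {2..})
     \<and> (\<forall>z. H_fn (2 * z) = 2 * H_fn z + 2 * (exp z - 1 - z))
     \<and> (\<forall>x. integrable lborel
           (\<lambda>t. H_fn (- \<i> * of_real (t * 2 powr (x + 1))) * weight_fn (\<i> * of_real t)))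
     \<and> (\<lambda>t::real. norm (poincare_fn (\<i> * of_real t))) \<in> O[at_infinity](\<lambda>t. \<bar>t\<bar> powr (-2))
     \<and> (\<lambda>t::real. norm (H_fn (\<i> * of_real t))) \<in> O[at_infinity](\<lambda>t. \<bar>t\<bar> * ln \<bar>t\<bar>)
     \<and> (\<lambda>z. norm (poincare_fn z))
          \<in> O[inf at_infinity (principal {z. Re z \<le> 0})](\<lambda>z. norm z powr (-2))
     \<and> interval_lebesgue_integrable lborel 0 1
          (\<lambda>z. schroeder_fn (of_real z) ^ 2 * of_real (4 * z + 3 * z^2))
     \<and> interval_lebesgue_integrable lborel (-\<infinity>) 0 (\<lambda>t. of_real t * weight_fn (of_real t))
     \<and> interval_lebesgue_integrable lborel 0 \<infinity> (\<lambda>t. t * Re (weight_fn (\<i> * of_real t)))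
     \<and> interval_lebesgue_integrable lborel 0 \<infinity> (\<lambda>t. ln t * t * Im (weight_fn (\<i> * of_real t)))
     \<and> (LBINT x=0..1. sigma_fn x)
         = of_real (1 / (2 * ln 2)) *
           (LBINT z=0..1. schroeder_fn (of_real z) ^ 2 * of_real (4 * z + 3 * z^2))
     \<and> (LBINT x=0..1. sigma_fn x)
         = of_real (- 1 / ln 2) * (LBINT t=-\<infinity>..0. of_real t * weight_fn (of_real t))
     \<and> (LBINT x=0..1. sigma_fn x)
         = of_real (- 1 / ln 2 * (LBINT t=0..\<infinity>. t * Re (weight_fn (\<i> * of_real t))))
     \<and> (LBINT x=0..1. sigma_fn x)
         = of_real (- 2 / (pi * ln 2) *
             (LBINT t=0..\<infinity>. ln t * t * Im (weight_fn (\<i> * of_real t))))"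
proof -
  have mean: "(LBINT x=0..1. sigma_fn x)
         = of_real (- 1 / ln 2 * (LBINT t=0..\<infinity>. t * Re (weight_fn (\<i> * of_real t))))"
    using sigma_mean_Re by (simp only: interval_lebesgue_integral_0_infty)
  have neg: "(LBINT x=0..1. sigma_fn x)
         = of_real (- 1 / ln 2) * (LBINT t=-\<infinity>..0. of_real t * weight_fn (of_real t))"
    unfolding mean negative_axis_interval_integral(2) by (simp only: of_real_mult)
  have "(LBINT x=0..1. sigma_fn x)
         = of_real (1 / (2 * ln 2)) *
           (LBINT z=0..1. schroeder_fn (of_real z) ^ 2 * of_real (4 * z + 3 * z^2))"
    unfolding neg schroeder_weight_integral(2) by simp
  moreover have lg: "(LBINT t=0..\<infinity>. ln t * t * Im (weight_fn (\<i> * of_real t)))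
      = pi / 2 * (LBINT t=0..\<infinity>. t * Re (weight_fn (\<i> * of_real t)))"
    using Ln_weight_integral(2) by (simp only: interval_lebesgue_integral_0_infty)
  have "(LBINT x=0..1. sigma_fn x)
         = of_real (- 2 / (pi * ln 2) *
             (LBINT t=0..\<infinity>. ln t * t * Im (weight_fn (\<i> * of_real t))))"
    unfolding mean lg by simp
  moreover have "interval_lebesgue_integrable lborel 0 \<infinity> (\<lambda>t. t * Re (weight_fn (\<i> * of_real t)))"
      "interval_lebesgue_integrable lborel 0 \<infinity> (\<lambda>t. ln t * t * Im (weight_fn (\<i> * of_real t)))"
    using negative_axis_integral(2) Ln_weight_integral(1)
    by (simp_all only: interval_lebesgue_integral_0_infty)
  ultimately show ?thesis
    using rescaled_density_asymp sigma_fn_real sigma_fn_periodic continuous_sigma_fn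
      H_holomorphic H_has_sum H_double integrable_sigma_integrand poincare_it_bigo H_it_bigo
      poincare_half_plane_bigo schroeder_weight_integral(1) negative_axis_interval_integral(1)
      mean neg
    by (intro conjI allI)
qed

end
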